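(* Let $\mathscr{V}$ be a topological category over $\mathsf{Set}$, with topological functor $|-| : \mathscr{V} \to \mathsf{Set}$, equipped with a symmetric monoidal closed structure $(\otimes, I, [-,-])$ such that $|-|$ is strict symmetric monoidal with respect to the cartesian structure on $\mathsf{Set}$ and is represented by $I$, and let $\mathcal{S}$ be a set. 1. For each free-form $\mathbb{N}_{\mathcal{S}}$-signature $\mathscr{S}$, there is a $\mathscr{V}$-enriched $\mathcal{S}$-sorted signature $\Sigma_{\mathscr{S}}$ such that $\mathscr{S}\text{-}\mathsf{Alg} \cong \Sigma_{\mathscr{S}}\text{-}\mathsf{Alg}$ in $\mathscr{V}\text{-}\mathsf{CAT}/\mathscr{V}^{\mathcal{S}}$. 2. For each diagrammatic $\mathscr{S}$-equation $\mathsf{e}$, there is a set $\mathcal{E}_{\mathsf{e}}$ of algebraic $\Sigma_{\mathscr{S}}$-equations such that an $\mathscr{S}$-algebra satisfies $\mathsf{e}$ iff the corresponding $\Sigma_{\mathscr{S}}$-algebra (under the isomorphism of (1)) satisfies each algebraic $\Sigma_{\mathscr{S}}$-equation in $\mathcal{E}_{\mathsf{e}}$. 3. For each diagrammatic $\mathbb{N}_{\mathcal{S}}$-presentation $\mathscr{T}$, there is a $\mathscr{V}$-enriched $\mathcal{S}$-sorted equational theory $\mathcal{T}_{\mathscr{T}}$ such that $\mathscr{T}\text{-}\mathsf{Alg} \cong \mathcal{T}_{\mathscr{T}}\text{-}\mathsf{Alg}$ in $\mathscr{V}\text{-}\mathsf{CAT}/\mathscr{V}^{\mathcal{S}}$.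
   Context: Topological categories. A concrete category over $\mathsf{Set}$ is a category $\mathscr{V}$ with a faithful functor $|-| : \mathscr{V} \to \mathsf{Set}$; a function $f : |V| \to |W|$ is admissible if it lifts (uniquely) to a morphism $V \to W$. It is amnestic if, whenever $|V| = |V'|$ and the identity function is admissible both $V \to V'$ and $V' \to V$, then $V = V'$. A (possibly large) source $(f_i : V \to V_i)_{i}$ is initial if for all $W$ and $f : |W| \to |V|$, $f$ is admissible iff all $f_i \circ f$ are. $\mathscr{V}$ is topological over $\mathsf{Set}$ if it is amnestic and every (possibly large) structured source $(f_i : Y \to |V_i|)_i$ has an initial lift: an object $V$ with $|V| = Y$, each $f_i$ admissible, and $(f_i : V \to V_i)_i$ initial. Such $\mathscr{V}$ is complete and cocomplete, and $|-|$ strictly preserves limits and colimits. Enrichment. $\mathscr{V}$ is regarded as a $\mathscr{V}$-category, and $\mathscr{V}^{\mathcal{S}}$ as a $\mathscr{V}$-category with $\mathscr{V}^{\mathcal{S}}(X, Y) = \prod_{S \in \mathcal{S}} [X_S, Y_S]$; it is tensored with $V \otimes X = X \otimes V = (V \otimes X_S)_S$ for $V \in \mathscr{V}$, $X \in \mathscr{V}^{\mathcal{S}}$ (up to symmetry). $\mathscr{V}\text{-}\mathsf{CAT}/\mathscr{V}^{\mathcal{S}}$ is the strict slice category: objects are $\mathscr{V}$-categories equipped with a $\mathscr{V}$-functor to $\mathscr{V}^{\mathcal{S}}$, morphisms are $\mathscr{V}$-functors strictly commuting with these. Enriched multi-sorted theories. $\mathcal{S}^*$ is the set of finite sequences of elements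 of $\mathcal{S}$. A $\mathscr{V}$-enriched $\mathcal{S}$-sorted signature is a set $\Sigma$ of operation symbols, each with a type $((S_1, \ldots, S_n), S, P)$, where $(S_1, \ldots, S_n) \in \mathcal{S}^*$, $S \in \mathcal{S}$, $P \in \mathrm{ob}\,\mathscr{V}$. A $\Sigma$-algebra is an object $A$ of $\mathscr{V}^{\mathcal{S}}$ with a $\mathscr{V}$-morphism $\sigma^A : P \otimes (A_{S_1} \times \cdots \times A_{S_n}) \to A_S$ for each such $\sigma$; morphisms are morphisms $f$ of $\mathscr{V}^{\mathcal{S}}$ with $f_S \circ \sigma^A = \sigma^B \circ (1_P \otimes (f_{S_1} \times \cdots \times f_{S_n}))$. $\Sigma\text{-}\mathsf{Alg}$ is a $\mathscr{V}$-category over $\mathscr{V}^{\mathcal{S}}$ (via a faithful $\mathscr{V}$-functor $U^\Sigma$) with $\Sigma\text{-}\mathsf{Alg}(A, B) \rightarrowtail \mathscr{V}^{\mathcal{S}}(A, B)$ the joint equalizer, over all $\sigma \in \Sigma$ (of type $((S_1, \ldots, S_n), S, P)$), of the two morphisms $\mathscr{V}^{\mathcal{S}}(A, B) \rightrightarrows [P \otimes (A_{S_1} \times \cdots \times A_{S_n}), B_S]$ given by applying the $\mathscr{V}$-functor $A \mapsto P \otimes (A_{S_1} \times \cdots \times A_{S_n})$ followed by composition with $\sigma^B$, respectively by the $S$-component followed by precomposition with $\sigma^A$. An algebraic $\Sigma$-operation of type $((S_1, \ldots, S_n), S, P)$ is a natural transformation (of ordinary functors $\Sigma\text{-}\mathsf{Alg}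 \to \mathscr{V}$) with components $\omega_A : P \otimes (A_{S_1} \times \cdots \times A_{S_n}) \to A_S$. An algebraic $\Sigma$-equation $\omega \doteq \nu$ is a pair of algebraic $\Sigma$-operations of the same type; $A$ satisfies it if $\omega_A = \nu_A$. A $\mathscr{V}$-enriched $\mathcal{S}$-sorted equational theory is a pair $\mathcal{T} = (\Sigma, \mathcal{E})$ with $\mathcal{E}$ a set of algebraic $\Sigma$-equations; $\mathcal{T}\text{-}\mathsf{Alg}$ is the full sub-$\mathscr{V}$-category of $\Sigma\text{-}\mathsf{Alg}$ on the algebras satisfying all equations in $\mathcal{E}$. Arities. For $n \in \mathbb{N}$, $n \cdot I = \coprod_n I$ in $\mathscr{V}$. $\mathbb{N}_{\mathcal{S}}$ is the full sub-$\mathscr{V}$-category of $\mathscr{V}^{\mathcal{S}}$ on the objects $(n_S \cdot I)_{S \in \mathcal{S}}$ with $n_S \in \mathbb{N}$ and $n_S = 0$ for all but finitely many $S$. Diagrammatic presentations. A free-form $\mathbb{N}_{\mathcal{S}}$-signature is a set $\mathscr{S}$ of operation symbols, each equipped with an arity $J \in \mathrm{ob}\,\mathbb{N}_{\mathcal{S}}$ and a parameter $P \in \mathrm{ob}\,\mathscr{V}^{\mathcal{S}}$. An $\mathscr{S}$-algebra is an object $A$ of $\mathscr{V}^{\mathcal{S}}$ with, for each $\sigma \in \mathscr{S}$ of arity $J$ and parameter $P$, a morphism $\sigma^A : \mathscr{V}^{\mathcal{S}}(J, A) \otimes P \to A$ of $\mathscr{V}^{\mathcal{S}}$; a morphism $f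 : A \to B$ of $\mathscr{S}$-algebras is a morphism of $\mathscr{V}^{\mathcal{S}}$ with $f \circ \sigma^A = \sigma^B \circ (\mathscr{V}^{\mathcal{S}}(J, f) \otimes 1_P)$ for all $\sigma$. $\mathscr{S}\text{-}\mathsf{Alg}$ is a $\mathscr{V}$-category over $\mathscr{V}^{\mathcal{S}}$ (via a faithful $\mathscr{V}$-functor $U^{\mathscr{S}}$) with $\mathscr{S}\text{-}\mathsf{Alg}(A, B) \rightarrowtail \mathscr{V}^{\mathcal{S}}(A, B)$ the joint equalizer over $\sigma \in \mathscr{S}$ of the two morphisms $\mathscr{V}^{\mathcal{S}}(A, B) \rightrightarrows \mathscr{V}^{\mathcal{S}}(\mathscr{V}^{\mathcal{S}}(J, A) \otimes P, B)$ given by applying the $\mathscr{V}$-functor $\mathscr{V}^{\mathcal{S}}(J, -) \otimes P$ followed by composition with $\sigma^B$, respectively by precomposition with $\sigma^A$. A natural $\mathscr{S}$-operation of arity $J$ and parameter $P$ is a natural transformation $\omega : \mathscr{V}^{\mathcal{S}}(J, U^{\mathscr{S}}-) \otimes P \Rightarrow U^{\mathscr{S}}$. A diagrammatic $\mathscr{S}$-equation $\omega \doteq \nu$ is a pair of natural $\mathscr{S}$-operations with the same arity and parameter; $A$ satisfies it if $\omega_A = \nu_A$. A diagrammatic $\mathbb{N}_{\mathcal{S}}$-presentation is a pair $\mathscr{T} = (\mathscr{S}, \mathscr{E})$ with $\mathscr{S}$ a free-form $\mathbb{N}_{\mathcal{S}}$-signature and $\mathscr{E}$ a set of diagrammatic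 $\mathscr{S}$-equations; $\mathscr{T}\text{-}\mathsf{Alg}$ is the full sub-$\mathscr{V}$-category of $\mathscr{S}\text{-}\mathsf{Alg}$ on the algebras satisfying all equations in $\mathscr{E}$, regarded over $\mathscr{V}^{\mathcal{S}}$ by restricting $U^{\mathscr{S}}$. *)

theory Defs
  imports "HOL-Library.FuncSet"
begin

section \<open>The category of sets\<close>

(* The elements of a type of this class are the (small) sets: a model of second-order
   Zermelo-Fraenkel set theory without the axiom of infinity; choice comes from HOL.  Arbitrary
   HOL predicates on arbitrary types play the role of (proper) classes.  Omitting infinity only
   makes the notion more general: every Grothendieck universe with infinity is an instance, and so
   are the hereditarily finite sets. *)
class set_universe =
  fixes elts :: "'a \<Rightarrow> 'a set"
  assumes extensionality: "elts x = elts y \<Longrightarrow> x = y"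
    and foundation: "wf {(x, y). x \<in> elts y}"
    and separation: "A \<subseteq> elts x \<Longrightarrow> \<exists>z. elts z = A"
    and pairing: "\<exists>z. elts z = {x, y}"
    and union: "\<exists>z. elts z = (\<Union>y\<in>elts x. elts y)"
    and powerset: "\<exists>z. elts z = {y. elts y \<subseteq> elts x}"
    and replacement: "\<exists>z. elts z = f ` elts x"

definition set_of :: "'u::set_universe set \<Rightarrow> 'u" where
  "set_of A = (THE x. elts x = A)"

(* Smallness of a HOL set of arbitrary element type: it is the image of a set of the universe. *)
definition small :: "'u::set_universe itself \<Rightarrow> 'e set \<Rightarrow> bool" where
  "small _ X \<longleftrightarrow> (\<exists>(x::'u) f. X = f ` elts x)"

definition kpair :: "'u::set_universe \<Rightarrow> 'u \<Rightarrow> 'u" where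
  "kpair a b = set_of {set_of {a}, set_of {a, b}}"

definition kfst :: "'u::set_universe \<Rightarrow> 'u" where
  "kfst p = (THE a. \<exists>b. p = kpair a b)"

definition ksnd :: "'u::set_universe \<Rightarrow> 'u" where
  "ksnd p = (THE b. \<exists>a. p = kpair a b)"

definition cartesian :: "'u::set_universe \<Rightarrow> 'u \<Rightarrow> 'u" where
  "cartesian x y = set_of {kpair a b | a b. a \<in> elts x \<and> b \<in> elts y}"

definition singleton :: "'u::set_universe" where
  "singleton = set_of {set_of {}}"


section \<open>Categories, functors, symmetric monoidal closed categories\<close>

record ('o, 'm) category =
  Ob :: "'o set"
  Arr :: "'m set"
  Dom :: "'m \<Rightarrow> 'o"
  Cod :: "'m \<Rightarrow> 'o"
  Idt :: "'o \<Rightarrow> 'm" ("idn\<index>")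
  Cmp :: "'m \<Rightarrow> 'm \<Rightarrow> 'm" (infixl "\<cdot>\<index>" 65)

record ('o, 'm) monoidal = "('o, 'm) category" +
  TensorOb :: "'o \<Rightarrow> 'o \<Rightarrow> 'o" (infixl "\<otimes>\<index>" 75)
  TensorArr :: "'m \<Rightarrow> 'm \<Rightarrow> 'm" (infixl "\<otimes>\<^sub>1\<index>" 75)
  Unit :: "'o" ("\<I>\<index>")
  Assoc :: "'o \<Rightarrow> 'o \<Rightarrow> 'o \<Rightarrow> 'm" ("assoc\<index>")
  LUnit :: "'o \<Rightarrow> 'm" ("lunit\<index>")
  RUnit :: "'o \<Rightarrow> 'm" ("runit\<index>")
  Symm :: "'o \<Rightarrow> 'o \<Rightarrow> 'm" ("symm\<index>")

record ('o, 'm) closed = "('o, 'm) monoidal" +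
  IHom :: "'o \<Rightarrow> 'o \<Rightarrow> 'o" ("ihom\<index>")
  Eval :: "'o \<Rightarrow> 'o \<Rightarrow> 'm" ("ev\<index>")

definition Hom :: "('o, 'm, 'x) category_scheme \<Rightarrow> 'o \<Rightarrow> 'o \<Rightarrow> 'm set" ("hom\<index>") where
  "Hom C A B = {f \<in> Arr C. Dom C f = A \<and> Cod C f = B}"

locale category =
  fixes C :: "('o, 'm, 'x) category_scheme" (structure)
  assumes dom_cod: "f \<in> Arr C \<Longrightarrow> Dom C f \<in> Ob C \<and> Cod C f \<in> Ob C"
    and idn_hom: "A \<in> Ob C \<Longrightarrow> idn A \<in> hom A A"
    and cmp_hom: "f \<in> hom A B \<Longrightarrow> g \<in> hom B D \<Longrightarrow> g \<cdot> f \<in> hom A D"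
    and cmp_assoc: "f \<in> hom A B \<Longrightarrow> g \<in> hom B D \<Longrightarrow> h \<in> hom D E \<Longrightarrow> h \<cdot> g \<cdot> f = h \<cdot> (g \<cdot> f)"
    and idn_left: "f \<in> hom A B \<Longrightarrow> idn B \<cdot> f = f"
    and idn_right: "f \<in> hom A B \<Longrightarrow> f \<cdot> idn A = f"
begin

definition inverse_arrows :: "'m \<Rightarrow> 'm \<Rightarrow> bool" where
  "inverse_arrows f g \<longleftrightarrow> f \<in> hom (Dom C f) (Cod C f) \<and> g \<in> hom (Cod C f) (Dom C f)
     \<and> g \<cdot> f = idn (Dom C f) \<and> f \<cdot> g = idn (Cod C f)"

definition iso :: "'m \<Rightarrow> bool" where
  "iso f \<longleftrightarrow> (\<exists>g. inverse_arrows f g)"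

definition inv_arrow :: "'m \<Rightarrow> 'm" where
  "inv_arrow f = (THE g. inverse_arrows f g)"

end

locale symmetric_monoidal = category V
  for V :: "('o, 'm, 'x) monoidal_scheme" (structure) +
  assumes tensor_ob: "A \<in> Ob V \<Longrightarrow> B \<in> Ob V \<Longrightarrow> A \<otimes> B \<in> Ob V"
    and tensor_arr: "f \<in> hom A B \<Longrightarrow> g \<in> hom A' B' \<Longrightarrow> f \<otimes>\<^sub>1 g \<in> hom (A \<otimes> A') (B \<otimes> B')"
    and tensor_idn: "A \<in> Ob V \<Longrightarrow> B \<in> Ob V \<Longrightarrow> idn A \<otimes>\<^sub>1 idn B = idn (A \<otimes> B)"
    and tensor_cmp: "f \<in> hom A B \<Longrightarrow> g \<in> hom B D \<Longrightarrow> f' \<in> hom A' B' \<Longrightarrow> g' \<in> hom B' D' \<Longrightarrow>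
          (g \<cdot> f) \<otimes>\<^sub>1 (g' \<cdot> f') = (g \<otimes>\<^sub>1 g') \<cdot> (f \<otimes>\<^sub>1 f')"
    and unit_ob: "\<I> \<in> Ob V"
    and assoc_hom: "A \<in> Ob V \<Longrightarrow> B \<in> Ob V \<Longrightarrow> D \<in> Ob V \<Longrightarrow>
          assoc A B D \<in> hom (A \<otimes> B \<otimes> D) (A \<otimes> (B \<otimes> D)) \<and> iso (assoc A B D)"
    and lunit_hom: "A \<in> Ob V \<Longrightarrow> lunit A \<in> hom (\<I> \<otimes> A) A \<and> iso (lunit A)"
    and runit_hom: "A \<in> Ob V \<Longrightarrow> runit A \<in> hom (A \<otimes> \<I>) A \<and> iso (runit A)"
    and symm_hom: "A \<in> Ob V \<Longrightarrow> B \<in> Ob V \<Longrightarrow> symm A B \<in> hom (A \<otimes> B) (B \<otimes> A)"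
    and assoc_natural: "f \<in> hom A A' \<Longrightarrow> g \<in> hom B B' \<Longrightarrow> h \<in> hom D D' \<Longrightarrow>
          assoc A' B' D' \<cdot> (f \<otimes>\<^sub>1 g \<otimes>\<^sub>1 h) = (f \<otimes>\<^sub>1 (g \<otimes>\<^sub>1 h)) \<cdot> assoc A B D"
    and lunit_natural: "f \<in> hom A B \<Longrightarrow> lunit B \<cdot> (idn \<I> \<otimes>\<^sub>1 f) = f \<cdot> lunit A"
    and runit_natural: "f \<in> hom A B \<Longrightarrow> runit B \<cdot> (f \<otimes>\<^sub>1 idn \<I>) = f \<cdot> runit A"
    and symm_natural: "f \<in> hom A A' \<Longrightarrow> g \<in> hom B B' \<Longrightarrow>
          symm A' B' \<cdot> (f \<otimes>\<^sub>1 g) = (g \<otimes>\<^sub>1 f) \<cdot> symm A B"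
    and pentagon: "A \<in> Ob V \<Longrightarrow> B \<in> Ob V \<Longrightarrow> D \<in> Ob V \<Longrightarrow> E \<in> Ob V \<Longrightarrow>
          assoc A B (D \<otimes> E) \<cdot> assoc (A \<otimes> B) D E
          = (idn A \<otimes>\<^sub>1 assoc B D E) \<cdot> assoc A (B \<otimes> D) E \<cdot> (assoc A B D \<otimes>\<^sub>1 idn E)"
    and triangle: "A \<in> Ob V \<Longrightarrow> B \<in> Ob V \<Longrightarrow>
          (idn A \<otimes>\<^sub>1 lunit B) \<cdot> assoc A \<I> B = runit A \<otimes>\<^sub>1 idn B"
    and hexagon: "A \<in> Ob V \<Longrightarrow> B \<in> Ob V \<Longrightarrow> D \<in> Ob V \<Longrightarrow>
          assoc B D A \<cdot> symm A (B \<otimes> D) \<cdot> assoc A B D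
          = (idn B \<otimes>\<^sub>1 symm A D) \<cdot> assoc B A D \<cdot> (symm A B \<otimes>\<^sub>1 idn D)"
    and symm_symm: "A \<in> Ob V \<Longrightarrow> B \<in> Ob V \<Longrightarrow> symm B A \<cdot> symm A B = idn (A \<otimes> B)"

locale symmetric_monoidal_closed = symmetric_monoidal V
  for V :: "('o, 'm) closed" (structure) +
  assumes ihom_ob: "A \<in> Ob V \<Longrightarrow> B \<in> Ob V \<Longrightarrow> ihom A B \<in> Ob V"
    and ev_hom: "A \<in> Ob V \<Longrightarrow> B \<in> Ob V \<Longrightarrow> ev A B \<in> hom (ihom A B \<otimes> A) B"
    and ev_universal: "A \<in> Ob V \<Longrightarrow> B \<in> Ob V \<Longrightarrow> D \<in> Ob V \<Longrightarrow> f \<in> hom (A \<otimes> B) D \<Longrightarrow>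
          \<exists>!g. g \<in> hom A (ihom B D) \<and> ev B D \<cdot> (g \<otimes>\<^sub>1 idn B) = f"

definition is_functor :: "('o, 'm, 'x) category_scheme \<Rightarrow> ('p, 'n, 'y) category_scheme \<Rightarrow>
    ('o \<Rightarrow> 'p) \<Rightarrow> ('m \<Rightarrow> 'n) \<Rightarrow> bool" where
  "is_functor C D Fo Fa \<longleftrightarrow> category C \<and> category D
     \<and> (\<forall>A\<in>Ob C. Fo A \<in> Ob D)
     \<and> (\<forall>A B. \<forall>f\<in>hom\<^bsub>C\<^esub> A B. Fa f \<in> hom\<^bsub>D\<^esub> (Fo A) (Fo B))
     \<and> (\<forall>A\<in>Ob C. Fa (idn\<^bsub>C\<^esub> A) = idn\<^bsub>D\<^esub> (Fo A))
     \<and> (\<forall>A B E. \<forall>f\<in>hom\<^bsub>C\<^esub> A B. \<forall>g\<in>hom\<^bsub>C\<^esub> B E. Fa (g \<cdot>\<^bsub>C\<^esub> f) = Fa g \<cdot>\<^bsub>D\<^esub> Fa f)"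

definition faithful :: "('o, 'm, 'x) category_scheme \<Rightarrow> ('m \<Rightarrow> 'n) \<Rightarrow> bool" where
  "faithful C Fa \<longleftrightarrow> (\<forall>A B. inj_on Fa (hom\<^bsub>C\<^esub> A B))"

definition strict_symmetric_monoidal :: "('o, 'm, 'x) monoidal_scheme \<Rightarrow>
    ('p, 'n, 'y) monoidal_scheme \<Rightarrow> ('o \<Rightarrow> 'p) \<Rightarrow> ('m \<Rightarrow> 'n) \<Rightarrow> bool" where
  "strict_symmetric_monoidal C D Fo Fa \<longleftrightarrow> is_functor C D Fo Fa
     \<and> (\<forall>A\<in>Ob C. \<forall>B\<in>Ob C. Fo (A \<otimes>\<^bsub>C\<^esub> B) = Fo A \<otimes>\<^bsub>D\<^esub> Fo B)
     \<and> (\<forall>f\<in>Arr C. \<forall>g\<in>Arr C. Fa (f \<otimes>\<^sub>1\<^bsub>C\<^esub> g) = Fa f \<otimes>\<^sub>1\<^bsub>D\<^esub> Fa g)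
     \<and> Fo \<I>\<^bsub>C\<^esub> = \<I>\<^bsub>D\<^esub>
     \<and> (\<forall>A\<in>Ob C. \<forall>B\<in>Ob C. \<forall>E\<in>Ob C.
          Fa (assoc\<^bsub>C\<^esub> A B E) = assoc\<^bsub>D\<^esub> (Fo A) (Fo B) (Fo E))
     \<and> (\<forall>A\<in>Ob C. Fa (lunit\<^bsub>C\<^esub> A) = lunit\<^bsub>D\<^esub> (Fo A))
     \<and> (\<forall>A\<in>Ob C. Fa (runit\<^bsub>C\<^esub> A) = runit\<^bsub>D\<^esub> (Fo A))
     \<and> (\<forall>A\<in>Ob C. \<forall>B\<in>Ob C. Fa (symm\<^bsub>C\<^esub> A B) = symm\<^bsub>D\<^esub> (Fo A) (Fo B))"


section \<open>Topological categories over Set\<close>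

(* A function between sets together with its domain and codomain; the middle component is
   extensional, so that equality of triples is equality of functions. *)
type_synonym 'u set_arrow = "'u \<times> ('u \<Rightarrow> 'u) \<times> 'u"

definition set_arrow :: "'u::set_universe \<Rightarrow> ('u \<Rightarrow> 'u) \<Rightarrow> 'u \<Rightarrow> 'u set_arrow" where
  "set_arrow x f y = (x, restrict f (elts x), y)"

definition SET :: "('u::set_universe, 'u set_arrow) monoidal" where
  "SET = \<lparr>
     Ob = UNIV,
     Arr = {(x, f, y). f \<in> elts x \<rightarrow>\<^sub>E elts y},
     Dom = (\<lambda>(x, f, y). x),
     Cod = (\<lambda>(x, f, y). y),
     Idt = (\<lambda>x. set_arrow x (\<lambda>a. a) x),
     Cmp = (\<lambda>(y', g, z) (x, f, y). set_arrow x (\<lambda>a. g (f a)) z),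
     TensorOb = cartesian,
     TensorArr = (\<lambda>(x, f, y) (x', f', y').
       set_arrow (cartesian x x') (\<lambda>p. kpair (f (kfst p)) (f' (ksnd p))) (cartesian y y')),
     Unit = singleton,
     Assoc = (\<lambda>x y z. set_arrow (cartesian (cartesian x y) z)
       (\<lambda>p. kpair (kfst (kfst p)) (kpair (ksnd (kfst p)) (ksnd p)))
       (cartesian x (cartesian y z))),
     LUnit = (\<lambda>x. set_arrow (cartesian singleton x) ksnd x),
     RUnit = (\<lambda>x. set_arrow (cartesian x singleton) kfst x),
     Symm = (\<lambda>x y. set_arrow (cartesian x y) (\<lambda>p. kpair (ksnd p) (kfst p)) (cartesian y x))
   \<rparr>"

definition admissible :: "('o, 'm, 'x) category_scheme \<Rightarrow> ('m \<Rightarrow> 'u::set_universe set_arrow) \<Rightarrow>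
    'o \<Rightarrow> 'o \<Rightarrow> 'u set_arrow \<Rightarrow> bool" where
  "admissible C Ua A B f \<longleftrightarrow> (\<exists>m\<in>hom\<^bsub>C\<^esub> A B. Ua m = f)"

definition amnestic :: "('o, 'm, 'x) category_scheme \<Rightarrow> ('o \<Rightarrow> 'u::set_universe) \<Rightarrow>
    ('m \<Rightarrow> 'u set_arrow) \<Rightarrow> bool" where
  "amnestic C Uo Ua \<longleftrightarrow> (\<forall>A\<in>Ob C. \<forall>B\<in>Ob C. Uo A = Uo B
     \<and> admissible C Ua A B (idn\<^bsub>SET\<^esub> (Uo A)) \<and> admissible C Ua B A (idn\<^bsub>SET\<^esub> (Uo A))
     \<longrightarrow> A = B)"

(* A source is given by the class of pairs (codomain, function) occurring in it.  Indexing by an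
   arbitrary class and allowing repetitions gives nothing more, since neither admissibility nor
   initiality refers to the indices.  No smallness is imposed on the class of pairs. *)
definition initial_source :: "('o, 'm, 'x) category_scheme \<Rightarrow> ('o \<Rightarrow> 'u::set_universe) \<Rightarrow>
    ('m \<Rightarrow> 'u set_arrow) \<Rightarrow> 'o \<Rightarrow> ('o \<times> 'u set_arrow) set \<Rightarrow> bool" where
  "initial_source C Uo Ua A src \<longleftrightarrow> (\<forall>W\<in>Ob C. \<forall>f\<in>hom\<^bsub>SET\<^esub> (Uo W) (Uo A).
     admissible C Ua W A f \<longleftrightarrow> (\<forall>(B, g)\<in>src. admissible C Ua W B (g \<cdot>\<^bsub>SET\<^esub> f)))"

definition topological :: "('o, 'm, 'x) category_scheme \<Rightarrow> ('o \<Rightarrow> 'u::set_universe) \<Rightarrow>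
    ('m \<Rightarrow> 'u set_arrow) \<Rightarrow> bool" where
  "topological C Uo Ua \<longleftrightarrow> is_functor C SET Uo Ua \<and> faithful C Ua \<and> amnestic C Uo Ua
     \<and> (\<forall>Y src. (\<forall>(B, g)\<in>src. B \<in> Ob C \<and> g \<in> hom\<^bsub>SET\<^esub> Y (Uo B)) \<longrightarrow>
          (\<exists>A\<in>Ob C. Uo A = Y \<and> (\<forall>(B, g)\<in>src. admissible C Ua A B g)
             \<and> initial_source C Uo Ua A src))"

definition represented_by :: "('o, 'm, 'x) category_scheme \<Rightarrow> ('o \<Rightarrow> 'u::set_universe) \<Rightarrow>
    ('m \<Rightarrow> 'u set_arrow) \<Rightarrow> 'o \<Rightarrow> bool" where
  "represented_by C Uo Ua R \<longleftrightarrow> R \<in> Ob C \<and> (\<exists>\<phi>.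
     (\<forall>A\<in>Ob C. bij_betw (\<phi> A) (hom\<^bsub>C\<^esub> R A) (elts (Uo A)))
     \<and> (\<forall>A B. \<forall>f\<in>hom\<^bsub>C\<^esub> A B. \<forall>m\<in>hom\<^bsub>C\<^esub> R A.
          \<phi> B (f \<cdot>\<^bsub>C\<^esub> m) = fst (snd (Ua f)) (\<phi> A m)))"


section \<open>Limits and copowers\<close>

context category
begin

definition is_product :: "'i set \<Rightarrow> ('i \<Rightarrow> 'o) \<Rightarrow> 'o \<Rightarrow> ('i \<Rightarrow> 'm) \<Rightarrow> bool" where
  "is_product I X P p \<longleftrightarrow> P \<in> Ob C \<and> (\<forall>i\<in>I. p i \<in> hom P (X i))
     \<and> (\<forall>A\<in>Ob C. \<forall>f. (\<forall>i\<in>I. f i \<in> hom A (X i)) \<longrightarrow>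
          (\<exists>!h. h \<in> hom A P \<and> (\<forall>i\<in>I. p i \<cdot> h = f i)))"

definition product :: "'i set \<Rightarrow> ('i \<Rightarrow> 'o) \<Rightarrow> 'o \<times> ('i \<Rightarrow> 'm)" where
  "product I X = (SOME (P, p). is_product I X P p)"

definition prd :: "'i set \<Rightarrow> ('i \<Rightarrow> 'o) \<Rightarrow> 'o" where
  "prd I X = fst (product I X)"

definition proj :: "'i set \<Rightarrow> ('i \<Rightarrow> 'o) \<Rightarrow> 'i \<Rightarrow> 'm" where
  "proj I X = snd (product I X)"

definition tuple :: "'i set \<Rightarrow> ('i \<Rightarrow> 'o) \<Rightarrow> 'o \<Rightarrow> ('i \<Rightarrow> 'm) \<Rightarrow> 'm" where
  "tuple I X A f = (THE h. h \<in> hom A (prd I X) \<and> (\<forall>i\<in>I. proj I X i \<cdot> h = f i))"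

definition is_joint_equalizer ::
    "'i set \<Rightarrow> 'o \<Rightarrow> ('i \<Rightarrow> 'm) \<Rightarrow> ('i \<Rightarrow> 'm) \<Rightarrow> 'o \<Rightarrow> 'm \<Rightarrow> bool" where
  "is_joint_equalizer I X f g E e \<longleftrightarrow> e \<in> hom E X \<and> (\<forall>i\<in>I. f i \<cdot> e = g i \<cdot> e)
     \<and> (\<forall>A. \<forall>h\<in>hom A X. (\<forall>i\<in>I. f i \<cdot> h = g i \<cdot> h) \<longrightarrow> (\<exists>!k. k \<in> hom A E \<and> e \<cdot> k = h))"

definition joint_equalizer :: "'i set \<Rightarrow> 'o \<Rightarrow> ('i \<Rightarrow> 'm) \<Rightarrow> ('i \<Rightarrow> 'm) \<Rightarrow> 'o \<times> 'm" where
  "joint_equalizer I X f g = (SOME (E, e). is_joint_equalizer I X f g E e)"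

definition is_copower :: "nat \<Rightarrow> 'o \<Rightarrow> 'o \<Rightarrow> (nat \<Rightarrow> 'm) \<Rightarrow> bool" where
  "is_copower n X Q q \<longleftrightarrow> Q \<in> Ob C \<and> (\<forall>i<n. q i \<in> hom X Q)
     \<and> (\<forall>A\<in>Ob C. \<forall>f. (\<forall>i<n. f i \<in> hom X A) \<longrightarrow>
          (\<exists>!h. h \<in> hom Q A \<and> (\<forall>i<n. h \<cdot> q i = f i)))"

definition copower :: "nat \<Rightarrow> 'o \<Rightarrow> 'o" where
  "copower n X = (SOME Q. \<exists>q. is_copower n X Q q)"

end


section \<open>Enriched categories\<close>

(* VCmp C A B D : C(B,D) \<otimes> C(A,B) \<rightarrow> C(A,D). *)
record ('c, 'o, 'm) vcat =
  VOb :: "'c set"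
  VHom :: "'c \<Rightarrow> 'c \<Rightarrow> 'o"
  VId :: "'c \<Rightarrow> 'm"
  VCmp :: "'c \<Rightarrow> 'c \<Rightarrow> 'c \<Rightarrow> 'm"

type_synonym ('c, 'd, 'm) vfun = "('c \<Rightarrow> 'd) \<times> ('c \<Rightarrow> 'c \<Rightarrow> 'm)"

context symmetric_monoidal_closed
begin

definition vcategory :: "('c, 'o, 'm) vcat \<Rightarrow> bool" where
  "vcategory C \<longleftrightarrow>
     (\<forall>A\<in>VOb C. \<forall>B\<in>VOb C. VHom C A B \<in> Ob V)
     \<and> (\<forall>A\<in>VOb C. VId C A \<in> hom \<I> (VHom C A A))
     \<and> (\<forall>A\<in>VOb C. \<forall>B\<in>VOb C. \<forall>D\<in>VOb C.
          VCmp C A B D \<in> hom (VHom C B D \<otimes> VHom C A B) (VHom C A D))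
     \<and> (\<forall>A\<in>VOb C. \<forall>B\<in>VOb C. \<forall>D\<in>VOb C. \<forall>E\<in>VOb C.
          VCmp C A B E \<cdot> (VCmp C B D E \<otimes>\<^sub>1 idn (VHom C A B))
          = VCmp C A D E \<cdot> (idn (VHom C D E) \<otimes>\<^sub>1 VCmp C A B D)
              \<cdot> assoc (VHom C D E) (VHom C B D) (VHom C A B))
     \<and> (\<forall>A\<in>VOb C. \<forall>B\<in>VOb C.
          VCmp C A B B \<cdot> (VId C B \<otimes>\<^sub>1 idn (VHom C A B)) = lunit (VHom C A B)
          \<and> VCmp C A A B \<cdot> (idn (VHom C A B) \<otimes>\<^sub>1 VId C A) = runit (VHom C A B))"

definition vfunctor :: "('c, 'o, 'm) vcat \<Rightarrow> ('d, 'o, 'm) vcat \<Rightarrow> ('c, 'd, 'm) vfun \<Rightarrow> bool" where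
  "vfunctor C D F \<longleftrightarrow> vcategory C \<and> vcategory D
     \<and> (\<forall>A\<in>VOb C. fst F A \<in> VOb D)
     \<and> (\<forall>A\<in>VOb C. \<forall>B\<in>VOb C. snd F A B \<in> hom (VHom C A B) (VHom D (fst F A) (fst F B)))
     \<and> (\<forall>A\<in>VOb C. snd F A A \<cdot> VId C A = VId D (fst F A))
     \<and> (\<forall>A\<in>VOb C. \<forall>B\<in>VOb C. \<forall>E\<in>VOb C.
          snd F A E \<cdot> VCmp C A B E
          = VCmp D (fst F A) (fst F B) (fst F E) \<cdot> (snd F B E \<otimes>\<^sub>1 snd F A B))"

definition vfun_eq :: "('c, 'o, 'm) vcat \<Rightarrow> ('c, 'd, 'm) vfun \<Rightarrow> ('c, 'd, 'm) vfun \<Rightarrow> bool" where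
  "vfun_eq C F G \<longleftrightarrow> (\<forall>A\<in>VOb C. fst F A = fst G A)
     \<and> (\<forall>A\<in>VOb C. \<forall>B\<in>VOb C. snd F A B = snd G A B)"

definition vfun_id :: "('c, 'o, 'm) vcat \<Rightarrow> ('c, 'c, 'm) vfun" where
  "vfun_id C = (\<lambda>A. A, \<lambda>A B. idn (VHom C A B))"

definition vfun_cmp :: "('d, 'e, 'm) vfun \<Rightarrow> ('c, 'd, 'm) vfun \<Rightarrow> ('c, 'e, 'm) vfun" where
  "vfun_cmp G F = (\<lambda>A. fst G (fst F A), \<lambda>A B. snd G (fst F A) (fst F B) \<cdot> snd F A B)"

definition slice_ob :: "('b, 'o, 'm) vcat \<Rightarrow> ('c, 'o, 'm) vcat \<times> ('c, 'b, 'm) vfun \<Rightarrow> bool" where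
  "slice_ob B X \<longleftrightarrow> vfunctor (fst X) B (snd X)"

definition slice_hom :: "('c, 'o, 'm) vcat \<times> ('c, 'b, 'm) vfun \<Rightarrow>
    ('d, 'o, 'm) vcat \<times> ('d, 'b, 'm) vfun \<Rightarrow> ('c, 'd, 'm) vfun \<Rightarrow> bool" where
  "slice_hom X Y F \<longleftrightarrow> vfunctor (fst X) (fst Y) F \<and> vfun_eq (fst X) (vfun_cmp (snd Y) F) (snd X)"

definition slice_iso :: "('b, 'o, 'm) vcat \<Rightarrow> ('c, 'o, 'm) vcat \<times> ('c, 'b, 'm) vfun \<Rightarrow>
    ('d, 'o, 'm) vcat \<times> ('d, 'b, 'm) vfun \<Rightarrow> ('c, 'd, 'm) vfun \<Rightarrow> bool" where
  "slice_iso B X Y F \<longleftrightarrow> slice_ob B X \<and> slice_ob B Y \<and> slice_hom X Y F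
     \<and> (\<exists>G. slice_hom Y X G \<and> vfun_eq (fst X) (vfun_cmp G F) (vfun_id (fst X))
          \<and> vfun_eq (fst Y) (vfun_cmp F G) (vfun_id (fst Y)))"

definition full_sub :: "('c, 'o, 'm) vcat \<times> ('c, 'b, 'm) vfun \<Rightarrow> 'c set \<Rightarrow>
    ('c, 'o, 'm) vcat \<times> ('c, 'b, 'm) vfun" where
  "full_sub X Z = ((fst X)\<lparr>VOb := Z\<rparr>, snd X)"

(* The V-category with objects Z over B determined by monomorphisms e X Y : E X Y \<rightarrow> B(u X, u Y)
   through which identities and composition of B factor, with its V-functor to B. *)
definition sub_homs :: "('b, 'o, 'm) vcat \<Rightarrow> 'c set \<Rightarrow> ('c \<Rightarrow> 'b) \<Rightarrow> ('c \<Rightarrow> 'c \<Rightarrow> 'o \<times> 'm) \<Rightarrow>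
    ('c, 'o, 'm) vcat \<times> ('c, 'b, 'm) vfun" where
  "sub_homs B Z u Ee = (let E = (\<lambda>X Y. fst (Ee X Y)); e = (\<lambda>X Y. snd (Ee X Y)) in
     (\<lparr> VOb = Z,
        VHom = E,
        VId = (\<lambda>X. THE i. i \<in> hom \<I> (E X X) \<and> e X X \<cdot> i = VId B (u X)),
        VCmp = (\<lambda>X Y W. THE m. m \<in> hom (E Y W \<otimes> E X Y) (E X W)
                  \<and> e X W \<cdot> m = VCmp B (u X) (u Y) (u W) \<cdot> (e Y W \<otimes>\<^sub>1 e X Y)) \<rparr>,
      (u, e)))"

definition curry_arrow :: "'o \<Rightarrow> 'o \<Rightarrow> 'o \<Rightarrow> 'm \<Rightarrow> 'm" where
  "curry_arrow A B D f = (THE g. g \<in> hom A (ihom B D) \<and> ev B D \<cdot> (g \<otimes>\<^sub>1 idn B) = f)"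

definition self_vcat :: "('o, 'o, 'm) vcat" where
  "self_vcat = \<lparr>
     VOb = Ob V,
     VHom = ihom,
     VId = (\<lambda>A. curry_arrow \<I> A A (lunit A)),
     VCmp = (\<lambda>A B D. curry_arrow (ihom B D \<otimes> ihom A B) A D
               (ev B D \<cdot> (idn (ihom B D) \<otimes>\<^sub>1 ev A B) \<cdot> assoc (ihom B D) (ihom A B) A)) \<rparr>"

(* [A,g] and [g,D]. *)
definition postcomp :: "'o \<Rightarrow> 'm \<Rightarrow> 'm" where
  "postcomp A g = curry_arrow (ihom A (Dom V g)) A (Cod V g) (g \<cdot> ev A (Dom V g))"

definition precomp :: "'m \<Rightarrow> 'o \<Rightarrow> 'm" where
  "precomp g D = curry_arrow (ihom (Cod V g) D) (Dom V g) D
     (ev (Cod V g) D \<cdot> (idn (ihom (Cod V g) D) \<otimes>\<^sub>1 g))"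

(* C(J,-) : C \<rightarrow> V. *)
definition repr_vfun :: "('c, 'o, 'm) vcat \<Rightarrow> 'c \<Rightarrow> ('c, 'o, 'm) vfun" where
  "repr_vfun C J = (\<lambda>A. VHom C J A,
     \<lambda>A B. curry_arrow (VHom C A B) (VHom C J A) (VHom C J B) (VCmp C J A B))"

(* P \<otimes> - : V \<rightarrow> V, with [A,B] \<otimes> (P \<otimes> A) \<cong> P \<otimes> ([A,B] \<otimes> A) \<rightarrow> P \<otimes> B. *)
definition ltensor_vfun :: "'o \<Rightarrow> ('o, 'o, 'm) vfun" where
  "ltensor_vfun P = (\<lambda>A. P \<otimes> A,
     \<lambda>A B. curry_arrow (ihom A B) (P \<otimes> A) (P \<otimes> B)
       ((idn P \<otimes>\<^sub>1 ev A B) \<cdot> assoc P (ihom A B) A \<cdot> (symm (ihom A B) P \<otimes>\<^sub>1 idn A)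
        \<cdot> inv_arrow (assoc (ihom A B) P A)))"

(* - \<otimes> P : V \<rightarrow> V, with [A,B] \<otimes> (A \<otimes> P) \<cong> ([A,B] \<otimes> A) \<otimes> P \<rightarrow> B \<otimes> P. *)
definition rtensor_vfun :: "'o \<Rightarrow> ('o, 'o, 'm) vfun" where
  "rtensor_vfun P = (\<lambda>A. A \<otimes> P,
     \<lambda>A B. curry_arrow (ihom A B) (A \<otimes> P) (B \<otimes> P)
       ((ev A B \<otimes>\<^sub>1 idn P) \<cdot> inv_arrow (assoc (ihom A B) A P)))"

end


section \<open>Powers of V and multi-sorted theories\<close>

(* The signature of sets of sorted operations: symbols are the elements of the set ops; the type
   of a symbol consists of its argument sorts, its result sort and its parameter. *)
type_synonym ('u, 'o) op_type = "'u list \<times> 'u \<times> 'o"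

record ('u, 'o) signature =
  ops :: 'u
  op_type :: "'u \<Rightarrow> ('u, 'o) op_type"

record ('u, 'o) free_form_signature =
  symbols :: 'u
  arity :: "'u \<Rightarrow> 'u \<Rightarrow> 'o"
  param :: "'u \<Rightarrow> 'u \<Rightarrow> 'o"

(* Objects and morphisms of the power of V are extensional families indexed by the sorts.  An
   algebra is a pair of a carrier and an extensional family of structure morphisms. *)
type_synonym ('u, 'o, 'm) algebra = "('u \<Rightarrow> 'o) \<times> ('u \<Rightarrow> 'm)"
type_synonym ('u, 'o, 'm) ff_algebra = "('u \<Rightarrow> 'o) \<times> ('u \<Rightarrow> 'u \<Rightarrow> 'm)"

type_synonym ('u, 'o, 'm) algebraic_equation =
  "('u, 'o) op_type \<times> (('u, 'o, 'm) algebra \<Rightarrow> 'm) \<times> (('u, 'o, 'm) algebra \<Rightarrow> 'm)"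

type_synonym ('u, 'o, 'm) diagrammatic_equation =
  "('u \<Rightarrow> 'o) \<times> ('u \<Rightarrow> 'o)
   \<times> (('u, 'o, 'm) ff_algebra \<Rightarrow> 'u \<Rightarrow> 'm) \<times> (('u, 'o, 'm) ff_algebra \<Rightarrow> 'u \<Rightarrow> 'm)"

locale sorted_power = symmetric_monoidal_closed V
  for V :: "('o, 'm) closed" (structure) +
  fixes \<S> :: "'u::set_universe"
begin

definition pow_ob :: "('u \<Rightarrow> 'o) set" where
  "pow_ob = (elts \<S> \<rightarrow>\<^sub>E Ob V)"

definition pow_hom :: "('u \<Rightarrow> 'o) \<Rightarrow> ('u \<Rightarrow> 'o) \<Rightarrow> ('u \<Rightarrow> 'm) set" where
  "pow_hom X Y = (\<Pi>\<^sub>E s\<in>elts \<S>. hom (X s) (Y s))"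

definition pow_cmp :: "('u \<Rightarrow> 'm) \<Rightarrow> ('u \<Rightarrow> 'm) \<Rightarrow> ('u \<Rightarrow> 'm)" where
  "pow_cmp g f = (\<lambda>s\<in>elts \<S>. g s \<cdot> f s)"

definition pow_tensor :: "'o \<Rightarrow> ('u \<Rightarrow> 'o) \<Rightarrow> ('u \<Rightarrow> 'o)" where
  "pow_tensor A X = (\<lambda>s\<in>elts \<S>. A \<otimes> X s)"

abbreviation homs :: "('u \<Rightarrow> 'o) \<Rightarrow> ('u \<Rightarrow> 'o) \<Rightarrow> 'u \<Rightarrow> 'o" where
  "homs X Y \<equiv> (\<lambda>s. ihom (X s) (Y s))"

abbreviation pow_vhom :: "('u \<Rightarrow> 'o) \<Rightarrow> ('u \<Rightarrow> 'o) \<Rightarrow> 'o" where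
  "pow_vhom X Y \<equiv> prd (elts \<S>) (homs X Y)"

definition pow_vcat :: "('u \<Rightarrow> 'o, 'o, 'm) vcat" where
  "pow_vcat = \<lparr>
     VOb = pow_ob,
     VHom = pow_vhom,
     VId = (\<lambda>X. tuple (elts \<S>) (homs X X) \<I> (\<lambda>s. VId self_vcat (X s))),
     VCmp = (\<lambda>X Y Z. tuple (elts \<S>) (homs X Z) (pow_vhom Y Z \<otimes> pow_vhom X Y)
               (\<lambda>s. VCmp self_vcat (X s) (Y s) (Z s)
                  \<cdot> (proj (elts \<S>) (homs Y Z) s \<otimes>\<^sub>1 proj (elts \<S>) (homs X Y) s))) \<rparr>"

(* For g : Y \<rightarrow> Z resp. h : X \<rightarrow> Y, the morphisms of hom-objects of the power of V induced by
   composition with g and by precomposition with h. *)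
definition pow_postcomp :: "('u \<Rightarrow> 'o) \<Rightarrow> ('u \<Rightarrow> 'o) \<Rightarrow> ('u \<Rightarrow> 'o) \<Rightarrow> ('u \<Rightarrow> 'm) \<Rightarrow> 'm" where
  "pow_postcomp X Y Z g = tuple (elts \<S>) (homs X Z) (pow_vhom X Y)
     (\<lambda>s. postcomp (X s) (g s) \<cdot> proj (elts \<S>) (homs X Y) s)"

definition pow_precomp :: "('u \<Rightarrow> 'o) \<Rightarrow> ('u \<Rightarrow> 'o) \<Rightarrow> ('u \<Rightarrow> 'o) \<Rightarrow> ('u \<Rightarrow> 'm) \<Rightarrow> 'm" where
  "pow_precomp X Y Z h = tuple (elts \<S>) (homs X Z) (pow_vhom Y Z)
     (\<lambda>s. precomp (h s) (Z s) \<cdot> proj (elts \<S>) (homs Y Z) s)"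


subsection \<open>Enriched multi-sorted signatures and equational theories\<close>

definition signature :: "('u, 'o) signature \<Rightarrow> bool" where
  "signature \<Sigma> \<longleftrightarrow> (\<forall>\<sigma>\<in>elts (ops \<Sigma>). case op_type \<Sigma> \<sigma> of (Ss, S, P) \<Rightarrow>
     set Ss \<subseteq> elts \<S> \<and> S \<in> elts \<S> \<and> P \<in> Ob V)"

definition fprod :: "'u list \<Rightarrow> ('u \<Rightarrow> 'o) \<Rightarrow> 'o" where
  "fprod Ss A = prd {..<length Ss} (\<lambda>i. A (Ss ! i))"

definition fprod_arrow :: "'u list \<Rightarrow> ('u \<Rightarrow> 'o) \<Rightarrow> ('u \<Rightarrow> 'o) \<Rightarrow> ('u \<Rightarrow> 'm) \<Rightarrow> 'm" where
  "fprod_arrow Ss A B f = tuple {..<length Ss} (\<lambda>i. B (Ss ! i)) (fprod Ss A)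
     (\<lambda>i. f (Ss ! i) \<cdot> proj {..<length Ss} (\<lambda>i. A (Ss ! i)) i)"

definition fprod_vfun :: "'u list \<Rightarrow> ('u \<Rightarrow> 'o, 'o, 'm) vfun" where
  "fprod_vfun Ss = (fprod Ss,
     \<lambda>A B. curry_arrow (pow_vhom A B) (fprod Ss A) (fprod Ss B)
       (tuple {..<length Ss} (\<lambda>i. B (Ss ! i)) (pow_vhom A B \<otimes> fprod Ss A)
          (\<lambda>i. ev (A (Ss ! i)) (B (Ss ! i))
             \<cdot> (proj (elts \<S>) (homs A B) (Ss ! i) \<otimes>\<^sub>1 proj {..<length Ss} (\<lambda>i. A (Ss ! i)) i))))"

(* A \<mapsto> P \<otimes> (A_S1 \<times> ... \<times> A_Sn) for an operation type ((S1, ..., Sn), S, P): the object, the action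
   on a morphism f : A \<rightarrow> B of the power of V, and the V-functor. *)
definition inputs :: "('u, 'o) op_type \<Rightarrow> ('u \<Rightarrow> 'o) \<Rightarrow> 'o" where
  "inputs \<tau> A = (case \<tau> of (Ss, S, P) \<Rightarrow> P \<otimes> fprod Ss A)"

definition inputs_arrow :: "('u, 'o) op_type \<Rightarrow> ('u \<Rightarrow> 'o) \<Rightarrow> ('u \<Rightarrow> 'o) \<Rightarrow> ('u \<Rightarrow> 'm) \<Rightarrow> 'm" where
  "inputs_arrow \<tau> A B f = (case \<tau> of (Ss, S, P) \<Rightarrow> idn P \<otimes>\<^sub>1 fprod_arrow Ss A B f)"

definition inputs_vfun :: "('u, 'o) op_type \<Rightarrow> ('u \<Rightarrow> 'o, 'o, 'm) vfun" where
  "inputs_vfun \<tau> = (case \<tau> of (Ss, S, P) \<Rightarrow> vfun_cmp (ltensor_vfun P) (fprod_vfun Ss))"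

definition result :: "('u, 'o) op_type \<Rightarrow> 'u" where
  "result \<tau> = fst (snd \<tau>)"

definition algebras :: "('u, 'o) signature \<Rightarrow> ('u, 'o, 'm) algebra set" where
  "algebras \<Sigma> = {(A, a). A \<in> pow_ob \<and>
     a \<in> (\<Pi>\<^sub>E \<sigma>\<in>elts (ops \<Sigma>). hom (inputs (op_type \<Sigma> \<sigma>) A) (A (result (op_type \<Sigma> \<sigma>))))}"

definition algebra_hom :: "('u, 'o) signature \<Rightarrow> ('u, 'o, 'm) algebra \<Rightarrow> ('u, 'o, 'm) algebra \<Rightarrow>
    ('u \<Rightarrow> 'm) set" where
  "algebra_hom \<Sigma> A B = {f \<in> pow_hom (fst A) (fst B). \<forall>\<sigma>\<in>elts (ops \<Sigma>).
     f (result (op_type \<Sigma> \<sigma>)) \<cdot> snd A \<sigma>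
     = snd B \<sigma> \<cdot> inputs_arrow (op_type \<Sigma> \<sigma>) (fst A) (fst B) f}"

definition algebra_homs :: "('u, 'o) signature \<Rightarrow> ('u, 'o, 'm) algebra \<Rightarrow> ('u, 'o, 'm) algebra \<Rightarrow>
    'o \<times> 'm" where
  "algebra_homs \<Sigma> A B = joint_equalizer (elts (ops \<Sigma>)) (pow_vhom (fst A) (fst B))
     (\<lambda>\<sigma>. postcomp (inputs (op_type \<Sigma> \<sigma>) (fst A)) (snd B \<sigma>)
           \<cdot> snd (inputs_vfun (op_type \<Sigma> \<sigma>)) (fst A) (fst B))
     (\<lambda>\<sigma>. precomp (snd A \<sigma>) (fst B (result (op_type \<Sigma> \<sigma>)))
           \<cdot> proj (elts \<S>) (homs (fst A) (fst B)) (result (op_type \<Sigma> \<sigma>)))"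

definition Alg :: "('u, 'o) signature \<Rightarrow>
    (('u, 'o, 'm) algebra, 'o, 'm) vcat \<times> (('u, 'o, 'm) algebra, 'u \<Rightarrow> 'o, 'm) vfun" where
  "Alg \<Sigma> = sub_homs pow_vcat (algebras \<Sigma>) fst (algebra_homs \<Sigma>)"

definition algebraic_operation :: "('u, 'o) signature \<Rightarrow> ('u, 'o) op_type \<Rightarrow>
    (('u, 'o, 'm) algebra \<Rightarrow> 'm) \<Rightarrow> bool" where
  "algebraic_operation \<Sigma> \<tau> \<omega> \<longleftrightarrow>
     (case \<tau> of (Ss, S, P) \<Rightarrow> set Ss \<subseteq> elts \<S> \<and> S \<in> elts \<S> \<and> P \<in> Ob V)
     \<and> \<omega> \<in> (\<Pi>\<^sub>E A\<in>algebras \<Sigma>. hom (inputs \<tau> (fst A)) (fst A (result \<tau>)))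
     \<and> (\<forall>A\<in>algebras \<Sigma>. \<forall>B\<in>algebras \<Sigma>. \<forall>f\<in>algebra_hom \<Sigma> A B.
          f (result \<tau>) \<cdot> \<omega> A = \<omega> B \<cdot> inputs_arrow \<tau> (fst A) (fst B) f)"

definition algebraic_equation :: "('u, 'o) signature \<Rightarrow> ('u, 'o, 'm) algebraic_equation \<Rightarrow> bool" where
  "algebraic_equation \<Sigma> e \<longleftrightarrow> (case e of (\<tau>, \<omega>, \<nu>) \<Rightarrow>
     algebraic_operation \<Sigma> \<tau> \<omega> \<and> algebraic_operation \<Sigma> \<tau> \<nu>)"

definition satisfies :: "('u, 'o, 'm) algebra \<Rightarrow> ('u, 'o, 'm) algebraic_equation \<Rightarrow> bool" where
  "satisfies A e \<longleftrightarrow> (case e of (\<tau>, \<omega>, \<nu>) \<Rightarrow> \<omega> A = \<nu> A)"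

definition equational_theory ::
    "('u, 'o) signature \<times> ('u, 'o, 'm) algebraic_equation set \<Rightarrow> bool" where
  "equational_theory T \<longleftrightarrow> signature (fst T) \<and> small TYPE('u) (snd T)
     \<and> (\<forall>e\<in>snd T. algebraic_equation (fst T) e)"

definition theory_Alg :: "('u, 'o) signature \<times> ('u, 'o, 'm) algebraic_equation set \<Rightarrow>
    (('u, 'o, 'm) algebra, 'o, 'm) vcat \<times> (('u, 'o, 'm) algebra, 'u \<Rightarrow> 'o, 'm) vfun" where
  "theory_Alg T = full_sub (Alg (fst T)) {A \<in> algebras (fst T). \<forall>e\<in>snd T. satisfies A e}"


subsection \<open>Free-form signatures and diagrammatic presentations\<close>

definition arity_objects :: "('u \<Rightarrow> 'o) set" where
  "arity_objects = {\<lambda>s\<in>elts \<S>. copower (n s) \<I> | n. finite {s \<in> elts \<S>. n s \<noteq> 0}}"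

definition free_form_signature :: "('u, 'o) free_form_signature \<Rightarrow> bool" where
  "free_form_signature \<Sigma> \<longleftrightarrow>
     (\<forall>\<sigma>\<in>elts (symbols \<Sigma>). arity \<Sigma> \<sigma> \<in> arity_objects \<and> param \<Sigma> \<sigma> \<in> pow_ob)"

(* A \<mapsto> V^S(J,A) \<otimes> P: the object, the action on a morphism f : A \<rightarrow> B of the power of V, and the
   V-functor. *)
definition ff_inputs :: "('u \<Rightarrow> 'o) \<Rightarrow> ('u \<Rightarrow> 'o) \<Rightarrow> ('u \<Rightarrow> 'o) \<Rightarrow> ('u \<Rightarrow> 'o)" where
  "ff_inputs J P A = pow_tensor (pow_vhom J A) P"

definition ff_inputs_arrow :: "('u \<Rightarrow> 'o) \<Rightarrow> ('u \<Rightarrow> 'o) \<Rightarrow> ('u \<Rightarrow> 'o) \<Rightarrow> ('u \<Rightarrow> 'o) \<Rightarrow>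
    ('u \<Rightarrow> 'm) \<Rightarrow> ('u \<Rightarrow> 'm)" where
  "ff_inputs_arrow J P A B f = (\<lambda>s\<in>elts \<S>. pow_postcomp J A B f \<otimes>\<^sub>1 idn (P s))"

definition pow_tensor_vfun :: "('u \<Rightarrow> 'o) \<Rightarrow> ('o, 'u \<Rightarrow> 'o, 'm) vfun" where
  "pow_tensor_vfun P = (\<lambda>A. pow_tensor A P,
     \<lambda>A B. tuple (elts \<S>) (homs (pow_tensor A P) (pow_tensor B P)) (ihom A B)
       (\<lambda>s. snd (rtensor_vfun (P s)) A B))"

definition ff_inputs_vfun :: "('u \<Rightarrow> 'o) \<Rightarrow> ('u \<Rightarrow> 'o) \<Rightarrow> ('u \<Rightarrow> 'o, 'u \<Rightarrow> 'o, 'm) vfun" where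
  "ff_inputs_vfun J P = vfun_cmp (pow_tensor_vfun P) (repr_vfun pow_vcat J)"

definition ff_algebras :: "('u, 'o) free_form_signature \<Rightarrow> ('u, 'o, 'm) ff_algebra set" where
  "ff_algebras \<Sigma> = {(A, a). A \<in> pow_ob \<and>
     a \<in> (\<Pi>\<^sub>E \<sigma>\<in>elts (symbols \<Sigma>). pow_hom (ff_inputs (arity \<Sigma> \<sigma>) (param \<Sigma> \<sigma>) A) A)}"

definition ff_algebra_hom :: "('u, 'o) free_form_signature \<Rightarrow> ('u, 'o, 'm) ff_algebra \<Rightarrow>
    ('u, 'o, 'm) ff_algebra \<Rightarrow> ('u \<Rightarrow> 'm) set" where
  "ff_algebra_hom \<Sigma> A B = {f \<in> pow_hom (fst A) (fst B). \<forall>\<sigma>\<in>elts (symbols \<Sigma>).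
     pow_cmp f (snd A \<sigma>)
     = pow_cmp (snd B \<sigma>) (ff_inputs_arrow (arity \<Sigma> \<sigma>) (param \<Sigma> \<sigma>) (fst A) (fst B) f)}"

definition ff_algebra_homs :: "('u, 'o) free_form_signature \<Rightarrow> ('u, 'o, 'm) ff_algebra \<Rightarrow>
    ('u, 'o, 'm) ff_algebra \<Rightarrow> 'o \<times> 'm" where
  "ff_algebra_homs \<Sigma> A B = joint_equalizer (elts (symbols \<Sigma>)) (pow_vhom (fst A) (fst B))
     (\<lambda>\<sigma>. pow_postcomp (ff_inputs (arity \<Sigma> \<sigma>) (param \<Sigma> \<sigma>) (fst A))
             (ff_inputs (arity \<Sigma> \<sigma>) (param \<Sigma> \<sigma>) (fst B)) (fst B) (snd B \<sigma>)
           \<cdot> snd (ff_inputs_vfun (arity \<Sigma> \<sigma>) (param \<Sigma> \<sigma>)) (fst A) (fst B))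
     (\<lambda>\<sigma>. pow_precomp (ff_inputs (arity \<Sigma> \<sigma>) (param \<Sigma> \<sigma>) (fst A)) (fst A) (fst B) (snd A \<sigma>))"

definition ff_Alg :: "('u, 'o) free_form_signature \<Rightarrow>
    (('u, 'o, 'm) ff_algebra, 'o, 'm) vcat \<times> (('u, 'o, 'm) ff_algebra, 'u \<Rightarrow> 'o, 'm) vfun" where
  "ff_Alg \<Sigma> = sub_homs pow_vcat (ff_algebras \<Sigma>) fst (ff_algebra_homs \<Sigma>)"

definition natural_operation :: "('u, 'o) free_form_signature \<Rightarrow> ('u \<Rightarrow> 'o) \<Rightarrow> ('u \<Rightarrow> 'o) \<Rightarrow>
    (('u, 'o, 'm) ff_algebra \<Rightarrow> 'u \<Rightarrow> 'm) \<Rightarrow> bool" where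
  "natural_operation \<Sigma> J P \<omega> \<longleftrightarrow> J \<in> arity_objects \<and> P \<in> pow_ob
     \<and> \<omega> \<in> (\<Pi>\<^sub>E A\<in>ff_algebras \<Sigma>. pow_hom (ff_inputs J P (fst A)) (fst A))
     \<and> (\<forall>A\<in>ff_algebras \<Sigma>. \<forall>B\<in>ff_algebras \<Sigma>. \<forall>f\<in>ff_algebra_hom \<Sigma> A B.
          pow_cmp f (\<omega> A) = pow_cmp (\<omega> B) (ff_inputs_arrow J P (fst A) (fst B) f))"

definition diagrammatic_equation :: "('u, 'o) free_form_signature \<Rightarrow>
    ('u, 'o, 'm) diagrammatic_equation \<Rightarrow> bool" where
  "diagrammatic_equation \<Sigma> e \<longleftrightarrow> (case e of (J, P, \<omega>, \<nu>) \<Rightarrow>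
     natural_operation \<Sigma> J P \<omega> \<and> natural_operation \<Sigma> J P \<nu>)"

definition ff_satisfies :: "('u, 'o, 'm) ff_algebra \<Rightarrow> ('u, 'o, 'm) diagrammatic_equation \<Rightarrow> bool"
  where "ff_satisfies A e \<longleftrightarrow> (case e of (J, P, \<omega>, \<nu>) \<Rightarrow> \<omega> A = \<nu> A)"

definition diagrammatic_presentation ::
    "('u, 'o) free_form_signature \<times> ('u, 'o, 'm) diagrammatic_equation set \<Rightarrow> bool" where
  "diagrammatic_presentation T \<longleftrightarrow> free_form_signature (fst T) \<and> small TYPE('u) (snd T)
     \<and> (\<forall>e\<in>snd T. diagrammatic_equation (fst T) e)"

definition presentation_Alg ::
    "('u, 'o) free_form_signature \<times> ('u, 'o, 'm) diagrammatic_equation set \<Rightarrow>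
    (('u, 'o, 'm) ff_algebra, 'o, 'm) vcat \<times> (('u, 'o, 'm) ff_algebra, 'u \<Rightarrow> 'o, 'm) vfun" where
  "presentation_Alg T = full_sub (ff_Alg (fst T))
     {A \<in> ff_algebras (fst T). \<forall>e\<in>snd T. ff_satisfies A e}"

end

end

(*
  Everything is reduced to computations with elements.  The functor to Set is faithful, and as it is
  represented by the unit, an element of a product, of an internal hom or of a joint equalizer is
  determined by its images under the projections, evaluations or the inclusion.  So an equation
  between morphisms of V may be checked on elements, and a hom-object of a category of algebras
  consists of those elements of the hom-object of the power that are homomorphisms elementwise.

  An arity J is a family of finite copowers of the unit; listing all the summands gives sorts
  S_1, ..., S_n with elements c_i of J at S_i, and evaluation at the c_i is an isomorphism from the
  hom-object V^S(J, A) to A_S1 x ... x A_Sn, compatible with the action of V^S(A, B).  A structure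
  morphism V^S(J, A) (x) P -> A therefore amounts to a family, indexed by the sorts s, of operations
  of type ((S_1, ..., S_n), s, P_s), and an equation between natural operations to one algebraic
  equation for each s.
*)
theory Submission
  imports Defs
begin

section \<open>Small sets\<close>

text \<open>Products, copowers and joint equalizers are arbitrary choices of objects with a
  universal property. Hence the hom-objects of the two categories of algebras are different objects
  of V, obtained from pairs of morphisms with different index sets (symbols on one side, pairs of a
  symbol and a sort on the other) and different codomains. To compare them, a subobject of B(u X, u
  Y) is described by a predicate on elements: \<open>cuts_out\<close> says that every morphism with
  values in the predicate factors uniquely. A category over B is then given by its objects and
  predicates, and by \<open>slice_iso_comparison\<close> a bijection of objects over B that matches
  the predicates already yields an isomorphism in the slice. Restricting the set of objects leaves
  the hom-objects alone, so statements 1 and 3 are instances of one isomorphism. The action on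
  inputs is computed twice: for elements of hom-objects, which determine the enriched structure, and
  for families of morphisms, which occur in the naturality of operations.\<close>

lemma small_elts [simp]: "small TYPE('u::set_universe) (elts (x::'u))"
  unfolding small_def by (intro exI[of _ x] exI[of _ "\<lambda>y. y"]) auto

lemma small_imp_elts:
  assumes "small TYPE('u::set_universe) (A::'u set)" shows "\<exists>x. elts x = A"
  using assms replacement unfolding small_def by metis

lemma small_image:
  assumes "small TYPE('u::set_universe) X" shows "small TYPE('u) (f ` X)"
  using assms unfolding small_def by (metis image_image)

lemma small_subset:
  assumes "small TYPE('u::set_universe) X" and "Y \<subseteq> X" shows "small TYPE('u) Y"
proof -
  obtain x :: 'u and f where X: "X = f ` elts x" using assms(1) unfolding small_def by blast
  obtain z where "elts z = {a \<in> elts x. f a \<in> Y}"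
    using separation[of "{a \<in> elts x. f a \<in> Y}" x] by auto
  then have "Y = f ` elts z" using X assms(2) by auto
  then show ?thesis unfolding small_def by blast
qed

lemma elts_set_of:
  assumes "small TYPE('u::set_universe) (A::'u set)" shows "elts (set_of A) = A"
proof -
  obtain x where x: "elts x = A" using small_imp_elts[OF assms] by blast
  then have "set_of A = x"
    unfolding set_of_def by (intro the_equality) (auto intro: extensionality)
  with x show ?thesis by simp
qed

lemma small_finite_universe:
  assumes "finite A" shows "small TYPE('u::set_universe) (A :: 'u set)"
  using assms
proof induction
  case empty
  \<comment> \<open>\<open>undefined\<close> stands for an arbitrary set of the universe; separation
    cuts the empty set out of it.\<close>
  show ?case by (rule small_subset[OF small_elts[of undefined]]) simp
next
  case (insert a A)
  then obtain x where x: "elts x = A" using small_imp_elts by blast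
  obtain y where y: "elts y = {a}" using pairing[of a a] by auto
  obtain z where z: "elts z = {x, y}" using pairing[of x y] by auto
  obtain w where "elts w = (\<Union>v\<in>elts z. elts v)" using union[of z] by auto
  then have "elts w = Set.insert a A" using x y z by auto
  then show ?case using small_elts[of w] by simp
qed

text \<open>No infinite set is assumed to exist, but the type itself is infinite: were it finite,
  the set of all its elements would be small, hence a member of itself, against foundation. This
  provides sets of universe elements of every finite size for \<open>small_finite\<close>.\<close>

lemma infinite_universe: "infinite (UNIV :: 'u::set_universe set)"
proof
  assume "finite (UNIV :: 'u set)"
  then obtain x :: 'u where "elts x = UNIV" using small_finite_universe small_imp_elts by blast
  then have "(x, x) \<in> {(x, y). x \<in> elts y}" by simp
  with wf_not_refl[OF foundation] show False by blast
qed

lemma small_finite: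
  assumes "finite X" shows "small TYPE('u::set_universe) X"
proof -
  obtain B :: "'u set" where B: "finite B" "card B = card X"
    using infinite_arbitrarily_large[OF infinite_universe] by blast
  then obtain f where "bij_betw f B X" using assms finite_same_card_bij by blast
  then show ?thesis using small_image[OF small_finite_universe[OF B(1)], of f]
    by (simp add: bij_betw_def)
qed

section \<open>Kuratowski pairs in the universe\<close>

lemma elts_set_of_pair [simp]: "elts (set_of {a, b :: 'u::set_universe}) = {a, b}"
  by (simp add: elts_set_of small_finite)

lemma elts_set_of_single [simp]: "elts (set_of {a :: 'u::set_universe}) = {a}"
  by (simp add: elts_set_of small_finite)

lemma kpair_inject [simp]: "kpair a b = kpair c d \<longleftrightarrow> a = c \<and> b = d"
proof
  assume eq: "kpair a b = kpair c d"
  have single: "set_of {x} = set_of {y :: 'a} \<longleftrightarrow> x = y" for x y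
    by (metis elts_set_of_single singleton_inject)
  have pair: "set_of {x, y} = set_of {z, w :: 'a} \<longleftrightarrow> {x, y} = {z, w}" for x y z w
    by (metis elts_set_of_pair)
  have sp: "set_of {x} = set_of {z, w :: 'a} \<longleftrightarrow> {x} = {z, w}"
    and ps: "set_of {z, w} = set_of {x} \<longleftrightarrow> {z, w} = {x}" for x z w
    by (metis elts_set_of_pair elts_set_of_single)+
  from eq have "{set_of {a}, set_of {a, b}} = {set_of {c}, set_of {c, d}}"
    unfolding kpair_def by (metis elts_set_of_pair)
  then show "a = c \<and> b = d"
    by (auto simp: doubleton_eq_iff single pair sp ps)
qed simp

lemma kfst_kpair [simp]: "kfst (kpair a b) = a"
  unfolding kfst_def by auto

lemma ksnd_kpair [simp]: "ksnd (kpair a b) = b"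
  unfolding ksnd_def by auto

section \<open>Closure of smallness under unions, power sets and function spaces\<close>

lemma small_UN:
  assumes "small TYPE('u::set_universe) I" and "\<And>i. i \<in> I \<Longrightarrow> small TYPE('u) (B i)"
  shows "small TYPE('u) (\<Union>i\<in>I. B i)"
proof -
  have aux: "small TYPE('u) (\<Union>a\<in>elts x. elts (y a))" for x :: 'u and y :: "'u \<Rightarrow> 'u"
  proof -
    obtain z where "elts z = y ` elts x" using replacement by blast
    moreover obtain w where "elts w = (\<Union>v\<in>elts z. elts v)" using union[of z] by auto
    ultimately show ?thesis using small_elts[of w] by simp
  qed
  obtain x :: 'u and f where I: "I = f ` elts x" using assms(1) unfolding small_def by blast
  obtain y :: "_ \<Rightarrow> 'u" and g where B: "\<And>i. i \<in> I \<Longrightarrow> B i = g i ` elts (y i)"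
    using assms(2) unfolding small_def by metis
  \<comment> \<open>The members of \<open>B i\<close> have an arbitrary type, so the axiom of union
    is applied to codes: \<open>P a\<close> consists of the pairs of \<open>a\<close> with a code of
    a member of \<open>B (f a)\<close>.\<close>
  define P where "P a = set_of (kpair a ` elts (y (f a)))" for a
  have P: "elts (P a) = kpair a ` elts (y (f a))" for a
    unfolding P_def by (intro elts_set_of small_image small_elts)
  have "(\<Union>i\<in>I. B i) = (\<lambda>p. g (f (kfst p)) (ksnd p)) ` (\<Union>a\<in>elts x. elts (P a))"
    using I B by (force simp: P image_iff)
  then show ?thesis using small_image[OF aux] by metis
qed

lemma small_Sigma:
  assumes "small TYPE('u::set_universe) I" and "\<And>i. i \<in> I \<Longrightarrow> small TYPE('u) (B i)"
  shows "small TYPE('u) (Sigma I B)"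
proof -
  have "Sigma I B = (\<Union>i\<in>I. Pair i ` B i)" by auto
  then show ?thesis using assms by (simp add: small_UN small_image)
qed

lemma small_Pow:
  assumes "small TYPE('u::set_universe) X" shows "small TYPE('u) (Pow X)"
proof -
  obtain x :: 'u and f where X: "X = f ` elts x" using assms unfolding small_def by blast
  obtain z where z: "elts z = {y. elts y \<subseteq> elts x}" using powerset by blast
  have "Pow (elts x) \<subseteq> elts ` elts z"
  proof
    fix A assume "A \<in> Pow (elts x)"
    then obtain y where "elts y = A" using separation by blast
    with \<open>A \<in> Pow (elts x)\<close> z show "A \<in> elts ` elts z" by auto
  qed
  then have "small TYPE('u) (Pow (elts x))"
    by (rule small_subset[OF small_image[OF small_elts]])
  moreover have "Pow X = image f ` Pow (elts x)" using X by (simp add: image_Pow_surj)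
  ultimately show ?thesis using small_image by metis
qed

text \<open>A function in the product is recovered from its graph, a subset of the small set
  \<open>Sigma I B\<close>; the restriction to \<open>I\<close> fixes its values elsewhere.\<close>

lemma small_PiE:
  assumes "small TYPE('u::set_universe) I" and "\<And>i. i \<in> I \<Longrightarrow> small TYPE('u) (B i)"
  shows "small TYPE('u) (PiE I B)"
proof (rule small_subset[OF small_image[OF small_Pow[OF small_Sigma[OF assms]]]])
  show "PiE I B \<subseteq> (\<lambda>R. \<lambda>i\<in>I. THE y. (i, y) \<in> R) ` Pow (Sigma I B)"
  proof
    fix f assume f: "f \<in> PiE I B"
    then have "f = (\<lambda>i\<in>I. THE y. (i, y) \<in> (\<lambda>i. (i, f i)) ` I)"
      by (intro extensionalityI[of _ I]) (auto simp: PiE_def intro!: the_equality[symmetric])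
    moreover have "(\<lambda>i. (i, f i)) ` I \<in> Pow (Sigma I B)" using f by auto
    ultimately show "f \<in> (\<lambda>R. \<lambda>i\<in>I. THE y. (i, y) \<in> R) ` Pow (Sigma I B)" by blast
  qed
qed auto

text \<open>Smallness only provides a surjection from a set of the universe. Keeping one preimage of
  each point makes it bijective, so that a small set can be coded by the elements of an underlying
  set.\<close>

lemma small_bij:
  assumes "small TYPE('u::set_universe) X"
  obtains z :: "'u::set_universe" and f where "bij_betw f (elts z) X"
proof -
  obtain x :: 'u and f where X: "X = f ` elts x" using assms unfolding small_def by blast
  then have "small TYPE('u) (inv_into (elts x) f ` X)" using assms by (simp add: small_image)
  then obtain z where "elts z = inv_into (elts x) f ` X" using small_imp_elts by blast
  moreover have "bij_betw f (inv_into (elts x) f ` X) X"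
    using X by (force simp: bij_betw_def inj_on_def f_inv_into_f image_image inv_into_into)
  ultimately show thesis using that by metis
qed

lemma elts_cartesian: "elts (cartesian x y) = {kpair a b | a b. a \<in> elts x \<and> b \<in> elts y}"
proof -
  have "{kpair a b | a b. a \<in> elts x \<and> b \<in> elts y}
      = (\<lambda>(a, b). kpair a b) ` (elts x \<times> elts y)" by auto
  then have "small TYPE('a) {kpair a b | a b. a \<in> elts x \<and> b \<in> elts y}"
    by (simp add: small_image small_Sigma)
  then show ?thesis unfolding cartesian_def by (rule elts_set_of)
qed

lemma kpair_in_cartesian [simp]: "kpair a b \<in> elts (cartesian x y) \<longleftrightarrow> a \<in> elts x \<and> b \<in> elts y"
  by (auto simp: elts_cartesian)

lemma ball_cartesian:
  "(\<forall>q\<in>elts (cartesian x y). P q) \<longleftrightarrow> (\<forall>a\<in>elts x. \<forall>b\<in>elts y. P (kpair a b))"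
  by (auto simp: elts_cartesian)

lemma elts_cartesianE:
  assumes "q \<in> elts (cartesian x y)"
  obtains a b where "q = kpair a b" "a \<in> elts x" "b \<in> elts y"
  using assms by (auto simp: elts_cartesian)

lemma elts_singleton: "elts singleton = {set_of {}}"
  unfolding singleton_def by simp

section \<open>Reasoning with elements\<close>

lemma hom_SET_iff:
  "f \<in> hom\<^bsub>SET\<^esub> x y \<longleftrightarrow> (\<exists>F. f = (x, F, y) \<and> F \<in> elts x \<rightarrow>\<^sub>E elts y)"
  by (cases f) (auto simp: Hom_def SET_def)

lemma set_arrow_hom: "F \<in> elts x \<rightarrow> elts y \<Longrightarrow> set_arrow x F y \<in> hom\<^bsub>SET\<^esub> x y"
  by (auto simp: hom_SET_iff set_arrow_def)

lemma Cmp_SET: "(y', g, z) \<cdot>\<^bsub>SET\<^esub> (x, f, y) = set_arrow x (\<lambda>a. g (f a)) z"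
  by (simp add: SET_def)

locale topological_closed = symmetric_monoidal_closed V
  for V :: "('o, 'm) closed" (structure) +
  fixes Uo :: "'o \<Rightarrow> 'u::set_universe" and Ua :: "'m \<Rightarrow> 'u set_arrow"
  assumes topological: "topological V Uo Ua"
    and strict: "strict_symmetric_monoidal V SET Uo Ua"
    and represented: "represented_by V Uo Ua \<I>"
begin

abbreviation el :: "'o \<Rightarrow> 'u set" where
  "el A \<equiv> elts (Uo A)"

definition app :: "'m \<Rightarrow> 'u \<Rightarrow> 'u" (infixr "\<star>" 85) where
  "f \<star> a = fst (snd (Ua f)) a"

section \<open>Morphisms as functions on underlying sets\<close>

lemma in_hom: "f \<in> hom A B \<longleftrightarrow> f \<in> Arr V \<and> Dom V f = A \<and> Cod V f = B"
  by (auto simp: Hom_def)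

lemma dom_ob [simp]: "f \<in> Arr V \<Longrightarrow> Dom V f \<in> Ob V"
  and cod_ob [simp]: "f \<in> Arr V \<Longrightarrow> Cod V f \<in> Ob V"
  using dom_cod by auto

lemma arr_idn [simp]:
  "A \<in> Ob V \<Longrightarrow> idn A \<in> Arr V" "A \<in> Ob V \<Longrightarrow> Dom V (idn A) = A" "A \<in> Ob V \<Longrightarrow> Cod V (idn A) = A"
  using idn_hom by (auto simp: in_hom)

lemma arr_cmp [simp]:
  assumes "f \<in> Arr V" "g \<in> Arr V" "Dom V g = Cod V f"
  shows "g \<cdot> f \<in> Arr V" "Dom V (g \<cdot> f) = Dom V f" "Cod V (g \<cdot> f) = Cod V g"
  using cmp_hom[of f "Dom V f" "Cod V f" g "Cod V g"] assms by (auto simp: in_hom)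

lemma Ua_functor: "is_functor V SET Uo Ua"
  using topological unfolding topological_def by blast

lemma Ua_eq:
  assumes "f \<in> Arr V"
  shows "Ua f = (Uo (Dom V f), app f, Uo (Cod V f))" "app f \<in> el (Dom V f) \<rightarrow>\<^sub>E el (Cod V f)"
proof -
  have "f \<in> hom (Dom V f) (Cod V f)" using assms by (simp add: in_hom)
  then have "Ua f \<in> hom\<^bsub>SET\<^esub> (Uo (Dom V f)) (Uo (Cod V f))"
    using Ua_functor unfolding is_functor_def by blast
  then show "Ua f = (Uo (Dom V f), app f, Uo (Cod V f))" "app f \<in> el (Dom V f) \<rightarrow>\<^sub>E el (Cod V f)"
    by (auto simp: hom_SET_iff app_def[abs_def])
qed

lemma app_in [simp]: "f \<in> Arr V \<Longrightarrow> a \<in> el (Dom V f) \<Longrightarrow> Cod V f = B \<Longrightarrow> f \<star> a \<in> el B"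
  using Ua_eq(2)[of f] by auto

lemma app_idn [simp]: "A \<in> Ob V \<Longrightarrow> a \<in> el A \<Longrightarrow> idn A \<star> a = a"
  using Ua_functor by (auto simp: is_functor_def app_def SET_def set_arrow_def)

lemma app_cmp [simp]:
  assumes "f \<in> Arr V" "g \<in> Arr V" "Dom V g = Cod V f" "a \<in> el (Dom V f)"
  shows "(g \<cdot> f) \<star> a = g \<star> f \<star> a"
proof -
  have "f \<in> hom (Dom V f) (Cod V f)" "g \<in> hom (Cod V f) (Cod V g)"
    using assms by (auto simp: in_hom)
  then have "Ua (g \<cdot> f) = Ua g \<cdot>\<^bsub>SET\<^esub> Ua f" using Ua_functor unfolding is_functor_def by blast
  then have "Ua (g \<cdot> f) = set_arrow (Uo (Dom V f)) (\<lambda>a. g \<star> f \<star> a) (Uo (Cod V g))"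
    using assms by (simp add: Ua_eq(1) Cmp_SET)
  then show ?thesis using assms(4) by (simp add: app_def[of "g \<cdot> f"] set_arrow_def)
qed

text \<open>This is faithfulness of the functor to sets. Diagrams in V are reduced to computations
  with elements through this rule.\<close>

lemma arr_eqI:
  assumes "f \<in> Arr V" "g \<in> Arr V" "Dom V f = Dom V g" "Cod V f = Cod V g"
    and "\<And>a. a \<in> el (Dom V f) \<Longrightarrow> f \<star> a = g \<star> a"
  shows "f = g"
proof -
  have "app f = app g"
    using Ua_eq(2)[OF assms(1)] Ua_eq(2)[OF assms(2)] assms(3-5)
    by (intro extensionalityI[of _ "el (Dom V f)"]) (auto simp: PiE_def)
  then have "Ua f = Ua g" using assms by (simp add: Ua_eq(1))
  moreover have "inj_on Ua (hom (Dom V f) (Cod V f))"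
    using topological unfolding topological_def faithful_def by blast
  ultimately show ?thesis using assms by (auto simp: inj_on_def in_hom)
qed

section \<open>Tensor products and coherence isomorphisms on elements\<close>

lemma tensor_ob' [simp]: "A \<in> Ob V \<Longrightarrow> B \<in> Ob V \<Longrightarrow> A \<otimes> B \<in> Ob V"
  by (rule tensor_ob)

lemma arr_tensor [simp]:
  assumes "f \<in> Arr V" "g \<in> Arr V"
  shows "f \<otimes>\<^sub>1 g \<in> Arr V" "Dom V (f \<otimes>\<^sub>1 g) = Dom V f \<otimes> Dom V g" "Cod V (f \<otimes>\<^sub>1 g) = Cod V f \<otimes> Cod V g"
  using tensor_arr[of f "Dom V f" "Cod V f" g "Dom V g" "Cod V g"] assms by (auto simp: in_hom)

text \<open>Strictness of the monoidal functor gives an equality of sets, not just a bijection: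
  elements of a tensor product are literally pairs, and the coherence morphisms rearrange
  them.\<close>

lemma el_tensor:
  "A \<in> Ob V \<Longrightarrow> B \<in> Ob V \<Longrightarrow> el (A \<otimes> B) = {kpair a b | a b. a \<in> el A \<and> b \<in> el B}"
  using strict by (simp add: strict_symmetric_monoidal_def SET_def elts_cartesian)

lemma kpair_in_tensor [simp]:
  "A \<in> Ob V \<Longrightarrow> B \<in> Ob V \<Longrightarrow> kpair a b \<in> el (A \<otimes> B) \<longleftrightarrow> a \<in> el A \<and> b \<in> el B"
  by (auto simp: el_tensor)

lemma el_tensorE:
  assumes "p \<in> el (A \<otimes> B)" "A \<in> Ob V" "B \<in> Ob V"
  obtains a b where "p = kpair a b" "a \<in> el A" "b \<in> el B"
  using assms by (auto simp: el_tensor)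

lemma app_tensor [simp]:
  assumes "f \<in> Arr V" "g \<in> Arr V" "a \<in> el (Dom V f)" "b \<in> el (Dom V g)"
  shows "(f \<otimes>\<^sub>1 g) \<star> kpair a b = kpair (f \<star> a) (g \<star> b)"
proof -
  have "Ua (f \<otimes>\<^sub>1 g) = Ua f \<otimes>\<^sub>1\<^bsub>SET\<^esub> Ua g"
    using strict assms unfolding strict_symmetric_monoidal_def by blast
  then show ?thesis
    using assms by (simp add: app_def[of "f \<otimes>\<^sub>1 g"] Ua_eq(1)[OF assms(1)] Ua_eq(1)[OF assms(2)]
        SET_def set_arrow_def elts_cartesian)
qed

lemma unit_ob' [simp]: "\<I> \<in> Ob V"
  by (rule unit_ob)

abbreviation pt :: 'u where
  "pt \<equiv> set_of {}"

lemma el_unit [simp]: "el \<I> = {pt}"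
  using strict by (simp add: strict_symmetric_monoidal_def SET_def elts_singleton)

lemma arr_assoc [simp]:
  assumes "A \<in> Ob V" "B \<in> Ob V" "D \<in> Ob V"
  shows "assoc A B D \<in> Arr V" "Dom V (assoc A B D) = A \<otimes> B \<otimes> D"
    "Cod V (assoc A B D) = A \<otimes> (B \<otimes> D)"
  using assoc_hom[OF assms] by (auto simp: in_hom)

lemma arr_lunit [simp]:
  assumes "A \<in> Ob V"
  shows "lunit A \<in> Arr V" "Dom V (lunit A) = \<I> \<otimes> A" "Cod V (lunit A) = A"
  using lunit_hom[OF assms] by (auto simp: in_hom)

lemma arr_runit [simp]:
  assumes "A \<in> Ob V"
  shows "runit A \<in> Arr V" "Dom V (runit A) = A \<otimes> \<I>" "Cod V (runit A) = A"
  using runit_hom[OF assms] by (auto simp: in_hom)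

lemma arr_symm [simp]:
  assumes "A \<in> Ob V" "B \<in> Ob V"
  shows "symm A B \<in> Arr V" "Dom V (symm A B) = A \<otimes> B" "Cod V (symm A B) = B \<otimes> A"
  using symm_hom[OF assms] by (auto simp: in_hom)

lemma app_assoc [simp]:
  assumes "A \<in> Ob V" "B \<in> Ob V" "D \<in> Ob V" "a \<in> el A" "b \<in> el B" "d \<in> el D"
  shows "assoc A B D \<star> kpair (kpair a b) d = kpair a (kpair b d)"
proof -
  have "Ua (assoc A B D) = assoc\<^bsub>SET\<^esub> (Uo A) (Uo B) (Uo D)"
    using strict assms unfolding strict_symmetric_monoidal_def by blast
  then show ?thesis using assms by (simp add: app_def SET_def set_arrow_def elts_cartesian)
qed

lemma app_lunit [simp]: "A \<in> Ob V \<Longrightarrow> a \<in> el A \<Longrightarrow> lunit A \<star> kpair pt a = a"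
  using strict
  by (simp add: strict_symmetric_monoidal_def app_def SET_def set_arrow_def elts_cartesian
      elts_singleton)

lemma app_runit [simp]: "A \<in> Ob V \<Longrightarrow> a \<in> el A \<Longrightarrow> runit A \<star> kpair a pt = a"
  using strict
  by (simp add: strict_symmetric_monoidal_def app_def SET_def set_arrow_def elts_cartesian
      elts_singleton)

lemma app_symm [simp]:
  assumes "A \<in> Ob V" "B \<in> Ob V" "a \<in> el A" "b \<in> el B"
  shows "symm A B \<star> kpair a b = kpair b a"
  using strict assms
  by (simp add: strict_symmetric_monoidal_def app_def SET_def set_arrow_def elts_cartesian)

text \<open>Uniqueness of inverses gives the description in \<open>inv_arrow\<close> its meaning.
  The left inverse law suffices to compute with inverses of coherence isomorphisms, because the
  arguments they receive are visibly values of the isomorphism.\<close>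

lemma inv_arrow_inverse:
  assumes "iso f" "f \<in> Arr V"
  shows "inv_arrow f \<in> Arr V" "Dom V (inv_arrow f) = Cod V f" "Cod V (inv_arrow f) = Dom V f"
    "a \<in> el (Dom V f) \<Longrightarrow> inv_arrow f \<star> f \<star> a = a"
proof -
  obtain g where g: "inverse_arrows f g" using assms unfolding iso_def by blast
  have "inverse_arrows f (inv_arrow f)" unfolding inv_arrow_def
  proof (rule theI[of _ g])
    fix g' assume g': "inverse_arrows f g'"
    have "g' = g' \<cdot> (f \<cdot> g)"
      using g g' idn_right unfolding inverse_arrows_def by metis
    also have "\<dots> = (g' \<cdot> f) \<cdot> g"
      using g g' cmp_assoc unfolding inverse_arrows_def by metis
    also have "\<dots> = g" using g g' idn_left unfolding inverse_arrows_def by metis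
    finally show "g' = g" .
  qed (rule g)
  then have inv: "inv_arrow f \<in> hom (Cod V f) (Dom V f)" "inv_arrow f \<cdot> f = idn (Dom V f)"
    unfolding inverse_arrows_def by auto
  then show *: "inv_arrow f \<in> Arr V" "Dom V (inv_arrow f) = Cod V f" "Cod V (inv_arrow f) = Dom V f"
    by (auto simp: in_hom)
  assume "a \<in> el (Dom V f)"
  then show "inv_arrow f \<star> f \<star> a = a"
    using inv(2) app_cmp[of f "inv_arrow f" a] * assms(2) by simp
qed

lemma inv_assoc [simp]:
  assumes "A \<in> Ob V" "B \<in> Ob V" "D \<in> Ob V"
  shows "inv_arrow (assoc A B D) \<in> Arr V" "Dom V (inv_arrow (assoc A B D)) = A \<otimes> (B \<otimes> D)"
    "Cod V (inv_arrow (assoc A B D)) = A \<otimes> B \<otimes> D"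
    "a \<in> el A \<Longrightarrow> b \<in> el B \<Longrightarrow> d \<in> el D \<Longrightarrow>
       inv_arrow (assoc A B D) \<star> kpair a (kpair b d) = kpair (kpair a b) d"
proof -
  have i: "iso (assoc A B D)" using assoc_hom[OF assms] by simp
  show "inv_arrow (assoc A B D) \<in> Arr V" "Dom V (inv_arrow (assoc A B D)) = A \<otimes> (B \<otimes> D)"
    "Cod V (inv_arrow (assoc A B D)) = A \<otimes> B \<otimes> D"
    using inv_arrow_inverse(1-3)[OF i] assms by auto
  assume "a \<in> el A" "b \<in> el B" "d \<in> el D"
  then show "inv_arrow (assoc A B D) \<star> kpair a (kpair b d) = kpair (kpair a b) d"
    using inv_arrow_inverse(4)[OF i, of "kpair (kpair a b) d"] assms by simp
qed

lemma inv_lunit [simp]: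
  assumes "A \<in> Ob V"
  shows "inv_arrow (lunit A) \<in> Arr V" "Dom V (inv_arrow (lunit A)) = A"
    "Cod V (inv_arrow (lunit A)) = \<I> \<otimes> A"
    "a \<in> el A \<Longrightarrow> inv_arrow (lunit A) \<star> a = kpair pt a"
proof -
  have i: "iso (lunit A)" using lunit_hom[OF assms] by simp
  show "inv_arrow (lunit A) \<in> Arr V" "Dom V (inv_arrow (lunit A)) = A"
    "Cod V (inv_arrow (lunit A)) = \<I> \<otimes> A"
    using inv_arrow_inverse(1-3)[OF i] assms by auto
  assume "a \<in> el A"
  then show "inv_arrow (lunit A) \<star> a = kpair pt a"
    using inv_arrow_inverse(4)[OF i, of "kpair pt a"] assms by simp
qed

text \<open>The representing bijection is an arbitrary natural one. As in the Yoneda lemma,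
  naturality forces it to be evaluation at the image of the identity of \<I>, and that image can
  only be \<open>pt\<close>, the sole element of \<I>. Elements are therefore values of points, and
  \<open>arr_eqI\<close> makes the point unique.\<close>

lemma point:
  assumes "A \<in> Ob V" "a \<in> el A"
  obtains m where "m \<in> hom \<I> A" "m \<star> pt = a"
proof -
  obtain \<phi> where bij: "\<forall>A\<in>Ob V. bij_betw (\<phi> A) (hom \<I> A) (el A)"
    and nat: "\<forall>A B. \<forall>f\<in>hom A B. \<forall>m\<in>hom \<I> A. \<phi> B (f \<cdot> m) = f \<star> \<phi> A m"
    using represented unfolding represented_by_def app_def by (elim conjE exE)
  have "a \<in> \<phi> A ` hom \<I> A" using bij assms by (auto dest: bij_betw_imp_surj_on)
  then obtain m where m: "m \<in> hom \<I> A" "\<phi> A m = a" by (elim imageE) simp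
  have i: "idn \<I> \<in> hom \<I> \<I>" by (simp add: in_hom)
  have "\<phi> \<I> (idn \<I>) \<in> el \<I>" using bspec[OF bij unit_ob] i by (rule bij_betw_apply)
  then have "\<phi> A (m \<cdot> idn \<I>) = m \<star> pt" using nat m(1) i by simp
  then show thesis using that m idn_right[OF m(1)] by simp
qed

section \<open>Internal homs on elements\<close>

lemma ihom_ob' [simp]: "A \<in> Ob V \<Longrightarrow> B \<in> Ob V \<Longrightarrow> ihom A B \<in> Ob V"
  by (rule ihom_ob)

lemma arr_ev [simp]:
  assumes "A \<in> Ob V" "B \<in> Ob V"
  shows "ev A B \<in> Arr V" "Dom V (ev A B) = ihom A B \<otimes> A" "Cod V (ev A B) = B"
  using ev_hom[OF assms] by (auto simp: in_hom)

abbreviation evl :: "'o \<Rightarrow> 'o \<Rightarrow> 'u \<Rightarrow> 'u \<Rightarrow> 'u" where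
  "evl A B h a \<equiv> ev A B \<star> kpair h a"

text \<open>The beta rule for internal homs. With the extensionality rule \<open>ihom_eqI\<close> it
  lets composites of curried morphisms be computed like nested functions.\<close>

lemma curry_arrow [simp]:
  assumes "f \<in> Arr V" "Dom V f = A \<otimes> B" "Cod V f = D" "A \<in> Ob V" "B \<in> Ob V"
  shows "curry_arrow A B D f \<in> Arr V" "Dom V (curry_arrow A B D f) = A"
    "Cod V (curry_arrow A B D f) = ihom B D"
    "a \<in> el A \<Longrightarrow> b \<in> el B \<Longrightarrow> evl B D (curry_arrow A B D f \<star> a) b = f \<star> kpair a b"
proof -
  have D: "D \<in> Ob V" using assms by auto
  then have "\<exists>!g. g \<in> hom A (ihom B D) \<and> ev B D \<cdot> (g \<otimes>\<^sub>1 idn B) = f"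
    using ev_universal[OF assms(4,5) D] assms by (simp add: in_hom)
  from theI'[OF this] have g: "curry_arrow A B D f \<in> hom A (ihom B D)"
    and ev: "ev B D \<cdot> (curry_arrow A B D f \<otimes>\<^sub>1 idn B) = f"
    unfolding curry_arrow_def by auto
  from g show *: "curry_arrow A B D f \<in> Arr V" "Dom V (curry_arrow A B D f) = A"
    "Cod V (curry_arrow A B D f) = ihom B D"
    by (auto simp: in_hom)
  assume ab: "a \<in> el A" "b \<in> el B"
  have "f \<star> kpair a b = (ev B D \<cdot> (curry_arrow A B D f \<otimes>\<^sub>1 idn B)) \<star> kpair a b"
    using ev by simp
  also have "\<dots> = evl B D (curry_arrow A B D f \<star> a) b"
    using ab * assms(4,5) D by simp
  finally show "evl B D (curry_arrow A B D f \<star> a) b = f \<star> kpair a b" ..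
qed

text \<open>Both elements are values of points of the internal hom. The transposes of these points
  agree on elements, hence coincide by faithfulness, and transposition is injective.\<close>

lemma ihom_eqI:
  assumes "h \<in> el (ihom A B)" "k \<in> el (ihom A B)" "A \<in> Ob V" "B \<in> Ob V"
    and eq: "\<And>a. a \<in> el A \<Longrightarrow> evl A B h a = evl A B k a"
  shows "h = k"
proof -
  obtain m where m: "m \<in> hom \<I> (ihom A B)" "m \<star> pt = h" using point assms by (metis ihom_ob)
  obtain n where n: "n \<in> hom \<I> (ihom A B)" "n \<star> pt = k" using point assms by (metis ihom_ob)
  let ?f = "ev A B \<cdot> (m \<otimes>\<^sub>1 idn A)"
  have f: "?f \<in> hom (\<I> \<otimes> A) B" using m assms by (simp add: in_hom)
  have "?f = ev A B \<cdot> (n \<otimes>\<^sub>1 idn A)"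
  proof (rule arr_eqI)
    fix p assume "p \<in> el (Dom V ?f)"
    then obtain a where "p = kpair pt a" "a \<in> el A"
      using f assms by (auto simp: in_hom el_tensor)
    then show "?f \<star> p = (ev A B \<cdot> (n \<otimes>\<^sub>1 idn A)) \<star> p"
      using m n assms by (simp add: in_hom)
  qed (use m n assms in \<open>simp_all add: in_hom\<close>)
  then have "m = n" using ev_universal[OF unit_ob assms(3,4) f] m n by auto
  with m n show ?thesis by simp
qed

text \<open>Together with \<open>arrow_of_element\<close> this identifies elements of [A, B] with
  morphisms A \<rightarrow> B: an element is a point of [A, B], and the transpose of a point is a
  morphism out of \<I> \<otimes> A, which is isomorphic to A.\<close>

lemma element_of_arrow:
  assumes "m \<in> hom A B"
  obtains h where "h \<in> el (ihom A B)" "\<And>a. a \<in> el A \<Longrightarrow> evl A B h a = m \<star> a"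
proof
  have m: "m \<in> Arr V" "Dom V m = A" "Cod V m = B" "A \<in> Ob V" "B \<in> Ob V"
    using assms by (auto simp: in_hom)
  show "curry_arrow \<I> A B (m \<cdot> lunit A) \<star> pt \<in> el (ihom A B)" using m by simp
  show "evl A B (curry_arrow \<I> A B (m \<cdot> lunit A) \<star> pt) a = m \<star> a" if "a \<in> el A" for a
    using m that by simp
qed

lemma arrow_of_element:
  assumes "h \<in> el (ihom A B)" "A \<in> Ob V" "B \<in> Ob V"
  obtains m where "m \<in> hom A B" "\<And>a. a \<in> el A \<Longrightarrow> m \<star> a = evl A B h a"
proof -
  obtain n where n: "n \<in> hom \<I> (ihom A B)" "n \<star> pt = h" using point assms by (metis ihom_ob)
  have "ev A B \<cdot> (n \<otimes>\<^sub>1 idn A) \<cdot> inv_arrow (lunit A) \<in> hom A B"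
    using n assms by (simp add: in_hom)
  moreover have "(ev A B \<cdot> (n \<otimes>\<^sub>1 idn A) \<cdot> inv_arrow (lunit A)) \<star> a = evl A B h a"
    if "a \<in> el A" for a
    using n assms that by (simp add: in_hom)
  ultimately show thesis using that by blast
qed

text \<open>Evaluation at a fixed element is itself a morphism of V: replace \<open>a\<close> by the
  point that names it, tensor with [A, B] and apply \<open>ev\<close> after the symmetry. It
  supplies the components of \<open>arity_iso_inv\<close>.\<close>

lemma evaluation_arrow:
  assumes "A \<in> Ob V" "B \<in> Ob V" "a \<in> el A"
  shows "\<exists>m. m \<in> hom (ihom A B) B \<and> (\<forall>h\<in>el (ihom A B). m \<star> h = evl A B h a)"
proof -
  obtain n where n: "n \<in> hom \<I> A" "n \<star> pt = a" by (rule point[OF assms(1,3)])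
  let ?m = "ev A B \<cdot> symm A (ihom A B) \<cdot> (n \<otimes>\<^sub>1 idn (ihom A B)) \<cdot> inv_arrow (lunit (ihom A B))"
  have "?m \<in> hom (ihom A B) B" using n assms by (simp add: in_hom)
  moreover have "?m \<star> h = evl A B h a" if "h \<in> el (ihom A B)" for h
    using n assms that by (simp add: in_hom)
  ultimately show ?thesis by blast
qed

section \<open>The enriched structure of V on elements\<close>

lemma VId_self [simp]:
  assumes "A \<in> Ob V"
  shows "VId self_vcat A \<in> Arr V" "Dom V (VId self_vcat A) = \<I>"
    "Cod V (VId self_vcat A) = ihom A A" "a \<in> el A \<Longrightarrow> evl A A (VId self_vcat A \<star> pt) a = a"
  using assms by (simp_all add: self_vcat_def)

lemma VCmp_self [simp]:
  assumes "A \<in> Ob V" "B \<in> Ob V" "D \<in> Ob V"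
  shows "VCmp self_vcat A B D \<in> Arr V" "Dom V (VCmp self_vcat A B D) = ihom B D \<otimes> ihom A B"
    "Cod V (VCmp self_vcat A B D) = ihom A D"
    "g \<in> el (ihom B D) \<Longrightarrow> f \<in> el (ihom A B) \<Longrightarrow> a \<in> el A \<Longrightarrow>
       evl A D (VCmp self_vcat A B D \<star> kpair g f) a = evl B D g (evl A B f a)"
  using assms by (simp_all add: self_vcat_def)

lemma postcomp [simp]:
  assumes "A \<in> Ob V" "g \<in> Arr V"
  shows "postcomp A g \<in> Arr V" "Dom V (postcomp A g) = ihom A (Dom V g)"
    "Cod V (postcomp A g) = ihom A (Cod V g)"
    "Cod V g = D \<Longrightarrow> h \<in> el (ihom A (Dom V g)) \<Longrightarrow> a \<in> el A \<Longrightarrow>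
       evl A D (postcomp A g \<star> h) a = g \<star> evl A (Dom V g) h a"
  using assms by (auto simp: postcomp_def)

lemma precomp [simp]:
  assumes "D \<in> Ob V" "g \<in> Arr V"
  shows "precomp g D \<in> Arr V" "Dom V (precomp g D) = ihom (Cod V g) D"
    "Cod V (precomp g D) = ihom (Dom V g) D"
    "Dom V g = B \<Longrightarrow> h \<in> el (ihom (Cod V g) D) \<Longrightarrow> a \<in> el B \<Longrightarrow>
       evl B D (precomp g D \<star> h) a = evl (Cod V g) D h (g \<star> a)"
  using assms by (auto simp: precomp_def)

lemma ltensor_vfun [simp]:
  assumes "P \<in> Ob V" "A \<in> Ob V" "B \<in> Ob V"
  shows "snd (ltensor_vfun P) A B \<in> Arr V" "Dom V (snd (ltensor_vfun P) A B) = ihom A B"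
    "Cod V (snd (ltensor_vfun P) A B) = ihom (P \<otimes> A) (P \<otimes> B)"
    "h \<in> el (ihom A B) \<Longrightarrow> p \<in> el P \<Longrightarrow> a \<in> el A \<Longrightarrow>
       evl (P \<otimes> A) (P \<otimes> B) (snd (ltensor_vfun P) A B \<star> h) (kpair p a) = kpair p (evl A B h a)"
  using assms by (simp_all add: ltensor_vfun_def)

lemma rtensor_vfun [simp]:
  assumes "P \<in> Ob V" "A \<in> Ob V" "B \<in> Ob V"
  shows "snd (rtensor_vfun P) A B \<in> Arr V" "Dom V (snd (rtensor_vfun P) A B) = ihom A B"
    "Cod V (snd (rtensor_vfun P) A B) = ihom (A \<otimes> P) (B \<otimes> P)"
    "h \<in> el (ihom A B) \<Longrightarrow> a \<in> el A \<Longrightarrow> p \<in> el P \<Longrightarrow>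
       evl (A \<otimes> P) (B \<otimes> P) (snd (rtensor_vfun P) A B \<star> h) (kpair a p) = kpair (evl A B h a) p"
  using assms by (simp_all add: rtensor_vfun_def)

end

section \<open>Limits and copowers in topological categories\<close>

lemma ex1_eq: "\<exists>!x. P x \<Longrightarrow> P a \<Longrightarrow> P b \<Longrightarrow> a = b"
  by blast

context topological_closed
begin

section \<open>Initial lifts and products\<close>

lemma admissible_set_arrow:
  assumes "A \<in> Ob V" "B \<in> Ob V"
  shows "admissible V Ua A B (set_arrow (Uo A) F (Uo B)) \<longleftrightarrow> (\<exists>m\<in>hom A B. \<forall>a\<in>el A. m \<star> a = F a)"
proof -
  have "Ua m = set_arrow (Uo A) F (Uo B) \<longleftrightarrow> (\<forall>a\<in>el A. m \<star> a = F a)" if "m \<in> hom A B" for m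
  proof
    assume "Ua m = set_arrow (Uo A) F (Uo B)"
    then show "\<forall>a\<in>el A. m \<star> a = F a" by (simp add: app_def set_arrow_def)
  next
    assume "\<forall>a\<in>el A. m \<star> a = F a"
    then have "app m = restrict F (el A)"
      using that Ua_eq(2)[of m]
      by (intro extensionalityI[of _ "el A"]) (auto simp: PiE_def in_hom)
    then show "Ua m = set_arrow (Uo A) F (Uo B)"
      using that Ua_eq(1)[of m] by (simp add: in_hom set_arrow_def)
  qed
  then show ?thesis unfolding admissible_def by auto
qed

lemma point_ex: "A \<in> Ob V \<Longrightarrow> a \<in> el A \<Longrightarrow> \<exists>m\<in>hom \<I> A. m \<star> pt = a"
  by (rule point) auto

text \<open>Initial lifts for indexed families, with functions on elements in place of arrows of
  \<open>SET\<close>. The last clause is the substantial half of initiality: G lifts as soon as all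
  its composites do. The index set has arbitrary type and size, and \<open>copower_unit\<close>
  needs this, since its source ranges over all objects of V.\<close>

lemma initial_lift:
  assumes "\<And>i. i \<in> I \<Longrightarrow> X i \<in> Ob V" and F: "\<And>i. i \<in> I \<Longrightarrow> F i \<in> elts Y \<rightarrow> el (X i)"
  obtains A p where "A \<in> Ob V" "Uo A = Y" "\<And>i. i \<in> I \<Longrightarrow> p i \<in> hom A (X i)"
    "\<And>i a. i \<in> I \<Longrightarrow> a \<in> elts Y \<Longrightarrow> p i \<star> a = F i a"
    "\<And>W G. W \<in> Ob V \<Longrightarrow> G \<in> el W \<rightarrow> elts Y \<Longrightarrow>
       (\<And>i. i \<in> I \<Longrightarrow> \<exists>m\<in>hom W (X i). \<forall>w\<in>el W. m \<star> w = F i (G w)) \<Longrightarrow>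
       \<exists>m\<in>hom W A. \<forall>w\<in>el W. m \<star> w = G w"
proof -
  define src where "src = (\<lambda>i. (X i, set_arrow Y (F i) (Uo (X i)))) ` I"
  have "\<forall>(B, g)\<in>src. B \<in> Ob V \<and> g \<in> hom\<^bsub>SET\<^esub> Y (Uo B)"
    using assms by (auto simp: src_def intro!: set_arrow_hom)
  then obtain A where A: "A \<in> Ob V" "Uo A = Y" and adm: "\<forall>(B, g)\<in>src. admissible V Ua A B g"
    and init: "initial_source V Uo Ua A src"
    using topological unfolding topological_def by meson
  have "\<exists>m\<in>hom A (X i). \<forall>a\<in>elts Y. m \<star> a = F i a" if "i \<in> I" for i
  proof -
    have "admissible V Ua A (X i) (set_arrow Y (F i) (Uo (X i)))"
      using adm that by (auto simp: src_def)
    then show ?thesis using A admissible_set_arrow[of A "X i" "F i"] assms(1)[OF that] by simp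
  qed
  then obtain p where p: "\<And>i. i \<in> I \<Longrightarrow> p i \<in> hom A (X i) \<and> (\<forall>a\<in>elts Y. p i \<star> a = F i a)"
    by metis
  have univ: "\<exists>m\<in>hom W A. \<forall>w\<in>el W. m \<star> w = G w"
    if W: "W \<in> Ob V" and G: "G \<in> el W \<rightarrow> elts Y"
      and ex: "\<And>i. i \<in> I \<Longrightarrow> \<exists>m\<in>hom W (X i). \<forall>w\<in>el W. m \<star> w = F i (G w)" for W G
  proof -
    have "admissible V Ua W B (g \<cdot>\<^bsub>SET\<^esub> set_arrow (Uo W) G (Uo A))" if Bg: "(B, g) \<in> src" for B g
    proof -
      obtain i where i: "i \<in> I" "B = X i" "g = set_arrow Y (F i) (Uo (X i))"
        using Bg by (auto simp: src_def)
      have "g \<cdot>\<^bsub>SET\<^esub> set_arrow (Uo W) G (Uo A) = set_arrow (Uo W) (\<lambda>w. F i (G w)) (Uo (X i))"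
        using G by (auto simp: i A set_arrow_def Cmp_SET intro!: restrict_ext)
      then show ?thesis using ex[OF i(1)] admissible_set_arrow[OF W assms(1)[OF i(1)]] i by simp
    qed
    moreover have "set_arrow (Uo W) G (Uo A) \<in> hom\<^bsub>SET\<^esub> (Uo W) (Uo A)"
      using G A by (simp add: set_arrow_hom)
    ultimately have "admissible V Ua W A (set_arrow (Uo W) G (Uo A))"
      using init W unfolding initial_source_def by blast
    then show ?thesis using admissible_set_arrow[OF W A(1)] by simp
  qed
  show thesis by (rule that[of A p]) (use A p univ in auto)
qed

text \<open>The product carries the initial structure for the coordinate functions. Its underlying
  set must be a set of the universe, so its elements are codes: \<open>c y\<close> is the family
  coded by \<open>y\<close>.\<close>

lemma product_exists:
  assumes small: "small TYPE('u) I" and X: "\<And>i. i \<in> I \<Longrightarrow> X i \<in> Ob V"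
  shows "\<exists>P p. is_product I X P p"
proof -
  have "small TYPE('u) (\<Pi>\<^sub>E i\<in>I. el (X i))" by (rule small_PiE[OF small]) simp
  then obtain Y :: 'u and c where bij: "bij_betw c (elts Y) (\<Pi>\<^sub>E i\<in>I. el (X i))"
    by (rule small_bij)
  have c: "c y i \<in> el (X i)" if "y \<in> elts Y" "i \<in> I" for y i
    using bij_betwE[OF bij] that by auto
  obtain P p where P: "P \<in> Ob V" "Uo P = Y" and p: "\<And>i. i \<in> I \<Longrightarrow> p i \<in> hom P (X i)"
    and pc: "\<And>i y. i \<in> I \<Longrightarrow> y \<in> elts Y \<Longrightarrow> p i \<star> y = c y i"
    and univ: "\<And>W G. W \<in> Ob V \<Longrightarrow> G \<in> el W \<rightarrow> elts Y \<Longrightarrow>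
       (\<And>i. i \<in> I \<Longrightarrow> \<exists>m\<in>hom W (X i). \<forall>w\<in>el W. m \<star> w = c (G w) i) \<Longrightarrow>
       \<exists>m\<in>hom W P. \<forall>w\<in>el W. m \<star> w = G w"
    by (rule initial_lift[of I X "\<lambda>i y. c y i" Y]) (use X c in auto)
  have main: "\<exists>!h. h \<in> hom A P \<and> (\<forall>i\<in>I. p i \<cdot> h = f i)"
    if A: "A \<in> Ob V" and f: "\<forall>i\<in>I. f i \<in> hom A (X i)" for A f
  proof -
    \<comment> \<open>\<open>G a\<close> is the code of the family of values
      \<open>f i \<star> a\<close>; on elements a mediating morphism has no other choice.\<close>
    define G where "G a = inv_into (elts Y) c (\<lambda>i\<in>I. f i \<star> a)" for a
    have G: "G a \<in> elts Y" "\<And>i. i \<in> I \<Longrightarrow> c (G a) i = f i \<star> a" if "a \<in> el A" for a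
    proof -
      have "(\<lambda>i\<in>I. f i \<star> a) \<in> c ` elts Y"
        using bij_betw_imp_surj_on[OF bij] f that by (auto simp: in_hom)
      then show "G a \<in> elts Y" "\<And>i. i \<in> I \<Longrightarrow> c (G a) i = f i \<star> a"
        unfolding G_def by (auto simp: inv_into_into f_inv_into_f)
    qed
    have "\<exists>m\<in>hom A P. \<forall>a\<in>el A. m \<star> a = G a"
      by (rule univ) (use A G f in \<open>auto intro!: bexI[of _ "f _"]\<close>)
    then obtain h where h: "h \<in> hom A P" "\<And>a. a \<in> el A \<Longrightarrow> h \<star> a = G a" by blast
    show ?thesis
    proof
      have "p i \<cdot> h = f i" if "i \<in> I" for i
        by (rule arr_eqI) (use h p[OF that] f that G pc in \<open>auto simp: in_hom\<close>)
      with h show "h \<in> hom A P \<and> (\<forall>i\<in>I. p i \<cdot> h = f i)" by blast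
    next
      fix h' assume h': "h' \<in> hom A P \<and> (\<forall>i\<in>I. p i \<cdot> h' = f i)"
      show "h' = h"
      proof (rule arr_eqI)
        fix a assume "a \<in> el (Dom V h')"
        then have a: "a \<in> el A" "h' \<star> a \<in> elts Y" using h' P by (auto simp: in_hom)
        have "c (h' \<star> a) i = c (G a) i" if "i \<in> I" for i
        proof -
          have "c (h' \<star> a) i = (p i \<cdot> h') \<star> a" using a h' p[OF that] pc[OF that] by (simp add: in_hom)
          also have "\<dots> = c (G a) i" using h' that G(2)[OF a(1) that] by simp
          finally show ?thesis .
        qed
        moreover have "c (h' \<star> a) \<in> (\<Pi>\<^sub>E i\<in>I. el (X i))" "c (G a) \<in> (\<Pi>\<^sub>E i\<in>I. el (X i))"
          using bij_betwE[OF bij] a G by auto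
        ultimately have "c (h' \<star> a) = c (G a)" by (auto intro: PiE_ext)
        then show "h' \<star> a = h \<star> a"
          using bij_betw_imp_inj_on[OF bij] a G(1)[OF a(1)] h(2)[OF a(1)] by (auto dest: inj_onD)
      qed (use h h' in \<open>auto simp: in_hom\<close>)
    qed
  qed
  show ?thesis
    by (intro exI[of _ P] exI[of _ p]) (simp add: is_product_def P(1) p main)
qed

lemma prd_is_product:
  assumes "small TYPE('u) I" and "\<And>i. i \<in> I \<Longrightarrow> X i \<in> Ob V"
  shows "is_product I X (prd I X) (proj I X)"
proof -
  have "\<exists>Pp. case Pp of (P, p) \<Rightarrow> is_product I X P p" using product_exists[of I X] assms by auto
  from someI_ex[OF this] show ?thesis
    by (simp add: prd_def proj_def product_def case_prod_unfold)
qed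

lemma prd_ob [simp]: "small TYPE('u) I \<Longrightarrow> (\<And>i. i \<in> I \<Longrightarrow> X i \<in> Ob V) \<Longrightarrow> prd I X \<in> Ob V"
  using prd_is_product[of I X] unfolding is_product_def by blast

lemma proj [simp]:
  assumes "i \<in> I" "small TYPE('u) I" "\<And>i. i \<in> I \<Longrightarrow> X i \<in> Ob V"
  shows "proj I X i \<in> Arr V" "Dom V (proj I X i) = prd I X" "Cod V (proj I X i) = X i"
proof -
  have "is_product I X (prd I X) (proj I X)" by (rule prd_is_product) (use assms in auto)
  then have "\<forall>i\<in>I. proj I X i \<in> hom (prd I X) (X i)" unfolding is_product_def by (elim conjE)
  then show "proj I X i \<in> Arr V" "Dom V (proj I X i) = prd I X" "Cod V (proj I X i) = X i"
    using assms(1) by (auto simp: in_hom)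
qed

lemma tuple_hom_proj:
  assumes "small TYPE('u) I" "\<And>i. i \<in> I \<Longrightarrow> f i \<in> Arr V \<and> Dom V (f i) = A \<and> Cod V (f i) = X i"
    "A \<in> Ob V"
  shows "tuple I X A f \<in> hom A (prd I X) \<and> (\<forall>i\<in>I. proj I X i \<cdot> tuple I X A f = f i)"
proof -
  have X: "X i \<in> Ob V" if "i \<in> I" for i using assms(2)[OF that] cod_ob by metis
  have "\<exists>!h. h \<in> hom A (prd I X) \<and> (\<forall>i\<in>I. proj I X i \<cdot> h = f i)"
    using prd_is_product[OF assms(1), of X, OF X] assms unfolding is_product_def in_hom by blast
  from theI'[OF this] show ?thesis unfolding tuple_def .
qed

lemma tuple [simp]:
  assumes "small TYPE('u) I" "\<And>i. i \<in> I \<Longrightarrow> f i \<in> Arr V \<and> Dom V (f i) = A \<and> Cod V (f i) = X i"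
    "A \<in> Ob V"
  shows "tuple I X A f \<in> Arr V" "Dom V (tuple I X A f) = A" "Cod V (tuple I X A f) = prd I X"
    "i \<in> I \<Longrightarrow> a \<in> el A \<Longrightarrow> proj I X i \<star> tuple I X A f \<star> a = f i \<star> a"
proof -
  have X: "X i \<in> Ob V" if "i \<in> I" for i using assms(2)[OF that] cod_ob by metis
  show *: "tuple I X A f \<in> Arr V" "Dom V (tuple I X A f) = A" "Cod V (tuple I X A f) = prd I X"
    using tuple_hom_proj[of I f A X] assms by (auto simp: in_hom)
  assume ia: "i \<in> I" "a \<in> el A"
  have "proj I X i \<star> tuple I X A f \<star> a = (proj I X i \<cdot> tuple I X A f) \<star> a"
    using ia * assms(1) X by simp
  also have "\<dots> = f i \<star> a" using tuple_hom_proj[of I f A X] assms ia(1) by simp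
  finally show "proj I X i \<star> tuple I X A f \<star> a = f i \<star> a" .
qed

lemma small_lessThan [simp]: "small TYPE('u) {..<n::nat}"
  by (simp add: small_finite)

(* The simplifier does not use the premise i : {..<n} of the general rules to discharge i < n. *)
lemma prd_nat [simp]: "(\<And>i. i < n \<Longrightarrow> X i \<in> Ob V) \<Longrightarrow> prd {..<n::nat} X \<in> Ob V"
  by (rule prd_ob) auto

lemma proj_nat [simp]:
  assumes "i < n" "\<And>i. i < n \<Longrightarrow> X i \<in> Ob V"
  shows "proj {..<n::nat} X i \<in> Arr V" "Dom V (proj {..<n} X i) = prd {..<n} X"
    "Cod V (proj {..<n} X i) = X i"
  using proj[of i "{..<n}" X] assms by auto

lemma tuple_nat [simp]:
  assumes "\<And>i. i < n \<Longrightarrow> f i \<in> Arr V \<and> Dom V (f i) = A \<and> Cod V (f i) = X i" "A \<in> Ob V"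
  shows "tuple {..<n::nat} X A f \<in> Arr V" "Dom V (tuple {..<n} X A f) = A"
    "Cod V (tuple {..<n} X A f) = prd {..<n} X"
    "i < n \<Longrightarrow> a \<in> el A \<Longrightarrow> proj {..<n} X i \<star> tuple {..<n} X A f \<star> a = f i \<star> a"
  using tuple[of "{..<n}" f A X] assms by auto

text \<open>The chosen product need not consist of families, but its elements are values of points,
  and points of a product are determined by their composites with the projections.\<close>

lemma prd_eqI:
  assumes "x \<in> el (prd I X)" "y \<in> el (prd I X)" "small TYPE('u) I" "\<And>i. i \<in> I \<Longrightarrow> X i \<in> Ob V"
    and eq: "\<And>i. i \<in> I \<Longrightarrow> proj I X i \<star> x = proj I X i \<star> y"
  shows "x = y"
proof -
  have P: "prd I X \<in> Ob V" using assms by simp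
  obtain m where m: "m \<in> hom \<I> (prd I X)" "m \<star> pt = x" using point P assms(1) by metis
  obtain n where n: "n \<in> hom \<I> (prd I X)" "n \<star> pt = y" using point P assms(2) by metis
  have mn: "proj I X i \<cdot> m = proj I X i \<cdot> n" if "i \<in> I" for i
    by (rule arr_eqI) (use m n assms that eq in \<open>auto simp: in_hom\<close>)
  have "is_product I X (prd I X) (proj I X)" by (rule prd_is_product) (use assms in auto)
  moreover have "\<forall>i\<in>I. proj I X i \<cdot> n \<in> hom \<I> (X i)"
    using n assms by (simp add: in_hom)
  ultimately have "\<exists>!h. h \<in> hom \<I> (prd I X) \<and> (\<forall>i\<in>I. proj I X i \<cdot> h = proj I X i \<cdot> n)"
    unfolding is_product_def by simp
  then have "m = n" by (rule ex1_eq) (use m(1) n(1) mn in simp_all)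
  with m n show ?thesis by simp
qed

text \<open>A subobject of X with the universal property of the subset of elements that satisfy Q.
  Unlike a joint equalizer it mentions no index set and no codomain of the equalized morphisms, so
  subobjects with different origins become comparable.\<close>

definition cuts_out :: "('u \<Rightarrow> bool) \<Rightarrow> 'o \<Rightarrow> 'o \<Rightarrow> 'm \<Rightarrow> bool" where
  "cuts_out Q X E e \<longleftrightarrow> e \<in> hom E X \<and> (\<forall>x\<in>el E. Q (e \<star> x))
     \<and> (\<forall>A. \<forall>h\<in>hom A X. (\<forall>a\<in>el A. Q (h \<star> a)) \<longrightarrow> (\<exists>!k. k \<in> hom A E \<and> e \<cdot> k = h))"

lemma equalizes_iff:
  assumes "f \<in> Arr V" "g \<in> Arr V" "Dom V f = X" "Dom V g = X" "Cod V f = Cod V g" "h \<in> hom A X"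
  shows "f \<cdot> h = g \<cdot> h \<longleftrightarrow> (\<forall>a\<in>el A. f \<star> h \<star> a = g \<star> h \<star> a)"
proof
  assume eq: "f \<cdot> h = g \<cdot> h"
  show "\<forall>a\<in>el A. f \<star> h \<star> a = g \<star> h \<star> a"
  proof
    fix a assume "a \<in> el A"
    then have "f \<star> h \<star> a = (f \<cdot> h) \<star> a" "g \<star> h \<star> a = (g \<cdot> h) \<star> a"
      using assms by (auto simp: in_hom)
    with eq show "f \<star> h \<star> a = g \<star> h \<star> a" by simp
  qed
next
  assume "\<forall>a\<in>el A. f \<star> h \<star> a = g \<star> h \<star> a"
  then show "f \<cdot> h = g \<cdot> h" by (intro arr_eqI) (use assms in \<open>auto simp: in_hom\<close>)
qed

lemma cuts_out_iff_joint_equalizer: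
  assumes "\<And>i. i \<in> I \<Longrightarrow> f i \<in> Arr V \<and> Dom V (f i) = X"
    and "\<And>i. i \<in> I \<Longrightarrow> g i \<in> Arr V \<and> Dom V (g i) = X \<and> Cod V (g i) = Cod V (f i)"
  shows "cuts_out (\<lambda>x. \<forall>i\<in>I. f i \<star> x = g i \<star> x) X E e \<longleftrightarrow> is_joint_equalizer I X f g E e"
proof -
  have "(\<forall>i\<in>I. f i \<cdot> h = g i \<cdot> h) \<longleftrightarrow> (\<forall>a\<in>el A. \<forall>i\<in>I. f i \<star> h \<star> a = g i \<star> h \<star> a)"
    if "h \<in> hom A X" for h A
  proof -
    have "f i \<cdot> h = g i \<cdot> h \<longleftrightarrow> (\<forall>a\<in>el A. f i \<star> h \<star> a = g i \<star> h \<star> a)" if "i \<in> I" for i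
      by (rule equalizes_iff) (use assms(1,2)[OF that] \<open>h \<in> hom A X\<close> in auto)
    then show ?thesis by blast
  qed
  then show ?thesis unfolding cuts_out_def is_joint_equalizer_def by auto
qed

text \<open>The subset of X given by Q, with the initial structure for its inclusion; the source has
  this one member, hence the index set \<open>{()}\<close>. Separation admits any HOL predicate as
  Q.\<close>

lemma cuts_out_exists:
  assumes X: "X \<in> Ob V" shows "\<exists>E e. cuts_out Q X E e"
proof -
  obtain Y where Y: "elts Y = {x \<in> el X. Q x}" using separation[of "{x \<in> el X. Q x}" "Uo X"] by auto
  obtain E p where E: "E \<in> Ob V" "Uo E = Y" and p: "\<And>i. i \<in> {()} \<Longrightarrow> p i \<in> hom E X"
    and pa: "\<And>i a. i \<in> {()} \<Longrightarrow> a \<in> elts Y \<Longrightarrow> p i \<star> a = a"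
    and univ: "\<And>W G. W \<in> Ob V \<Longrightarrow> G \<in> el W \<rightarrow> elts Y \<Longrightarrow>
       (\<And>i. i \<in> {()} \<Longrightarrow> \<exists>m\<in>hom W X. \<forall>w\<in>el W. m \<star> w = G w) \<Longrightarrow>
       \<exists>m\<in>hom W E. \<forall>w\<in>el W. m \<star> w = G w"
    by (rule initial_lift[of "{()}" "\<lambda>_. X" "\<lambda>_ a. a" Y]) (use X Y in auto)
  have main: "\<exists>!k. k \<in> hom A E \<and> p () \<cdot> k = h"
    if h: "h \<in> hom A X" and Q: "\<forall>a\<in>el A. Q (h \<star> a)" for A h
  proof -
    have "\<exists>m\<in>hom A E. \<forall>w\<in>el A. m \<star> w = h \<star> w"
      by (rule univ) (use h Q Y in \<open>auto simp: in_hom intro: bexI[of _ h]\<close>)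
    then obtain k where k: "k \<in> hom A E" "\<And>a. a \<in> el A \<Longrightarrow> k \<star> a = h \<star> a" by blast
    show ?thesis
    proof
      have "p () \<cdot> k = h"
        by (rule arr_eqI) (use k h p Q Y pa in \<open>auto simp: in_hom\<close>)
      with k show "k \<in> hom A E \<and> p () \<cdot> k = h" by blast
    next
      fix k' assume k': "k' \<in> hom A E \<and> p () \<cdot> k' = h"
      have "k' \<star> a = k \<star> a" if a: "a \<in> el A" for a
      proof -
        have "k' \<star> a \<in> elts Y" using k' E a by (auto simp: in_hom)
        then have "k' \<star> a = (p () \<cdot> k') \<star> a"
          using k' p[of "()"] a pa app_cmp[of k' "p ()" a] by (auto simp: in_hom)
        then show ?thesis using k' k(2)[OF a] by simp
      qed
      then show "k' = k" by (intro arr_eqI) (use k k' in \<open>auto simp: in_hom\<close>)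
    qed
  qed
  moreover have "\<forall>x\<in>el E. Q (p () \<star> x)" using E Y pa by simp
  ultimately show ?thesis unfolding cuts_out_def using p by blast
qed

lemma joint_equalizer_cuts_out:
  assumes "X \<in> Ob V" "\<And>i. i \<in> I \<Longrightarrow> f i \<in> Arr V \<and> Dom V (f i) = X"
    and "\<And>i. i \<in> I \<Longrightarrow> g i \<in> Arr V \<and> Dom V (g i) = X \<and> Cod V (g i) = Cod V (f i)"
  shows "cuts_out (\<lambda>x. \<forall>i\<in>I. f i \<star> x = g i \<star> x) X
    (fst (joint_equalizer I X f g)) (snd (joint_equalizer I X f g))"
proof -
  have "\<exists>Ee. case Ee of (E, e) \<Rightarrow> is_joint_equalizer I X f g E e"
    using cuts_out_exists[OF assms(1), of "\<lambda>x. \<forall>i\<in>I. f i \<star> x = g i \<star> x"]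
      cuts_out_iff_joint_equalizer[of I f X g, OF assms(2,3)]
    by simp
  from someI_ex[OF this] show ?thesis
    using cuts_out_iff_joint_equalizer[of I f X g, OF assms(2,3)]
    by (simp add: joint_equalizer_def case_prod_unfold)
qed

text \<open>A morphism out of \<I> is an element, so n copies of \<I> form the object freely
  generated by n elements. It is the discrete structure on an n-element set.\<close>

lemma copower_unit:
  "\<exists>q. copower n \<I> \<in> Ob V \<and> (\<forall>k<n. q k \<in> el (copower n \<I>))
     \<and> (\<forall>A\<in>Ob V. \<forall>x. (\<forall>k<n. x k \<in> el A) \<longrightarrow>
          (\<exists>!m. m \<in> hom (copower n \<I>) A \<and> (\<forall>k<n. m \<star> q k = x k)))"
proof -
  obtain Y :: 'u and c where bij: "bij_betw c (elts Y) {..<n}"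
    using small_bij small_finite[of "{..<n}"] by (metis finite_lessThan)
  \<comment> \<open>All functions from Y to underlying sets of objects of V, in general a proper
    class. Lifting this source turns every one of these functions into a morphism, which makes the
    structure on Y discrete.\<close>
  let ?I = "{(B, g). B \<in> Ob V \<and> g \<in> elts Y \<rightarrow> el B}"
  obtain Q p where Q: "Q \<in> Ob V" "Uo Q = Y" and p: "\<And>i. i \<in> ?I \<Longrightarrow> p i \<in> hom Q (fst i)"
    and pg: "\<And>i a. i \<in> ?I \<Longrightarrow> a \<in> elts Y \<Longrightarrow> p i \<star> a = snd i a"
    by (rule initial_lift[of ?I fst snd Y]) auto
  define d where "d = inv_into (elts Y) c"
  have d: "d k \<in> elts Y" "c (d k) = k" if "k < n" for k
    using that bij_betw_imp_surj_on[OF bij] unfolding d_def by (auto simp: inv_into_into f_inv_into_f)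
  have cd: "d (c y) = y" "c y < n" if "y \<in> elts Y" for y
    using that bij bij_betwE[OF bij] unfolding d_def by (auto simp: bij_betw_inv_into_left)
  have "\<exists>q. \<forall>k\<in>{..<n}. q k \<in> hom \<I> Q \<and> q k \<star> pt = d k"
    using point_ex[OF Q(1)] d(1) Q(2) by (intro bchoice) (auto simp: Bex_def)
  then obtain q where q: "\<And>k. k < n \<Longrightarrow> q k \<in> hom \<I> Q \<and> q k \<star> pt = d k" by auto
  have cop: "is_copower n \<I> Q q"
    unfolding is_copower_def
  proof (intro conjI ballI allI impI)
    fix A f assume A: "A \<in> Ob V" and f: "\<forall>k<n. f k \<in> hom \<I> A"
    let ?g = "\<lambda>y. f (c y) \<star> pt"
    have i: "(A, ?g) \<in> ?I" using A f cd by (auto simp: in_hom)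
    show "\<exists>!h. h \<in> hom Q A \<and> (\<forall>k<n. h \<cdot> q k = f k)"
    proof
      have "p (A, ?g) \<cdot> q k = f k" if "k < n" for k
        by (rule arr_eqI) (use p[OF i] pg[OF i] q that f d in \<open>auto simp: in_hom\<close>)
      then show "p (A, ?g) \<in> hom Q A \<and> (\<forall>k<n. p (A, ?g) \<cdot> q k = f k)" using p[OF i] by simp
    next
      fix h assume h: "h \<in> hom Q A \<and> (\<forall>k<n. h \<cdot> q k = f k)"
      have "h \<star> y = p (A, ?g) \<star> y" if y: "y \<in> elts Y" for y
      proof -
        have "h \<star> y = (h \<cdot> q (c y)) \<star> pt"
          using h q[OF cd(2)[OF y]] cd(1)[OF y] app_cmp[of "q (c y)" h pt] by (auto simp: in_hom)
        then show ?thesis using h pg[OF i y] cd[OF y] by simp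
      qed
      then show "h = p (A, ?g)" by (intro arr_eqI) (use h p[OF i] Q in \<open>auto simp: in_hom\<close>)
    qed
  qed (use Q q in auto)
  \<comment> \<open>\<open>copower\<close> is a choice independent of this construction. Existence
    guarantees that the chosen object has coprojections \<open>q'\<close> of its own, and the
    generating elements are their values at \<open>pt\<close>.\<close>
  then have "\<exists>Q q. is_copower n \<I> Q q" by blast
  from someI_ex[OF this] obtain q' where q': "is_copower n \<I> (copower n \<I>) q'"
    unfolding copower_def by blast
  show ?thesis
  proof (intro exI[of _ "\<lambda>k. q' k \<star> pt"] conjI allI impI ballI)
    show ob: "copower n \<I> \<in> Ob V" using q' unfolding is_copower_def by blast
    have q'h: "q' k \<in> hom \<I> (copower n \<I>)" if "k < n" for k
      using q' that unfolding is_copower_def by blast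
    show "q' k \<star> pt \<in> el (copower n \<I>)" if "k < n" for k using q'h[OF that] by (simp add: in_hom)
    fix A x assume A: "A \<in> Ob V" and x: "\<forall>k<n. x k \<in> el A"
    have "\<exists>f. \<forall>k\<in>{..<n}. f k \<in> hom \<I> A \<and> f k \<star> pt = x k"
      using point_ex[OF A] x by (intro bchoice) (auto simp: Bex_def)
    then obtain f where f: "\<And>k. k < n \<Longrightarrow> f k \<in> hom \<I> A \<and> f k \<star> pt = x k" by auto
    have "(\<forall>k<n. m \<cdot> q' k = f k) \<longleftrightarrow> (\<forall>k<n. m \<star> q' k \<star> pt = x k)"
      if m: "m \<in> hom (copower n \<I>) A" for m
    proof -
      have "m \<cdot> q' k = f k \<longleftrightarrow> m \<star> q' k \<star> pt = x k" if k: "k < n" for k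
      proof
        assume "m \<cdot> q' k = f k"
        then show "m \<star> q' k \<star> pt = x k"
          using f[OF k] m q'h[OF k] app_cmp[of "q' k" m pt] by (simp add: in_hom)
      next
        assume "m \<star> q' k \<star> pt = x k"
        then show "m \<cdot> q' k = f k"
          by (intro arr_eqI) (use f[OF k] m q'h[OF k] in \<open>auto simp: in_hom\<close>)
      qed
      then show ?thesis by blast
    qed
    moreover have "\<exists>!m. m \<in> hom (copower n \<I>) A \<and> (\<forall>k<n. m \<cdot> q' k = f k)"
      using q' A f unfolding is_copower_def by blast
    ultimately show "\<exists>!m. m \<in> hom (copower n \<I>) A \<and> (\<forall>k<n. m \<star> q' k \<star> pt = x k)"
      by (metis (no_types, lifting))
  qed
qed

end

section \<open>Enriched categories over a base\<close>

context topological_closed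
begin

lemma cuts_outD [simp]:
  assumes "cuts_out Q X E e"
  shows "e \<in> Arr V" "Dom V e = E" "Cod V e = X"
  using assms unfolding cuts_out_def in_hom by auto

lemma cuts_out_pred: "cuts_out Q X E e \<Longrightarrow> x \<in> el E \<Longrightarrow> Q (e \<star> x)"
  unfolding cuts_out_def by blast

lemma cuts_out_ex1:
  assumes "cuts_out Q X E e" "h \<in> hom A X" "\<And>a. a \<in> el A \<Longrightarrow> Q (h \<star> a)"
  shows "\<exists>!k. k \<in> hom A E \<and> e \<cdot> k = h"
  using assms unfolding cuts_out_def by simp

lemma cuts_out_cong:
  assumes "cuts_out Q X E e" and "\<And>x. x \<in> el X \<Longrightarrow> Q x \<longleftrightarrow> Q' x"
  shows "cuts_out Q' X E e"
proof -
  have e: "e \<in> hom E X" using assms(1) unfolding cuts_out_def by blast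
  have "Q' (e \<star> x)" if "x \<in> el E" for x
    using cuts_out_pred[OF assms(1) that] assms(2)[of "e \<star> x"] e that by (simp add: in_hom)
  moreover have "\<exists>!k. k \<in> hom A E \<and> e \<cdot> k = h" if "h \<in> hom A X" "\<forall>a\<in>el A. Q' (h \<star> a)" for A h
    by (rule cuts_out_ex1[OF assms(1) that(1)]) (use that assms(2) in \<open>auto simp: in_hom\<close>)
  ultimately show ?thesis using e unfolding cuts_out_def by blast
qed

text \<open>The equation for \<open>k\<close> lets the rule be instantiated with the identities and
  compositions of \<open>sub_homs\<close> and the components of \<open>comparison\<close>, which are
  given by such descriptions.\<close>

lemma cuts_out_the:
  assumes "cuts_out Q X E e" "h \<in> hom A X" "\<And>a. a \<in> el A \<Longrightarrow> Q (h \<star> a)"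
    and k: "k = (THE k. k \<in> hom A E \<and> e \<cdot> k = h)"
  shows "k \<in> Arr V" "Dom V k = A" "Cod V k = E" "a \<in> el A \<Longrightarrow> e \<star> k \<star> a = h \<star> a" "e \<cdot> k = h"
proof -
  from theI'[OF cuts_out_ex1[OF assms(1-3)]] have "k \<in> hom A E" and ek: "e \<cdot> k = h"
    unfolding k by blast+
  then show *: "k \<in> Arr V" "Dom V k = A" "Cod V k = E" by (auto simp: in_hom)
  show "e \<cdot> k = h" by (rule ek)
  show "e \<star> k \<star> a = h \<star> a" if "a \<in> el A"
    using ek app_cmp[of k e a] * that cuts_outD[OF assms(1)] by simp
qed

text \<open>The embedding is injective on elements: uniqueness of factorizations, applied to the
  points that name the two elements.\<close>

lemma cuts_out_eqI:
  assumes "cuts_out Q X E e" "x \<in> el E" "y \<in> el E" "e \<star> x = e \<star> y"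
  shows "x = y"
proof -
  note [simp] = cuts_outD[OF assms(1)]
  have E: "E \<in> Ob V" using dom_ob[of e] by simp
  obtain m where m: "m \<in> hom \<I> E" "m \<star> pt = x" using point E assms(2) by metis
  obtain n where n: "n \<in> hom \<I> E" "n \<star> pt = y" using point E assms(3) by metis
  have mn: "e \<cdot> m = e \<cdot> n"
    by (rule arr_eqI) (use m n assms(4) in \<open>auto simp: in_hom\<close>)
  have "\<exists>!k. k \<in> hom \<I> E \<and> e \<cdot> k = e \<cdot> n"
    by (rule cuts_out_ex1[OF assms(1)])
      (use n cuts_out_pred[OF assms(1)] assms(3) in \<open>auto simp: in_hom\<close>)
  then have "m = n" by (rule ex1_eq) (use m n mn in auto)
  with m n show ?thesis by simp
qed

section \<open>Enriched categories and functors on elements\<close>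

lemma vcategory_typing [simp]:
  assumes "vcategory C"
  shows "A \<in> VOb C \<Longrightarrow> B \<in> VOb C \<Longrightarrow> VHom C A B \<in> Ob V"
    "A \<in> VOb C \<Longrightarrow> VId C A \<in> Arr V"
    "A \<in> VOb C \<Longrightarrow> Dom V (VId C A) = \<I>"
    "A \<in> VOb C \<Longrightarrow> Cod V (VId C A) = VHom C A A"
    "A \<in> VOb C \<Longrightarrow> B \<in> VOb C \<Longrightarrow> D \<in> VOb C \<Longrightarrow> VCmp C A B D \<in> Arr V"
    "A \<in> VOb C \<Longrightarrow> B \<in> VOb C \<Longrightarrow> D \<in> VOb C \<Longrightarrow>
       Dom V (VCmp C A B D) = VHom C B D \<otimes> VHom C A B"
    "A \<in> VOb C \<Longrightarrow> B \<in> VOb C \<Longrightarrow> D \<in> VOb C \<Longrightarrow> Cod V (VCmp C A B D) = VHom C A D"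
  using assms by (auto simp: vcategory_def in_hom)

lemma vcategory_laws:
  assumes C: "vcategory C" and AB: "A \<in> VOb C" "B \<in> VOb C" and f: "f \<in> el (VHom C A B)"
  shows "VCmp C A B B \<star> kpair (VId C B \<star> pt) f = f"
    "VCmp C A A B \<star> kpair f (VId C A \<star> pt) = f"
    "D \<in> VOb C \<Longrightarrow> E \<in> VOb C \<Longrightarrow> g \<in> el (VHom C B D) \<Longrightarrow> h \<in> el (VHom C D E) \<Longrightarrow>
       VCmp C A B E \<star> kpair (VCmp C B D E \<star> kpair h g) f
       = VCmp C A D E \<star> kpair h (VCmp C A B D \<star> kpair g f)"
proof -
  have "VCmp C A B B \<cdot> (VId C B \<otimes>\<^sub>1 idn (VHom C A B)) = lunit (VHom C A B)"
    and "VCmp C A A B \<cdot> (idn (VHom C A B) \<otimes>\<^sub>1 VId C A) = runit (VHom C A B)"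
    using C AB unfolding vcategory_def by blast+
  then have "(VCmp C A B B \<cdot> (VId C B \<otimes>\<^sub>1 idn (VHom C A B))) \<star> kpair pt f = f"
    "(VCmp C A A B \<cdot> (idn (VHom C A B) \<otimes>\<^sub>1 VId C A)) \<star> kpair f pt = f"
    using C AB f by simp_all
  then show "VCmp C A B B \<star> kpair (VId C B \<star> pt) f = f"
    "VCmp C A A B \<star> kpair f (VId C A \<star> pt) = f"
    using C AB f by simp_all
  assume DE: "D \<in> VOb C" "E \<in> VOb C" and gh: "g \<in> el (VHom C B D)" "h \<in> el (VHom C D E)"
  have "VCmp C A B E \<cdot> (VCmp C B D E \<otimes>\<^sub>1 idn (VHom C A B))
      = VCmp C A D E \<cdot> (idn (VHom C D E) \<otimes>\<^sub>1 VCmp C A B D)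
          \<cdot> assoc (VHom C D E) (VHom C B D) (VHom C A B)"
    using C AB DE unfolding vcategory_def by blast
  then have "(VCmp C A B E \<cdot> (VCmp C B D E \<otimes>\<^sub>1 idn (VHom C A B))) \<star> kpair (kpair h g) f
      = (VCmp C A D E \<cdot> (idn (VHom C D E) \<otimes>\<^sub>1 VCmp C A B D)
          \<cdot> assoc (VHom C D E) (VHom C B D) (VHom C A B)) \<star> kpair (kpair h g) f" by simp
  then show "VCmp C A B E \<star> kpair (VCmp C B D E \<star> kpair h g) f
      = VCmp C A D E \<star> kpair h (VCmp C A B D \<star> kpair g f)"
    using C AB DE f gh by simp
qed

text \<open>The axioms are equations between morphisms out of tensor products, so with well-typed
  structure morphisms it is enough that the underlying sets of the hom-objects obey the laws of an
  ordinary category.\<close>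

lemma vcategoryI:
  assumes [simp]: "\<And>A B. A \<in> VOb C \<Longrightarrow> B \<in> VOb C \<Longrightarrow> VHom C A B \<in> Ob V"
    "\<And>A. A \<in> VOb C \<Longrightarrow> VId C A \<in> Arr V"
    "\<And>A. A \<in> VOb C \<Longrightarrow> Dom V (VId C A) = \<I>"
    "\<And>A. A \<in> VOb C \<Longrightarrow> Cod V (VId C A) = VHom C A A"
    "\<And>A B D. A \<in> VOb C \<Longrightarrow> B \<in> VOb C \<Longrightarrow> D \<in> VOb C \<Longrightarrow> VCmp C A B D \<in> Arr V"
    "\<And>A B D. A \<in> VOb C \<Longrightarrow> B \<in> VOb C \<Longrightarrow> D \<in> VOb C \<Longrightarrow>
       Dom V (VCmp C A B D) = VHom C B D \<otimes> VHom C A B"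
    "\<And>A B D. A \<in> VOb C \<Longrightarrow> B \<in> VOb C \<Longrightarrow> D \<in> VOb C \<Longrightarrow> Cod V (VCmp C A B D) = VHom C A D"
  assumes [simp]: "\<And>A B f. A \<in> VOb C \<Longrightarrow> B \<in> VOb C \<Longrightarrow> f \<in> el (VHom C A B) \<Longrightarrow>
      VCmp C A B B \<star> kpair (VId C B \<star> pt) f = f"
    "\<And>A B f. A \<in> VOb C \<Longrightarrow> B \<in> VOb C \<Longrightarrow> f \<in> el (VHom C A B) \<Longrightarrow>
      VCmp C A A B \<star> kpair f (VId C A \<star> pt) = f"
    "\<And>A B D E f g h. A \<in> VOb C \<Longrightarrow> B \<in> VOb C \<Longrightarrow> D \<in> VOb C \<Longrightarrow> E \<in> VOb C \<Longrightarrow>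
      f \<in> el (VHom C A B) \<Longrightarrow> g \<in> el (VHom C B D) \<Longrightarrow> h \<in> el (VHom C D E) \<Longrightarrow>
       VCmp C A B E \<star> kpair (VCmp C B D E \<star> kpair h g) f
       = VCmp C A D E \<star> kpair h (VCmp C A B D \<star> kpair g f)"
  shows "vcategory C"
  unfolding vcategory_def
proof (intro conjI ballI)
  fix A B D E assume [simp]: "A \<in> VOb C" "B \<in> VOb C" "D \<in> VOb C" "E \<in> VOb C"
  show "VCmp C A B E \<cdot> (VCmp C B D E \<otimes>\<^sub>1 idn (VHom C A B))
      = VCmp C A D E \<cdot> (idn (VHom C D E) \<otimes>\<^sub>1 VCmp C A B D)
          \<cdot> assoc (VHom C D E) (VHom C B D) (VHom C A B)"
    by (rule arr_eqI) (auto elim!: el_tensorE)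
next
  fix A B assume [simp]: "A \<in> VOb C" "B \<in> VOb C"
  show "VCmp C A B B \<cdot> (VId C B \<otimes>\<^sub>1 idn (VHom C A B)) = lunit (VHom C A B)"
    "VCmp C A A B \<cdot> (idn (VHom C A B) \<otimes>\<^sub>1 VId C A) = runit (VHom C A B)"
    by (rule arr_eqI; auto elim!: el_tensorE)+
qed (simp_all add: in_hom)

lemma vfunctorI:
  assumes [simp]: "vcategory C" "vcategory D"
    "\<And>A. A \<in> VOb C \<Longrightarrow> fst F A \<in> VOb D"
    "\<And>A B. A \<in> VOb C \<Longrightarrow> B \<in> VOb C \<Longrightarrow> snd F A B \<in> Arr V"
    "\<And>A B. A \<in> VOb C \<Longrightarrow> B \<in> VOb C \<Longrightarrow> Dom V (snd F A B) = VHom C A B"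
    "\<And>A B. A \<in> VOb C \<Longrightarrow> B \<in> VOb C \<Longrightarrow> Cod V (snd F A B) = VHom D (fst F A) (fst F B)"
    "\<And>A. A \<in> VOb C \<Longrightarrow> snd F A A \<star> VId C A \<star> pt = VId D (fst F A) \<star> pt"
    "\<And>A B E f g. A \<in> VOb C \<Longrightarrow> B \<in> VOb C \<Longrightarrow> E \<in> VOb C \<Longrightarrow>
      f \<in> el (VHom C A B) \<Longrightarrow> g \<in> el (VHom C B E) \<Longrightarrow>
      snd F A E \<star> VCmp C A B E \<star> kpair g f
      = VCmp D (fst F A) (fst F B) (fst F E) \<star> kpair (snd F B E \<star> g) (snd F A B \<star> f)"
  shows "vfunctor C D F"
  unfolding vfunctor_def
proof (intro conjI ballI)
  fix A assume [simp]: "A \<in> VOb C"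
  show "snd F A A \<cdot> VId C A = VId D (fst F A)" by (rule arr_eqI) auto
next
  fix A B E assume [simp]: "A \<in> VOb C" "B \<in> VOb C" "E \<in> VOb C"
  show "snd F A E \<cdot> VCmp C A B E
      = VCmp D (fst F A) (fst F B) (fst F E) \<cdot> (snd F B E \<otimes>\<^sub>1 snd F A B)"
    by (rule arr_eqI) (auto elim!: el_tensorE)
qed (simp_all add: in_hom)

(* Q X Y is the property of elements of B(u X, u Y) that defines the subobject Ee X Y. *)
definition cut_subcategory :: "('b, 'o, 'm) vcat \<Rightarrow> 'c set \<Rightarrow> ('c \<Rightarrow> 'b) \<Rightarrow> ('c \<Rightarrow> 'c \<Rightarrow> 'o \<times> 'm) \<Rightarrow>
    ('c \<Rightarrow> 'c \<Rightarrow> 'u \<Rightarrow> bool) \<Rightarrow> bool" where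
  "cut_subcategory B Z u Ee Q \<longleftrightarrow> vcategory B \<and> (\<forall>X\<in>Z. u X \<in> VOb B)
     \<and> (\<forall>X\<in>Z. \<forall>Y\<in>Z. cuts_out (Q X Y) (VHom B (u X) (u Y)) (fst (Ee X Y)) (snd (Ee X Y)))
     \<and> (\<forall>X\<in>Z. Q X X (VId B (u X) \<star> pt))
     \<and> (\<forall>X\<in>Z. \<forall>Y\<in>Z. \<forall>W\<in>Z. \<forall>f\<in>el (VHom B (u X) (u Y)). \<forall>g\<in>el (VHom B (u Y) (u W)).
          Q X Y f \<longrightarrow> Q Y W g \<longrightarrow> Q X W (VCmp B (u X) (u Y) (u W) \<star> kpair g f))"

lemma cut_subcategory_subset:
  "cut_subcategory B Z u Ee Q \<Longrightarrow> Z' \<subseteq> Z \<Longrightarrow> cut_subcategory B Z' u Ee Q"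
  unfolding cut_subcategory_def subset_iff by simp

text \<open>The object set enters \<open>sub_homs\<close> only as such, not through hom-objects or
  composition. So categories of models of equations are again of the form \<open>sub_homs\<close>
  and need no separate treatment.\<close>

lemma full_sub_sub_homs: "full_sub (sub_homs B Z u Ee) Z' = sub_homs B Z' u Ee"
  by (simp add: full_sub_def sub_homs_def Let_def)

context
  fixes B :: "('b, 'o, 'm) vcat" and Z :: "'c set" and u Ee Q
  assumes cut: "cut_subcategory B Z u Ee Q"
begin

lemma base [simp]: "vcategory B" "X \<in> Z \<Longrightarrow> u X \<in> VOb B"
  using cut unfolding cut_subcategory_def by auto

lemma cut_hom:
  "X \<in> Z \<Longrightarrow> Y \<in> Z \<Longrightarrow> cuts_out (Q X Y) (VHom B (u X) (u Y)) (fst (Ee X Y)) (snd (Ee X Y))"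
  using cut unfolding cut_subcategory_def by auto

lemma embedding [simp]:
  assumes "X \<in> Z" "Y \<in> Z"
  shows "snd (Ee X Y) \<in> Arr V" "Dom V (snd (Ee X Y)) = fst (Ee X Y)"
    "Cod V (snd (Ee X Y)) = VHom B (u X) (u Y)" "fst (Ee X Y) \<in> Ob V"
  using cuts_outD[OF cut_hom[OF assms]] dom_ob[of "snd (Ee X Y)"] by auto

lemma sub_homs_simps [simp]:
  "VOb (fst (sub_homs B Z u Ee)) = Z"
  "VHom (fst (sub_homs B Z u Ee)) X Y = fst (Ee X Y)"
  "snd (sub_homs B Z u Ee) = (u, \<lambda>X Y. snd (Ee X Y))"
  by (simp_all add: sub_homs_def Let_def)

lemma sub_homs_VId [simp]:
  assumes "X \<in> Z"
  shows "VId (fst (sub_homs B Z u Ee)) X \<in> Arr V" "Dom V (VId (fst (sub_homs B Z u Ee)) X) = \<I>"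
    "Cod V (VId (fst (sub_homs B Z u Ee)) X) = fst (Ee X X)"
    "snd (Ee X X) \<star> VId (fst (sub_homs B Z u Ee)) X \<star> pt = VId B (u X) \<star> pt"
proof -
  have h: "VId B (u X) \<in> hom \<I> (VHom B (u X) (u X))" using assms by (simp add: in_hom)
  have q: "\<And>a. a \<in> el \<I> \<Longrightarrow> Q X X (VId B (u X) \<star> a)"
    using cut assms unfolding cut_subcategory_def by simp
  have k: "VId (fst (sub_homs B Z u Ee)) X
      = (THE i. i \<in> hom \<I> (fst (Ee X X)) \<and> snd (Ee X X) \<cdot> i = VId B (u X))"
    by (simp add: sub_homs_def Let_def)
  note * = cuts_out_the[OF cut_hom[OF assms assms] h q k]
  show "VId (fst (sub_homs B Z u Ee)) X \<in> Arr V" "Dom V (VId (fst (sub_homs B Z u Ee)) X) = \<I>"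
    "Cod V (VId (fst (sub_homs B Z u Ee)) X) = fst (Ee X X)"
    "snd (Ee X X) \<star> VId (fst (sub_homs B Z u Ee)) X \<star> pt = VId B (u X) \<star> pt"
    by (rule *; simp)+
qed

lemma sub_homs_VCmp [simp]:
  assumes "X \<in> Z" "Y \<in> Z" "W \<in> Z"
  shows "VCmp (fst (sub_homs B Z u Ee)) X Y W \<in> Arr V"
    "Dom V (VCmp (fst (sub_homs B Z u Ee)) X Y W) = fst (Ee Y W) \<otimes> fst (Ee X Y)"
    "Cod V (VCmp (fst (sub_homs B Z u Ee)) X Y W) = fst (Ee X W)"
    "g \<in> el (fst (Ee Y W)) \<Longrightarrow> f \<in> el (fst (Ee X Y)) \<Longrightarrow>
      snd (Ee X W) \<star> VCmp (fst (sub_homs B Z u Ee)) X Y W \<star> kpair g f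
      = VCmp B (u X) (u Y) (u W) \<star> kpair (snd (Ee Y W) \<star> g) (snd (Ee X Y) \<star> f)"
proof -
  let ?h = "VCmp B (u X) (u Y) (u W) \<cdot> (snd (Ee Y W) \<otimes>\<^sub>1 snd (Ee X Y))"
  have h: "?h \<in> hom (fst (Ee Y W) \<otimes> fst (Ee X Y)) (VHom B (u X) (u W))"
    using assms by (simp add: in_hom)
  have closed: "\<forall>f\<in>el (VHom B (u X) (u Y)). \<forall>g\<in>el (VHom B (u Y) (u W)).
          Q X Y f \<longrightarrow> Q Y W g \<longrightarrow> Q X W (VCmp B (u X) (u Y) (u W) \<star> kpair g f)"
    using cut assms unfolding cut_subcategory_def by simp
  have q: "Q X W (?h \<star> a)" if "a \<in> el (fst (Ee Y W) \<otimes> fst (Ee X Y))" for a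
    using that
  proof (rule el_tensorE)
    fix g f assume a: "a = kpair g f" "g \<in> el (fst (Ee Y W))" "f \<in> el (fst (Ee X Y))"
    have "Q Y W (snd (Ee Y W) \<star> g)" "Q X Y (snd (Ee X Y) \<star> f)"
      using a assms cuts_out_pred[OF cut_hom] by auto
    then show "Q X W (?h \<star> a)" using a assms closed by simp
  qed (use assms in simp_all)
  have k: "VCmp (fst (sub_homs B Z u Ee)) X Y W
      = (THE k. k \<in> hom (fst (Ee Y W) \<otimes> fst (Ee X Y)) (fst (Ee X W)) \<and> snd (Ee X W) \<cdot> k = ?h)"
    by (simp add: sub_homs_def Let_def)
  note * = cuts_out_the[OF cut_hom[OF assms(1,3)] h q k]
  show "VCmp (fst (sub_homs B Z u Ee)) X Y W \<in> Arr V"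
    "Dom V (VCmp (fst (sub_homs B Z u Ee)) X Y W) = fst (Ee Y W) \<otimes> fst (Ee X Y)"
    "Cod V (VCmp (fst (sub_homs B Z u Ee)) X Y W) = fst (Ee X W)"
    by (rule *; assumption)+
  assume "g \<in> el (fst (Ee Y W))" "f \<in> el (fst (Ee X Y))"
  then show "snd (Ee X W) \<star> VCmp (fst (sub_homs B Z u Ee)) X Y W \<star> kpair g f
      = VCmp B (u X) (u Y) (u W) \<star> kpair (snd (Ee Y W) \<star> g) (snd (Ee X Y) \<star> f)"
    using *(4)[of "kpair g f"] assms by simp
qed

lemma embedding_eqI:
  assumes "snd (Ee X Y) \<star> x = snd (Ee X Y) \<star> y" "X \<in> Z" "Y \<in> Z"
    "x \<in> el (fst (Ee X Y))" "y \<in> el (fst (Ee X Y))"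
  shows "x = y"
  using cuts_out_eqI[OF cut_hom] assms by metis

text \<open>The embeddings are injective on elements and carry identities and composites to those of
  B, so the laws of B are inherited.\<close>

lemma vcategory_sub_homs: "vcategory (fst (sub_homs B Z u Ee))"
proof (rule vcategoryI)
  fix X Y f assume "X \<in> VOb (fst (sub_homs B Z u Ee))" "Y \<in> VOb (fst (sub_homs B Z u Ee))"
    "f \<in> el (VHom (fst (sub_homs B Z u Ee)) X Y)"
  then have *: "X \<in> Z" "Y \<in> Z" "f \<in> el (fst (Ee X Y))" by simp_all
  show "VCmp (fst (sub_homs B Z u Ee)) X Y Y \<star> kpair (VId (fst (sub_homs B Z u Ee)) Y \<star> pt) f = f"
    by (rule embedding_eqI[of X Y]) (use * in \<open>simp_all add: vcategory_laws\<close>)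
  show "VCmp (fst (sub_homs B Z u Ee)) X X Y \<star> kpair f (VId (fst (sub_homs B Z u Ee)) X \<star> pt) = f"
    by (rule embedding_eqI[of X Y]) (use * in \<open>simp_all add: vcategory_laws\<close>)
next
  let ?C = "fst (sub_homs B Z u Ee)"
  fix X Y W U f g h assume "X \<in> VOb ?C" "Y \<in> VOb ?C" "W \<in> VOb ?C" "U \<in> VOb ?C"
    "f \<in> el (VHom ?C X Y)" "g \<in> el (VHom ?C Y W)" "h \<in> el (VHom ?C W U)"
  then have *: "X \<in> Z" "Y \<in> Z" "W \<in> Z" "U \<in> Z" "f \<in> el (fst (Ee X Y))" "g \<in> el (fst (Ee Y W))"
    "h \<in> el (fst (Ee W U))" by simp_all
  show "VCmp ?C X Y U \<star> kpair (VCmp ?C Y W U \<star> kpair h g) f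
      = VCmp ?C X W U \<star> kpair h (VCmp ?C X Y W \<star> kpair g f)"
    by (rule embedding_eqI[of X U]) (use * in \<open>simp_all add: vcategory_laws\<close>)
qed simp_all

lemma slice_ob_sub_homs: "slice_ob B (sub_homs B Z u Ee)"
  unfolding slice_ob_def by (rule vfunctorI) (simp_all add: vcategory_sub_homs)

end

text \<open>The two hom-objects are separately chosen subobjects, so even when they are cut out by
  the same predicate they are only canonically isomorphic. The component is the unique factorization
  of one embedding through the other.\<close>

definition comparison :: "('c \<Rightarrow> 'c \<Rightarrow> 'o \<times> 'm) \<Rightarrow> ('d \<Rightarrow> 'd \<Rightarrow> 'o \<times> 'm) \<Rightarrow> ('c \<Rightarrow> 'd) \<Rightarrow>
    ('c, 'd, 'm) vfun" where
  "comparison Ee Ee' \<phi> = (\<phi>, \<lambda>X Y. THE k. k \<in> hom (fst (Ee X Y)) (fst (Ee' (\<phi> X) (\<phi> Y)))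
     \<and> snd (Ee' (\<phi> X) (\<phi> Y)) \<cdot> k = snd (Ee X Y))"

lemma comparison_typing:
  assumes cut: "cut_subcategory B Z u Ee Q" "cut_subcategory B Z' u' Ee' Q'"
    and \<phi>: "\<And>X. X \<in> Z \<Longrightarrow> \<phi> X \<in> Z'" "\<And>X. X \<in> Z \<Longrightarrow> u' (\<phi> X) = u X"
    and Q: "\<And>X Y x. X \<in> Z \<Longrightarrow> Y \<in> Z \<Longrightarrow> x \<in> el (VHom B (u X) (u Y)) \<Longrightarrow> Q X Y x \<Longrightarrow>
        Q' (\<phi> X) (\<phi> Y) x"
    and XY: "X \<in> Z" "Y \<in> Z"
  shows "snd (comparison Ee Ee' \<phi>) X Y \<in> Arr V"
    "Dom V (snd (comparison Ee Ee' \<phi>) X Y) = fst (Ee X Y)"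
    "Cod V (snd (comparison Ee Ee' \<phi>) X Y) = fst (Ee' (\<phi> X) (\<phi> Y))"
    "a \<in> el (fst (Ee X Y)) \<Longrightarrow>
      snd (Ee' (\<phi> X) (\<phi> Y)) \<star> snd (comparison Ee Ee' \<phi>) X Y \<star> a = snd (Ee X Y) \<star> a"
    "snd (Ee' (\<phi> X) (\<phi> Y)) \<cdot> snd (comparison Ee Ee' \<phi>) X Y = snd (Ee X Y)"
proof -
  have h: "snd (Ee X Y) \<in> hom (fst (Ee X Y)) (VHom B (u' (\<phi> X)) (u' (\<phi> Y)))"
    using embedding[OF cut(1) XY] XY \<phi> by (simp add: in_hom)
  have q: "Q' (\<phi> X) (\<phi> Y) (snd (Ee X Y) \<star> a)" if "a \<in> el (fst (Ee X Y))" for a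
    using that embedding[OF cut(1) XY] XY Q cuts_out_pred[OF cut_hom[OF cut(1) XY]] by simp
  have k: "snd (comparison Ee Ee' \<phi>) X Y
      = (THE k. k \<in> hom (fst (Ee X Y)) (fst (Ee' (\<phi> X) (\<phi> Y)))
           \<and> snd (Ee' (\<phi> X) (\<phi> Y)) \<cdot> k = snd (Ee X Y))"
    by (simp add: comparison_def)
  note * = cuts_out_the[OF cut_hom[OF cut(2) \<phi>(1)[OF XY(1)] \<phi>(1)[OF XY(2)]] h q k]
  show "snd (comparison Ee Ee' \<phi>) X Y \<in> Arr V"
    "Dom V (snd (comparison Ee Ee' \<phi>) X Y) = fst (Ee X Y)"
    "Cod V (snd (comparison Ee Ee' \<phi>) X Y) = fst (Ee' (\<phi> X) (\<phi> Y))"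
    "a \<in> el (fst (Ee X Y)) \<Longrightarrow>
      snd (Ee' (\<phi> X) (\<phi> Y)) \<star> snd (comparison Ee Ee' \<phi>) X Y \<star> a = snd (Ee X Y) \<star> a"
    "snd (Ee' (\<phi> X) (\<phi> Y)) \<cdot> snd (comparison Ee Ee' \<phi>) X Y = snd (Ee X Y)"
    by (rule *; assumption)+
qed

lemma fst_comparison [simp]: "fst (comparison Ee Ee' \<phi>) = \<phi>"
  by (simp add: comparison_def)

text \<open>Commutation with the functors to B is the defining equation of the components.
  Preservation of identities and composites is tested after the embedding on the target side, where
  both sides become the corresponding operations of B.\<close>

lemma slice_hom_comparison:
  assumes cut: "cut_subcategory B Z u Ee Q" "cut_subcategory B Z' u' Ee' Q'"
    and \<phi>: "\<And>X. X \<in> Z \<Longrightarrow> \<phi> X \<in> Z'" "\<And>X. X \<in> Z \<Longrightarrow> u' (\<phi> X) = u X"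
    and Q: "\<And>X Y x. X \<in> Z \<Longrightarrow> Y \<in> Z \<Longrightarrow> x \<in> el (VHom B (u X) (u Y)) \<Longrightarrow> Q X Y x \<Longrightarrow>
        Q' (\<phi> X) (\<phi> Y) x"
  shows "slice_hom (sub_homs B Z u Ee) (sub_homs B Z' u' Ee') (comparison Ee Ee' \<phi>)"
proof -
  note cut_simps [simp] = base[OF cut(1)] base[OF cut(2)] embedding[OF cut(1)] embedding[OF cut(2)]
    sub_homs_VId[OF cut(1)] sub_homs_VId[OF cut(2)] sub_homs_VCmp[OF cut(1)] sub_homs_VCmp[OF cut(2)]
    sub_homs_simps[OF cut(1)] sub_homs_simps[OF cut(2)]
    vcategory_sub_homs[OF cut(1)] vcategory_sub_homs[OF cut(2)]
  note [simp] = comparison_typing[OF cut \<phi> Q] \<phi>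
  show ?thesis
    unfolding slice_hom_def
  proof
    show "vfunctor (fst (sub_homs B Z u Ee)) (fst (sub_homs B Z' u' Ee')) (comparison Ee Ee' \<phi>)"
    proof (rule vfunctorI)
      let ?C = "fst (sub_homs B Z u Ee)" and ?D = "fst (sub_homs B Z' u' Ee')"
        and ?F = "comparison Ee Ee' \<phi>"
      fix X assume "X \<in> VOb ?C"
      then have X: "X \<in> Z" by simp
      show "snd ?F X X \<star> VId ?C X \<star> pt = VId ?D (fst ?F X) \<star> pt"
        by (rule embedding_eqI[OF cut(2), of "\<phi> X" "\<phi> X"]) (use X in simp_all)
    next
      let ?C = "fst (sub_homs B Z u Ee)" and ?D = "fst (sub_homs B Z' u' Ee')"
        and ?F = "comparison Ee Ee' \<phi>"
      fix X Y W f g assume "X \<in> VOb ?C" "Y \<in> VOb ?C" "W \<in> VOb ?C"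
        "f \<in> el (VHom ?C X Y)" "g \<in> el (VHom ?C Y W)"
      then have *: "X \<in> Z" "Y \<in> Z" "W \<in> Z" "f \<in> el (fst (Ee X Y))" "g \<in> el (fst (Ee Y W))"
        by simp_all
      show "snd ?F X W \<star> VCmp ?C X Y W \<star> kpair g f
          = VCmp ?D (fst ?F X) (fst ?F Y) (fst ?F W) \<star> kpair (snd ?F Y W \<star> g) (snd ?F X Y \<star> f)"
        by (rule embedding_eqI[OF cut(2), of "\<phi> X" "\<phi> W"]) (use * in simp_all)
    qed simp_all
    show "vfun_eq (fst (sub_homs B Z u Ee))
        (vfun_cmp (snd (sub_homs B Z' u' Ee')) (comparison Ee Ee' \<phi>)) (snd (sub_homs B Z u Ee))"
      by (simp add: vfun_eq_def vfun_cmp_def)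
  qed
qed

text \<open>Followed by the embedding, the round trip and the identity agree on elements, and the
  embedding is injective. Exchanging the two sides yields the other round trip.\<close>

lemma comparison_inverse:
  assumes cut: "cut_subcategory B Z u Ee Q" "cut_subcategory B Z' u' Ee' Q'"
    and \<phi>: "\<And>X. X \<in> Z \<Longrightarrow> \<phi> X \<in> Z'" "\<And>X. X \<in> Z \<Longrightarrow> u' (\<phi> X) = u X"
    and Q: "\<And>X Y x. X \<in> Z \<Longrightarrow> Y \<in> Z \<Longrightarrow> x \<in> el (VHom B (u X) (u Y)) \<Longrightarrow>
        Q X Y x \<longleftrightarrow> Q' (\<phi> X) (\<phi> Y) x"
    and \<psi>: "\<And>X. X \<in> Z' \<Longrightarrow> \<psi> X \<in> Z" "\<And>X. X \<in> Z' \<Longrightarrow> u (\<psi> X) = u' X"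
    and Q': "\<And>X Y x. X \<in> Z' \<Longrightarrow> Y \<in> Z' \<Longrightarrow> x \<in> el (VHom B (u' X) (u' Y)) \<Longrightarrow>
        Q' X Y x \<Longrightarrow> Q (\<psi> X) (\<psi> Y) x"
    and inv: "\<And>X. X \<in> Z \<Longrightarrow> \<psi> (\<phi> X) = X"
  shows "vfun_eq (fst (sub_homs B Z u Ee))
    (vfun_cmp (comparison Ee' Ee \<psi>) (comparison Ee Ee' \<phi>)) (vfun_id (fst (sub_homs B Z u Ee)))"
proof -
  note [simp] = embedding[OF cut(1)] sub_homs_simps[OF cut(1)] \<phi> inv
    comparison_typing(1-4)[OF cut \<phi> Q[THEN iffD1]]
  have "snd (comparison Ee' Ee \<psi>) (\<phi> X) (\<phi> Y) \<cdot> snd (comparison Ee Ee' \<phi>) X Y = idn (fst (Ee X Y))"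
    (is "?k = _") if XY: "X \<in> Z" "Y \<in> Z" for X Y
  proof (rule arr_eqI)
    have c [simp]: "snd (comparison Ee' Ee \<psi>) (\<phi> X) (\<phi> Y) \<in> Arr V"
      "Dom V (snd (comparison Ee' Ee \<psi>) (\<phi> X) (\<phi> Y)) = fst (Ee' (\<phi> X) (\<phi> Y))"
      "Cod V (snd (comparison Ee' Ee \<psi>) (\<phi> X) (\<phi> Y)) = fst (Ee X Y)"
      "\<And>a. a \<in> el (fst (Ee' (\<phi> X) (\<phi> Y))) \<Longrightarrow>
        snd (Ee X Y) \<star> snd (comparison Ee' Ee \<psi>) (\<phi> X) (\<phi> Y) \<star> a = snd (Ee' (\<phi> X) (\<phi> Y)) \<star> a"
      using comparison_typing(1-4)[OF cut(2,1), where \<phi> = \<psi> and X = "\<phi> X" and Y = "\<phi> Y"] XY \<psi> Q'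
      by simp_all
    show "?k \<in> Arr V" "Dom V ?k = Dom V (idn (fst (Ee X Y)))" "Cod V ?k = Cod V (idn (fst (Ee X Y)))"
      using XY by simp_all
    fix a assume "a \<in> el (Dom V ?k)"
    then have a: "a \<in> el (fst (Ee X Y))" using XY by simp
    show "?k \<star> a = idn (fst (Ee X Y)) \<star> a"
      by (rule embedding_eqI[OF cut(1), of X Y]) (use XY a in simp_all)
  qed (use XY in simp_all)
  then show ?thesis by (simp add: vfun_eq_def vfun_cmp_def vfun_id_def)
qed

text \<open>Over B the action on hom-objects is forced, so the data reduce to the bijection of
  objects; the equivalence of the predicates makes comparisons available in both directions.\<close>

lemma slice_iso_comparison:
  assumes cut: "cut_subcategory B Z u Ee Q" "cut_subcategory B Z' u' Ee' Q'"
    and \<phi>: "bij_betw \<phi> Z Z'" "\<And>X. X \<in> Z \<Longrightarrow> u' (\<phi> X) = u X"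
    and Q: "\<And>X Y x. X \<in> Z \<Longrightarrow> Y \<in> Z \<Longrightarrow> x \<in> el (VHom B (u X) (u Y)) \<Longrightarrow>
        Q X Y x \<longleftrightarrow> Q' (\<phi> X) (\<phi> Y) x"
  shows "slice_iso B (sub_homs B Z u Ee) (sub_homs B Z' u' Ee') (comparison Ee Ee' \<phi>)"
proof -
  define \<psi> where "\<psi> = inv_into Z \<phi>"
  have \<phi>Z: "\<And>X. X \<in> Z \<Longrightarrow> \<phi> X \<in> Z'" using \<phi>(1) by (rule bij_betw_apply)
  have \<psi>Z: "\<And>X. X \<in> Z' \<Longrightarrow> \<psi> X \<in> Z"
    using bij_betw_apply[OF bij_betw_inv_into[OF \<phi>(1)]] unfolding \<psi>_def by blast
  have inv: "\<And>X. X \<in> Z \<Longrightarrow> \<psi> (\<phi> X) = X" "\<And>X. X \<in> Z' \<Longrightarrow> \<phi> (\<psi> X) = X"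
    unfolding \<psi>_def using \<phi>(1) by (auto simp: bij_betw_inv_into_left bij_betw_inv_into_right)
  have \<psi>u: "\<And>X. X \<in> Z' \<Longrightarrow> u (\<psi> X) = u' X" using \<phi>(2)[OF \<psi>Z] inv by simp
  have Q': "\<And>X Y x. X \<in> Z' \<Longrightarrow> Y \<in> Z' \<Longrightarrow> x \<in> el (VHom B (u' X) (u' Y)) \<Longrightarrow>
        Q' X Y x \<longleftrightarrow> Q (\<psi> X) (\<psi> Y) x"
    using Q[OF \<psi>Z \<psi>Z] by (simp add: inv \<psi>u)
  have "slice_hom (sub_homs B Z u Ee) (sub_homs B Z' u' Ee') (comparison Ee Ee' \<phi>)"
    by (rule slice_hom_comparison[OF cut]) (simp_all add: \<phi>Z \<phi>(2) Q)
  moreover have "slice_hom (sub_homs B Z' u' Ee') (sub_homs B Z u Ee) (comparison Ee' Ee \<psi>)"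
    by (rule slice_hom_comparison[OF cut(2,1)]) (simp_all add: \<psi>Z \<psi>u Q')
  moreover have "vfun_eq (fst (sub_homs B Z u Ee))
    (vfun_cmp (comparison Ee' Ee \<psi>) (comparison Ee Ee' \<phi>)) (vfun_id (fst (sub_homs B Z u Ee)))"
    by (rule comparison_inverse[OF cut];
        (rule \<phi>Z \<phi>(2) Q \<psi>Z \<psi>u Q'[THEN iffD1] inv; assumption))
  moreover have "vfun_eq (fst (sub_homs B Z' u' Ee'))
    (vfun_cmp (comparison Ee Ee' \<phi>) (comparison Ee' Ee \<psi>)) (vfun_id (fst (sub_homs B Z' u' Ee')))"
    by (rule comparison_inverse[OF cut(2,1)];
        (rule \<phi>Z \<phi>(2) Q[THEN iffD1] \<psi>Z \<psi>u Q' inv; assumption))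
  ultimately show ?thesis
    unfolding slice_iso_def using slice_ob_sub_homs[OF cut(1)] slice_ob_sub_homs[OF cut(2)] by blast
qed

end

section \<open>Powers\<close>

locale sorted_topological = topological_closed V Uo Ua + sorted_power V \<S>
  for V :: "('o, 'm) closed" (structure)
    and Uo :: "'o \<Rightarrow> 'u::set_universe" and Ua :: "'m \<Rightarrow> 'u set_arrow" and \<S> :: 'u
begin

lemma pow_ob_apply [simp]: "X \<in> pow_ob \<Longrightarrow> s \<in> elts \<S> \<Longrightarrow> X s \<in> Ob V"
  unfolding pow_ob_def by auto

lemma pow_homD:
  assumes "f \<in> pow_hom X Y" "s \<in> elts \<S>"
  shows "f s \<in> Arr V" "Dom V (f s) = X s" "Cod V (f s) = Y s"
  using assms unfolding pow_hom_def by (auto simp: in_hom)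

lemma pow_tensor_apply [simp]: "s \<in> elts \<S> \<Longrightarrow> pow_tensor A X s = A \<otimes> X s"
  by (simp add: pow_tensor_def)

lemma pow_tensor_ob [simp]: "A \<in> Ob V \<Longrightarrow> X \<in> pow_ob \<Longrightarrow> pow_tensor A X \<in> pow_ob"
  by (auto simp: pow_tensor_def pow_ob_def)

abbreviation component :: "('u \<Rightarrow> 'o) \<Rightarrow> ('u \<Rightarrow> 'o) \<Rightarrow> 'u \<Rightarrow> 'm" where
  "component X Y s \<equiv> proj (elts \<S>) (homs X Y) s"

text \<open>An element of the hom-object V^S(X, Y) is read as a family of functions; this applies
  its member at the sort \<open>s\<close>.\<close>

abbreviation act :: "('u \<Rightarrow> 'o) \<Rightarrow> ('u \<Rightarrow> 'o) \<Rightarrow> 'u \<Rightarrow> 'u \<Rightarrow> 'u \<Rightarrow> 'u" where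
  "act X Y s h a \<equiv> evl (X s) (Y s) (component X Y s \<star> h) a"

lemma pow_vhom_eqI:
  assumes "h \<in> el (pow_vhom X Y)" "k \<in> el (pow_vhom X Y)" "X \<in> pow_ob" "Y \<in> pow_ob"
    and "\<And>s a. s \<in> elts \<S> \<Longrightarrow> a \<in> el (X s) \<Longrightarrow> act X Y s h a = act X Y s k a"
  shows "h = k"
proof (rule prd_eqI[OF assms(1,2)])
  fix s assume s: "s \<in> elts \<S>"
  show "component X Y s \<star> h = component X Y s \<star> k"
    by (rule ihom_eqI[of _ "X s" "Y s"]) (use s assms in simp_all)
qed (use assms in simp_all)

lemma pow_vcat_simps [simp]: "VOb pow_vcat = pow_ob" "VHom pow_vcat = pow_vhom"
  by (simp_all add: pow_vcat_def)

lemma pow_VId [simp]: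
  assumes "X \<in> pow_ob"
  shows "VId pow_vcat X \<in> Arr V" "Dom V (VId pow_vcat X) = \<I>"
    "Cod V (VId pow_vcat X) = pow_vhom X X"
    "s \<in> elts \<S> \<Longrightarrow> a \<in> el (X s) \<Longrightarrow> act X X s (VId pow_vcat X \<star> pt) a = a"
  using assms by (simp_all add: pow_vcat_def)

lemma pow_VCmp [simp]:
  assumes "X \<in> pow_ob" "Y \<in> pow_ob" "Z \<in> pow_ob"
  shows "VCmp pow_vcat X Y Z \<in> Arr V" "Dom V (VCmp pow_vcat X Y Z) = pow_vhom Y Z \<otimes> pow_vhom X Y"
    "Cod V (VCmp pow_vcat X Y Z) = pow_vhom X Z"
    "g \<in> el (pow_vhom Y Z) \<Longrightarrow> f \<in> el (pow_vhom X Y) \<Longrightarrow> s \<in> elts \<S> \<Longrightarrow> a \<in> el (X s) \<Longrightarrow>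
      act X Z s (VCmp pow_vcat X Y Z \<star> kpair g f) a = act Y Z s g (act X Y s f a)"
  using assms by (simp_all add: pow_vcat_def)

lemma vcategory_pow_vcat [simp]: "vcategory pow_vcat"
proof (rule vcategoryI)
  fix X Y f assume "X \<in> VOb pow_vcat" "Y \<in> VOb pow_vcat" "f \<in> el (VHom pow_vcat X Y)"
  then have *: "X \<in> pow_ob" "Y \<in> pow_ob" "f \<in> el (pow_vhom X Y)" by simp_all
  show "VCmp pow_vcat X Y Y \<star> kpair (VId pow_vcat Y \<star> pt) f = f"
    "VCmp pow_vcat X X Y \<star> kpair f (VId pow_vcat X \<star> pt) = f"
    by (rule pow_vhom_eqI[of _ X Y]; use * in simp)+
next
  fix X Y Z W f g h assume "X \<in> VOb pow_vcat" "Y \<in> VOb pow_vcat" "Z \<in> VOb pow_vcat"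
    "W \<in> VOb pow_vcat" "f \<in> el (VHom pow_vcat X Y)" "g \<in> el (VHom pow_vcat Y Z)"
    "h \<in> el (VHom pow_vcat Z W)"
  then have *: "X \<in> pow_ob" "Y \<in> pow_ob" "Z \<in> pow_ob" "W \<in> pow_ob" "f \<in> el (pow_vhom X Y)"
    "g \<in> el (pow_vhom Y Z)" "h \<in> el (pow_vhom Z W)" by simp_all
  show "VCmp pow_vcat X Y W \<star> kpair (VCmp pow_vcat Y Z W \<star> kpair h g) f
      = VCmp pow_vcat X Z W \<star> kpair h (VCmp pow_vcat X Y Z \<star> kpair g f)"
    by (rule pow_vhom_eqI[of _ X W]) (use * in simp_all)
qed simp_all

lemma pow_postcomp [simp]:
  assumes [simp]: "X \<in> pow_ob" "Y \<in> pow_ob" "Z \<in> pow_ob" and g: "g \<in> pow_hom Y Z"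
  shows "pow_postcomp X Y Z g \<in> Arr V" "Dom V (pow_postcomp X Y Z g) = pow_vhom X Y"
    "Cod V (pow_postcomp X Y Z g) = pow_vhom X Z"
    "h \<in> el (pow_vhom X Y) \<Longrightarrow> s \<in> elts \<S> \<Longrightarrow> a \<in> el (X s) \<Longrightarrow>
       act X Z s (pow_postcomp X Y Z g \<star> h) a = g s \<star> act X Y s h a"
  using pow_homD[OF g] by (simp_all add: pow_postcomp_def)

lemma pow_precomp [simp]:
  assumes [simp]: "X \<in> pow_ob" "Y \<in> pow_ob" "Z \<in> pow_ob" and g: "g \<in> pow_hom X Y"
  shows "pow_precomp X Y Z g \<in> Arr V" "Dom V (pow_precomp X Y Z g) = pow_vhom Y Z"
    "Cod V (pow_precomp X Y Z g) = pow_vhom X Z"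
    "h \<in> el (pow_vhom Y Z) \<Longrightarrow> s \<in> elts \<S> \<Longrightarrow> a \<in> el (X s) \<Longrightarrow>
       act X Z s (pow_precomp X Y Z g \<star> h) a = act Y Z s h (g s \<star> a)"
  using pow_homD[OF g] by (simp_all add: pow_precomp_def)

text \<open>In the last rule h acts on an element of V^S(J, A) by composition and leaves the
  parameter alone. It is stated with explicit tensor products instead of \<open>act\<close> because
  \<open>pow_tensor_apply\<close> would rewrite the objects in that form.\<close>

lemma ff_inputs_vfun [simp]:
  assumes [simp]: "J \<in> pow_ob" "P \<in> pow_ob" "A \<in> pow_ob" "B \<in> pow_ob"
  shows "snd (ff_inputs_vfun J P) A B \<in> Arr V" "Dom V (snd (ff_inputs_vfun J P) A B) = pow_vhom A B"
    "Cod V (snd (ff_inputs_vfun J P) A B)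
      = pow_vhom (pow_tensor (pow_vhom J A) P) (pow_tensor (pow_vhom J B) P)"
    "h \<in> el (pow_vhom A B) \<Longrightarrow> s \<in> elts \<S> \<Longrightarrow> j \<in> el (pow_vhom J A) \<Longrightarrow> p \<in> el (P s) \<Longrightarrow>
      evl (pow_vhom J A \<otimes> P s) (pow_vhom J B \<otimes> P s)
        (component (pow_tensor (pow_vhom J A) P) (pow_tensor (pow_vhom J B) P) s
           \<star> snd (ff_inputs_vfun J P) A B \<star> h) (kpair j p)
      = kpair (VCmp pow_vcat J A B \<star> kpair h j) p"
  by (simp_all add: ff_inputs_vfun_def vfun_cmp_def pow_tensor_vfun_def repr_vfun_def)

section \<open>Finite products of carriers and the two actions on them\<close>

definition factor :: "'u list \<Rightarrow> ('u \<Rightarrow> 'o) \<Rightarrow> nat \<Rightarrow> 'm" where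
  "factor Ss A i = proj {..<length Ss} (\<lambda>i. A (Ss ! i)) i"

lemma sort_in [simp]: "set Ss \<subseteq> elts \<S> \<Longrightarrow> i < length Ss \<Longrightarrow> Ss ! i \<in> elts \<S>"
  by auto

lemma fprod_ob [simp]: "set Ss \<subseteq> elts \<S> \<Longrightarrow> A \<in> pow_ob \<Longrightarrow> fprod Ss A \<in> Ob V"
  by (simp add: fprod_def)

lemma factor [simp]:
  assumes "set Ss \<subseteq> elts \<S>" "A \<in> pow_ob" "i < length Ss"
  shows "factor Ss A i \<in> Arr V" "Dom V (factor Ss A i) = fprod Ss A"
    "Cod V (factor Ss A i) = A (Ss ! i)"
  using assms by (simp_all add: fprod_def factor_def)

lemma fprod_eqI:
  assumes "x \<in> el (fprod Ss A)" "y \<in> el (fprod Ss A)" "set Ss \<subseteq> elts \<S>" "A \<in> pow_ob"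
    and "\<And>i. i < length Ss \<Longrightarrow> factor Ss A i \<star> x = factor Ss A i \<star> y"
  shows "x = y"
  by (rule prd_eqI[of x "{..<length Ss}" "\<lambda>i. A (Ss ! i)"])
    (use assms in \<open>auto simp: fprod_def factor_def\<close>)

lemma fprod_arrow [simp]:
  assumes [simp]: "set Ss \<subseteq> elts \<S>" "A \<in> pow_ob" "B \<in> pow_ob" and f: "f \<in> pow_hom A B"
  shows "fprod_arrow Ss A B f \<in> Arr V" "Dom V (fprod_arrow Ss A B f) = fprod Ss A"
    "Cod V (fprod_arrow Ss A B f) = fprod Ss B"
    "i < length Ss \<Longrightarrow> x \<in> el (fprod Ss A) \<Longrightarrow>
       factor Ss B i \<star> fprod_arrow Ss A B f \<star> x = f (Ss ! i) \<star> factor Ss A i \<star> x"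
  using pow_homD[OF f] by (simp_all add: fprod_arrow_def fprod_def factor_def)

lemma fst_fprod_vfun [simp]: "fst (fprod_vfun Ss) = fprod Ss"
  by (simp add: fprod_vfun_def)

text \<open>The enriched counterpart of \<open>fprod_arrow\<close>: h is an element of a hom-object,
  as in the predicates that cut out homomorphisms, whereas \<open>fprod_arrow\<close> takes a family
  of morphisms, as in the naturality of operations.\<close>

abbreviation fprod_act :: "'u list \<Rightarrow> ('u \<Rightarrow> 'o) \<Rightarrow> ('u \<Rightarrow> 'o) \<Rightarrow> 'u \<Rightarrow> 'u \<Rightarrow> 'u" where
  "fprod_act Ss A B h x \<equiv> evl (fprod Ss A) (fprod Ss B) (snd (fprod_vfun Ss) A B \<star> h) x"

lemma fprod_vfun [simp]:
  assumes [simp]: "set Ss \<subseteq> elts \<S>" "A \<in> pow_ob" "B \<in> pow_ob"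
  shows "snd (fprod_vfun Ss) A B \<in> Arr V" "Dom V (snd (fprod_vfun Ss) A B) = pow_vhom A B"
    "Cod V (snd (fprod_vfun Ss) A B) = ihom (fprod Ss A) (fprod Ss B)"
    "i < length Ss \<Longrightarrow> h \<in> el (pow_vhom A B) \<Longrightarrow> x \<in> el (fprod Ss A) \<Longrightarrow>
       factor Ss B i \<star> fprod_act Ss A B h x = act A B (Ss ! i) h (factor Ss A i \<star> x)"
proof -
  let ?t = "tuple {..<length Ss} (\<lambda>i. B (Ss ! i)) (pow_vhom A B \<otimes> fprod Ss A)
     (\<lambda>i. ev (A (Ss ! i)) (B (Ss ! i)) \<cdot> (component A B (Ss ! i) \<otimes>\<^sub>1 factor Ss A i))"
  have t [simp]: "?t \<in> Arr V" "Dom V ?t = pow_vhom A B \<otimes> fprod Ss A" "Cod V ?t = fprod Ss B"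
    "\<And>i h x. i < length Ss \<Longrightarrow> h \<in> el (pow_vhom A B) \<Longrightarrow> x \<in> el (fprod Ss A) \<Longrightarrow>
       factor Ss B i \<star> ?t \<star> kpair h x = act A B (Ss ! i) h (factor Ss A i \<star> x)"
    by (simp_all add: fprod_def factor_def)
  have eq: "snd (fprod_vfun Ss) A B = curry_arrow (pow_vhom A B) (fprod Ss A) (fprod Ss B) ?t"
    by (simp add: fprod_vfun_def factor_def)
  show "snd (fprod_vfun Ss) A B \<in> Arr V" "Dom V (snd (fprod_vfun Ss) A B) = pow_vhom A B"
    "Cod V (snd (fprod_vfun Ss) A B) = ihom (fprod Ss A) (fprod Ss B)"
    unfolding eq by simp_all
  show "factor Ss B i \<star> fprod_act Ss A B h x = act A B (Ss ! i) h (factor Ss A i \<star> x)"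
    if "i < length Ss" "h \<in> el (pow_vhom A B)" "x \<in> el (fprod Ss A)"
    using that unfolding eq by simp
qed

lemma fprod_act_id:
  assumes "set Ss \<subseteq> elts \<S>" "A \<in> pow_ob" "x \<in> el (fprod Ss A)"
  shows "fprod_act Ss A A (VId pow_vcat A \<star> pt) x = x"
  by (rule fprod_eqI[of _ Ss A]) (use assms in simp_all)

lemma fprod_act_cmp:
  assumes "set Ss \<subseteq> elts \<S>" "A \<in> pow_ob" "B \<in> pow_ob" "D \<in> pow_ob"
    "x \<in> el (fprod Ss A)" "f \<in> el (pow_vhom A B)" "g \<in> el (pow_vhom B D)"
  shows "fprod_act Ss A D (VCmp pow_vcat A B D \<star> kpair g f) x
    = fprod_act Ss B D g (fprod_act Ss A B f x)"
  by (rule fprod_eqI[of _ Ss D]) (use assms in simp_all)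

subsection \<open>Finite arities\<close>

text \<open>J is a coproduct of copies of \<I>, one at the sort \<open>Ss ! i\<close> for each
  position i, and \<open>c i\<close> is the element named by its coprojection. The universal
  property is stated sort by sort against an arbitrary object of V, so that an internal hom can be
  the target in \<open>arity_iso_exists\<close>.\<close>

definition generates :: "'u list \<Rightarrow> (nat \<Rightarrow> 'u) \<Rightarrow> ('u \<Rightarrow> 'o) \<Rightarrow> bool" where
  "generates Ss c J \<longleftrightarrow> set Ss \<subseteq> elts \<S> \<and> J \<in> pow_ob \<and> (\<forall>i<length Ss. c i \<in> el (J (Ss ! i)))
     \<and> (\<forall>s\<in>elts \<S>. \<forall>A\<in>Ob V. \<forall>x. (\<forall>i<length Ss. Ss ! i = s \<longrightarrow> x i \<in> el A) \<longrightarrow>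
          (\<exists>!m. m \<in> hom (J s) A \<and> (\<forall>i<length Ss. Ss ! i = s \<longrightarrow> m \<star> c i = x i)))"

lemma arity_generated:
  assumes "J \<in> arity_objects" shows "\<exists>Ss c. generates Ss c J"
proof -
  obtain n where J: "J = (\<lambda>s\<in>elts \<S>. copower (n s) \<I>)" and fin: "finite {s \<in> elts \<S>. n s \<noteq> 0}"
    using assms unfolding arity_objects_def by auto
  let ?P = "SIGMA s:{s \<in> elts \<S>. n s \<noteq> 0}. {..<n s}"
  \<comment> \<open>Each summand of each copower is listed exactly once. Distinctness makes the
    position recoverable from the sort and the summand; a sort with \<open>n s = 0\<close> occupies
    no position, and its copower is initial.\<close>
  obtain L where L: "set L = ?P" "distinct L" using finite_distinct_list[of ?P] fin by auto
  have "\<exists>q. \<forall>s. copower (n s) \<I> \<in> Ob V \<and> (\<forall>k<n s. q s k \<in> el (copower (n s) \<I>))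
      \<and> (\<forall>A\<in>Ob V. \<forall>x. (\<forall>k<n s. x k \<in> el A) \<longrightarrow>
           (\<exists>!m. m \<in> hom (copower (n s) \<I>) A \<and> (\<forall>k<n s. m \<star> q s k = x k)))"
    by (rule choice, rule allI, rule copower_unit)
  then obtain q where q_props: "\<forall>s. copower (n s) \<I> \<in> Ob V \<and> (\<forall>k<n s. q s k \<in> el (copower (n s) \<I>))
      \<and> (\<forall>A\<in>Ob V. \<forall>x. (\<forall>k<n s. x k \<in> el A) \<longrightarrow>
           (\<exists>!m. m \<in> hom (copower (n s) \<I>) A \<and> (\<forall>k<n s. m \<star> q s k = x k)))" ..
  have ob: "copower (n s) \<I> \<in> Ob V" for s using spec[OF q_props, of s] by (elim conjE)
  have q: "q s k \<in> el (copower (n s) \<I>)" if "k < n s" for s k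
    using spec[OF q_props, of s] that by simp
  have univ: "\<exists>!m. m \<in> hom (copower (n s) \<I>) A \<and> (\<forall>k<n s. m \<star> q s k = x k)"
    if "A \<in> Ob V" "\<forall>k<n s. x k \<in> el A" for s A x
    using spec[OF q_props, of s] that by simp
  define Ss where "Ss = map fst L"
  define c where "c i = q (fst (L ! i)) (snd (L ! i))" for i
  have Li: "fst (L ! i) \<in> elts \<S>" "snd (L ! i) < n (fst (L ! i))" if "i < length L" for i
  proof -
    have "L ! i \<in> ?P" using nth_mem[OF that] by (simp only: L(1))
    then show "fst (L ! i) \<in> elts \<S>" "snd (L ! i) < n (fst (L ! i))" by (auto simp: mem_Sigma_iff)
  qed
  have "\<exists>!m. m \<in> hom (J s) A \<and> (\<forall>i<length Ss. Ss ! i = s \<longrightarrow> m \<star> c i = x i)"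
    if s: "s \<in> elts \<S>" and A: "A \<in> Ob V" and x: "\<forall>i<length Ss. Ss ! i = s \<longrightarrow> x i \<in> el A" for s A x
  proof -
    \<comment> \<open>The position of summand \<open>k\<close> of sort \<open>s\<close>; it converts
      families indexed by positions into families indexed by summands.\<close>
    define ix where "ix k = (THE i. i < length L \<and> L ! i = (s, k))" for k
    have ix: "ix k < length L \<and> L ! ix k = (s, k)" if "k < n s" for k
    proof -
      have "(s, k) \<in> set L" using that s L(1) by auto
      then have "\<exists>!i. i < length L \<and> L ! i = (s, k)" using distinct_Ex1[OF L(2)] by blast
      from theI'[OF this] show ?thesis unfolding ix_def .
    qed
    have ix_eq: "ix k = i" if "i < length L" "L ! i = (s, k)" for i k
      unfolding ix_def
      by (rule the_equality) (use that in simp, metis that nth_eq_iff_index_eq[OF L(2)])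
    have eq: "(\<forall>i<length Ss. Ss ! i = s \<longrightarrow> m \<star> c i = x i) \<longleftrightarrow> (\<forall>k<n s. m \<star> q s k = x (ix k))" for m
    proof safe
      fix k assume "\<forall>i<length Ss. Ss ! i = s \<longrightarrow> m \<star> c i = x i" "k < n s"
      then show "m \<star> q s k = x (ix k)" using ix[of k] by (auto simp: Ss_def c_def)
    next
      fix i assume *: "\<forall>k<n (Ss ! i). m \<star> q (Ss ! i) k = x (ix k)" "i < length Ss" "s = Ss ! i"
      then have "L ! i = (s, snd (L ! i))" "i < length L" by (simp_all add: Ss_def)
      then show "m \<star> c i = x i" using * Li[of i] ix_eq[of i "snd (L ! i)"] by (auto simp: Ss_def c_def)
    qed
    have "\<forall>k<n s. x (ix k) \<in> el A" using ix x by (auto simp: Ss_def)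
    from univ[OF A this] show ?thesis unfolding eq using s by (simp add: J)
  qed
  moreover have "set Ss \<subseteq> elts \<S>"
    unfolding Ss_def set_map L(1) by (rule image_subsetI) (erule SigmaE, simp)
  moreover have "J \<in> pow_ob" using ob by (simp add: J pow_ob_def)
  moreover have "c i \<in> el (J (Ss ! i))" if "i < length Ss" for i
    using Li[of i] that q by (simp add: Ss_def c_def J)
  ultimately have "generates Ss c J" unfolding generates_def by blast
  then show ?thesis by blast
qed

text \<open>The order of the summands is not part of J, so generators are chosen.
  \<open>arity_elements\<close> projects from the same choice, which keeps sorts and elements
  matched.\<close>

definition arity_sorts :: "('u \<Rightarrow> 'o) \<Rightarrow> 'u list" where
  "arity_sorts J = fst (SOME (Ss, c). generates Ss c J)"

definition arity_elements :: "('u \<Rightarrow> 'o) \<Rightarrow> nat \<Rightarrow> 'u" where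
  "arity_elements J = snd (SOME (Ss, c). generates Ss c J)"

lemma generates_arity:
  assumes "J \<in> arity_objects" shows "generates (arity_sorts J) (arity_elements J) J"
proof -
  have "\<exists>Sc. case Sc of (Ss, c) \<Rightarrow> generates Ss c J" using arity_generated[OF assms] by auto
  from someI_ex[OF this] show ?thesis
    by (simp add: arity_sorts_def arity_elements_def case_prod_unfold)
qed

lemma arity_simps [simp]:
  assumes "J \<in> arity_objects"
  shows "set (arity_sorts J) \<subseteq> elts \<S>" "J \<in> pow_ob"
    "i < length (arity_sorts J) \<Longrightarrow> arity_elements J i \<in> el (J (arity_sorts J ! i))"
  using generates_arity[OF assms] unfolding generates_def by blast+

lemma arity_universal:
  assumes "J \<in> arity_objects" "s \<in> elts \<S>" "A \<in> Ob V"
    and "\<And>i. i < length (arity_sorts J) \<Longrightarrow> arity_sorts J ! i = s \<Longrightarrow> x i \<in> el A"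
  shows "\<exists>!m. m \<in> hom (J s) A \<and>
    (\<forall>i<length (arity_sorts J). arity_sorts J ! i = s \<longrightarrow> m \<star> arity_elements J i = x i)"
  using generates_arity[OF assms(1)] assms(2-4) unfolding generates_def by simp

abbreviation arity_act :: "('u \<Rightarrow> 'o) \<Rightarrow> ('u \<Rightarrow> 'o) \<Rightarrow> 'u \<Rightarrow> nat \<Rightarrow> 'u" where
  "arity_act J A j i \<equiv> act J A (arity_sorts J ! i) j (arity_elements J i)"

text \<open>At each sort an element of V^S(J, A) corresponds to a morphism out of
  \<open>J s\<close>, and such a morphism is determined by its values at the generators.\<close>

lemma arity_eqI:
  assumes J: "J \<in> arity_objects" and A: "A \<in> pow_ob"
    and jk: "j \<in> el (pow_vhom J A)" "k \<in> el (pow_vhom J A)"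
    and eq: "\<And>i. i < length (arity_sorts J) \<Longrightarrow> arity_act J A j i = arity_act J A k i"
  shows "j = k"
proof (rule pow_vhom_eqI[OF jk])
  fix s a assume s: "s \<in> elts \<S>" and a: "a \<in> el (J s)"
  have Js: "J s \<in> Ob V" "A s \<in> Ob V" and h: "component J A s \<star> j \<in> el (ihom (J s) (A s))"
    "component J A s \<star> k \<in> el (ihom (J s) (A s))"
    using J A s jk by simp_all
  obtain m where m: "m \<in> hom (J s) (A s)" "\<And>a. a \<in> el (J s) \<Longrightarrow> m \<star> a = act J A s j a"
    by (rule arrow_of_element[OF h(1) Js]) blast
  obtain n where n: "n \<in> hom (J s) (A s)" "\<And>a. a \<in> el (J s) \<Longrightarrow> n \<star> a = act J A s k a"
    by (rule arrow_of_element[OF h(2) Js]) blast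
  have "\<exists>!m. m \<in> hom (J s) (A s) \<and> (\<forall>i<length (arity_sorts J). arity_sorts J ! i = s \<longrightarrow>
      m \<star> arity_elements J i = arity_act J A j i)"
    by (rule arity_universal[OF J s Js(2)]) (use J A jk in auto)
  then have "m = n"
  proof (rule ex1_eq)
    show "m \<in> hom (J s) (A s) \<and> (\<forall>i<length (arity_sorts J). arity_sorts J ! i = s \<longrightarrow>
      m \<star> arity_elements J i = arity_act J A j i)"
      using m arity_simps(3)[OF J] by auto
    show "n \<in> hom (J s) (A s) \<and> (\<forall>i<length (arity_sorts J). arity_sorts J ! i = s \<longrightarrow>
      n \<star> arity_elements J i = arity_act J A j i)"
      using n arity_simps(3)[OF J] eq by auto
  qed
  then show "act J A s j a = act J A s k a" using m(2)[OF a] n(2)[OF a] by simp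
qed (use J A in simp_all)

text \<open>Prescribing values at generators defines a function, but a morphism of V is required. So
  the arguments are exchanged: a morphism from \<open>J s\<close> to the internal hom from the
  product to \<open>A s\<close> is given freely by elements of that internal hom, namely those named
  by the factors of sort \<open>s\<close>.\<close>

lemma arity_iso_exists:
  assumes J: "J \<in> arity_objects" and A: "A \<in> pow_ob"
  shows "\<exists>t\<in>hom (fprod (arity_sorts J) A) (pow_vhom J A). \<forall>x\<in>el (fprod (arity_sorts J) A).
    \<forall>i<length (arity_sorts J). arity_act J A (t \<star> x) i = factor (arity_sorts J) A i \<star> x"
proof -
  let ?Ss = "arity_sorts J" and ?F = "fprod (arity_sorts J) A"
  note [simp] = J A
  have "\<exists>m. m \<in> hom ?F (ihom (J s) (A s)) \<and> (\<forall>x\<in>el ?F. \<forall>i<length ?Ss. ?Ss ! i = s \<longrightarrow>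
      evl (J s) (A s) (m \<star> x) (arity_elements J i) = factor ?Ss A i \<star> x)" if s [simp]: "s \<in> elts \<S>" for s
  proof -
    have "\<exists>h. h \<in> el (ihom ?F (A (?Ss ! i))) \<and> (\<forall>x\<in>el ?F. evl ?F (A (?Ss ! i)) h x = factor ?Ss A i \<star> x)"
      if "i < length ?Ss" for i
      by (rule element_of_arrow[of "factor ?Ss A i" ?F "A (?Ss ! i)"]) (use that in \<open>auto simp: in_hom\<close>)
    then have "\<forall>i\<in>{..<length ?Ss}. \<exists>h. h \<in> el (ihom ?F (A (?Ss ! i)))
        \<and> (\<forall>x\<in>el ?F. evl ?F (A (?Ss ! i)) h x = factor ?Ss A i \<star> x)" by simp
    from bchoice[OF this] obtain p where
      p: "\<And>i. i < length ?Ss \<Longrightarrow> p i \<in> el (ihom ?F (A (?Ss ! i)))"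
        "\<And>i x. i < length ?Ss \<Longrightarrow> x \<in> el ?F \<Longrightarrow> evl ?F (A (?Ss ! i)) (p i) x = factor ?Ss A i \<star> x"
      by auto
    have "\<exists>!m. m \<in> hom (J s) (ihom ?F (A s)) \<and>
        (\<forall>i<length ?Ss. ?Ss ! i = s \<longrightarrow> m \<star> arity_elements J i = p i)"
      by (rule arity_universal) (use p in auto)
    then obtain m where m: "m \<in> Arr V" "Dom V m = J s" "Cod V m = ihom ?F (A s)"
      and mp: "\<forall>i<length ?Ss. ?Ss ! i = s \<longrightarrow> m \<star> arity_elements J i = p i"
      unfolding in_hom by (elim ex1E conjE)
    \<comment> \<open>The universal property of \<open>J s\<close> gives the transpose with the
      arguments in the wrong order; symmetry and currying turn it into a morphism out of the
      product.\<close>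
    let ?m = "curry_arrow ?F (J s) (A s) (ev ?F (A s) \<cdot> (m \<otimes>\<^sub>1 idn ?F) \<cdot> symm ?F (J s))"
    have "evl (J s) (A s) (?m \<star> x) (arity_elements J i) = factor ?Ss A i \<star> x"
      if x: "x \<in> el ?F" and i: "i < length ?Ss" "?Ss ! i = s" for x i
    proof -
      have c: "arity_elements J i \<in> el (J s)" using arity_simps(3)[OF J i(1)] i(2) by simp
      have "evl (J s) (A s) (?m \<star> x) (arity_elements J i)
          = evl ?F (A s) (m \<star> arity_elements J i) x"
        using m x c by simp
      then show ?thesis using mp p(2)[OF i(1) x] i by simp
    qed
    moreover have "?m \<in> hom ?F (ihom (J s) (A s))" using m by (simp add: in_hom)
    ultimately show ?thesis by blast
  qed
  then have "\<forall>s\<in>elts \<S>. \<exists>m. m \<in> hom ?F (ihom (J s) (A s)) \<and> (\<forall>x\<in>el ?F. \<forall>i<length ?Ss. ?Ss ! i = s \<longrightarrow>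
      evl (J s) (A s) (m \<star> x) (arity_elements J i) = factor ?Ss A i \<star> x)" by blast
  from bchoice[OF this] obtain m where
    m: "\<And>s. s \<in> elts \<S> \<Longrightarrow> m s \<in> Arr V \<and> Dom V (m s) = ?F \<and> Cod V (m s) = ihom (J s) (A s)"
    and mx: "\<And>s x i. s \<in> elts \<S> \<Longrightarrow> x \<in> el ?F \<Longrightarrow> i < length ?Ss \<Longrightarrow> ?Ss ! i = s \<Longrightarrow>
      evl (J s) (A s) (m s \<star> x) (arity_elements J i) = factor ?Ss A i \<star> x"
    unfolding in_hom by auto
  have "tuple (elts \<S>) (homs J A) ?F m \<in> hom ?F (pow_vhom J A)" using m by (simp add: in_hom)
  moreover have "arity_act J A (tuple (elts \<S>) (homs J A) ?F m \<star> x) i = factor ?Ss A i \<star> x"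
    if "x \<in> el ?F" "i < length ?Ss" for x i
    using m mx[OF _ that] that by simp
  ultimately show ?thesis by blast
qed

definition arity_iso :: "('u \<Rightarrow> 'o) \<Rightarrow> ('u \<Rightarrow> 'o) \<Rightarrow> 'm" where
  "arity_iso J A = (SOME t. t \<in> hom (fprod (arity_sorts J) A) (pow_vhom J A)
     \<and> (\<forall>x\<in>el (fprod (arity_sorts J) A). \<forall>i<length (arity_sorts J).
          arity_act J A (t \<star> x) i = factor (arity_sorts J) A i \<star> x))"

lemma arity_iso [simp]:
  assumes "J \<in> arity_objects" "A \<in> pow_ob"
  shows "arity_iso J A \<in> Arr V" "Dom V (arity_iso J A) = fprod (arity_sorts J) A"
    "Cod V (arity_iso J A) = pow_vhom J A"
    "x \<in> el (fprod (arity_sorts J) A) \<Longrightarrow> i < length (arity_sorts J) \<Longrightarrow>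
      arity_act J A (arity_iso J A \<star> x) i = factor (arity_sorts J) A i \<star> x"
proof -
  have "\<exists>t. t \<in> hom (fprod (arity_sorts J) A) (pow_vhom J A)
     \<and> (\<forall>x\<in>el (fprod (arity_sorts J) A). \<forall>i<length (arity_sorts J).
          arity_act J A (t \<star> x) i = factor (arity_sorts J) A i \<star> x)"
    using arity_iso_exists[OF assms] by blast
  from someI_ex[OF this]
  have *: "arity_iso J A \<in> hom (fprod (arity_sorts J) A) (pow_vhom J A)
     \<and> (\<forall>x\<in>el (fprod (arity_sorts J) A). \<forall>i<length (arity_sorts J).
          arity_act J A (arity_iso J A \<star> x) i = factor (arity_sorts J) A i \<star> x)"
    unfolding arity_iso_def .
  then show "arity_iso J A \<in> Arr V" "Dom V (arity_iso J A) = fprod (arity_sorts J) A"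
    "Cod V (arity_iso J A) = pow_vhom J A" by (auto simp: in_hom)
  assume "x \<in> el (fprod (arity_sorts J) A)" "i < length (arity_sorts J)"
  then show "arity_act J A (arity_iso J A \<star> x) i = factor (arity_sorts J) A i \<star> x"
    using * by blast
qed

text \<open>The i-th component is the projection to the sort of the i-th generator followed by
  evaluation at that generator.\<close>

lemma arity_iso_inv_exists:
  assumes J: "J \<in> arity_objects" and A: "A \<in> pow_ob"
  shows "\<exists>t. t \<in> hom (pow_vhom J A) (fprod (arity_sorts J) A) \<and> (\<forall>j\<in>el (pow_vhom J A).
    \<forall>i<length (arity_sorts J). factor (arity_sorts J) A i \<star> t \<star> j = arity_act J A j i)"
proof -
  let ?Ss = "arity_sorts J"
  note [simp] = J A
  have "\<forall>i\<in>{..<length ?Ss}. \<exists>m. m \<in> hom (ihom (J (?Ss ! i)) (A (?Ss ! i))) (A (?Ss ! i)) \<and>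
      (\<forall>h\<in>el (ihom (J (?Ss ! i)) (A (?Ss ! i))).
        m \<star> h = evl (J (?Ss ! i)) (A (?Ss ! i)) h (arity_elements J i))"
    by (rule ballI, rule evaluation_arrow) auto
  from bchoice[OF this] obtain m where
    m: "\<And>i. i < length ?Ss \<Longrightarrow> m i \<in> Arr V \<and> Dom V (m i) = ihom (J (?Ss ! i)) (A (?Ss ! i))
        \<and> Cod V (m i) = A (?Ss ! i)"
    and mh: "\<And>i h. i < length ?Ss \<Longrightarrow> h \<in> el (ihom (J (?Ss ! i)) (A (?Ss ! i))) \<Longrightarrow>
        m i \<star> h = evl (J (?Ss ! i)) (A (?Ss ! i)) h (arity_elements J i)"
    unfolding in_hom by auto
  let ?t = "tuple {..<length ?Ss} (\<lambda>i. A (?Ss ! i)) (pow_vhom J A) (\<lambda>i. m i \<cdot> component J A (?Ss ! i))"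
  have "?t \<in> hom (pow_vhom J A) (fprod ?Ss A)" using m by (simp add: in_hom fprod_def)
  moreover have "factor ?Ss A i \<star> ?t \<star> j = arity_act J A j i"
    if "j \<in> el (pow_vhom J A)" "i < length ?Ss" for j i
    using m mh that by (simp add: factor_def)
  ultimately show ?thesis by blast
qed

definition arity_iso_inv :: "('u \<Rightarrow> 'o) \<Rightarrow> ('u \<Rightarrow> 'o) \<Rightarrow> 'm" where
  "arity_iso_inv J A = (SOME t. t \<in> hom (pow_vhom J A) (fprod (arity_sorts J) A)
     \<and> (\<forall>j\<in>el (pow_vhom J A). \<forall>i<length (arity_sorts J).
          factor (arity_sorts J) A i \<star> t \<star> j = arity_act J A j i))"

lemma arity_iso_inv [simp]:
  assumes "J \<in> arity_objects" "A \<in> pow_ob"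
  shows "arity_iso_inv J A \<in> Arr V" "Dom V (arity_iso_inv J A) = pow_vhom J A"
    "Cod V (arity_iso_inv J A) = fprod (arity_sorts J) A"
    "j \<in> el (pow_vhom J A) \<Longrightarrow> i < length (arity_sorts J) \<Longrightarrow>
      factor (arity_sorts J) A i \<star> arity_iso_inv J A \<star> j = arity_act J A j i"
proof -
  from someI_ex[OF arity_iso_inv_exists[OF assms]]
  have *: "arity_iso_inv J A \<in> hom (pow_vhom J A) (fprod (arity_sorts J) A)
     \<and> (\<forall>j\<in>el (pow_vhom J A). \<forall>i<length (arity_sorts J).
          factor (arity_sorts J) A i \<star> arity_iso_inv J A \<star> j = arity_act J A j i)"
    unfolding arity_iso_inv_def .
  then show "arity_iso_inv J A \<in> Arr V" "Dom V (arity_iso_inv J A) = pow_vhom J A"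
    "Cod V (arity_iso_inv J A) = fprod (arity_sorts J) A" by (auto simp: in_hom)
  assume "j \<in> el (pow_vhom J A)" "i < length (arity_sorts J)"
  then show "factor (arity_sorts J) A i \<star> arity_iso_inv J A \<star> j = arity_act J A j i"
    using * by blast
qed

lemma arity_iso_inverse [simp]:
  assumes "J \<in> arity_objects" "A \<in> pow_ob"
  shows "j \<in> el (pow_vhom J A) \<Longrightarrow> arity_iso J A \<star> arity_iso_inv J A \<star> j = j"
    "x \<in> el (fprod (arity_sorts J) A) \<Longrightarrow> arity_iso_inv J A \<star> arity_iso J A \<star> x = x"
proof -
  show "arity_iso J A \<star> arity_iso_inv J A \<star> j = j" if "j \<in> el (pow_vhom J A)"
    by (rule arity_eqI[OF assms]) (use assms that in simp_all)
  show "arity_iso_inv J A \<star> arity_iso J A \<star> x = x" if "x \<in> el (fprod (arity_sorts J) A)"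
    by (rule fprod_eqI[of _ "arity_sorts J" A]) (use assms that in simp_all)
qed

text \<open>At the i-th generator both sides equal h applied to the i-th factor of x. Since
  composition with h is how V^S(J, -) acts, this is the enriched naturality of
  \<open>arity_iso\<close> on elements.\<close>

lemma arity_iso_fprod_act:
  assumes "J \<in> arity_objects" "A \<in> pow_ob" "B \<in> pow_ob" "h \<in> el (pow_vhom A B)"
    "x \<in> el (fprod (arity_sorts J) A)"
  shows "arity_iso J B \<star> fprod_act (arity_sorts J) A B h x
    = VCmp pow_vcat J A B \<star> kpair h (arity_iso J A \<star> x)"
  by (rule arity_eqI[OF assms(1,3)]) (use assms in simp_all)

lemma arity_iso_fprod_arrow:
  assumes "J \<in> arity_objects" "A \<in> pow_ob" "B \<in> pow_ob" "f \<in> pow_hom A B"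
    "x \<in> el (fprod (arity_sorts J) A)"
  shows "arity_iso J B \<star> fprod_arrow (arity_sorts J) A B f \<star> x
    = pow_postcomp J A B f \<star> arity_iso J A \<star> x"
  by (rule arity_eqI[OF assms(1,3)]) (use assms in simp_all)

section \<open>Inputs of a free-form operation against inputs of its sorted counterparts\<close>

definition op_of :: "('u \<Rightarrow> 'o) \<Rightarrow> ('u \<Rightarrow> 'o) \<Rightarrow> 'u \<Rightarrow> ('u, 'o) op_type" where
  "op_of J P s = (arity_sorts J, s, P s)"

lemma result_op_of [simp]: "result (op_of J P s) = s"
  by (simp add: result_def op_of_def)

lemma inputs_op_of: "inputs (op_of J P s) A = P s \<otimes> fprod (arity_sorts J) A"
  by (simp add: inputs_def op_of_def)

lemma inputs_arrow_op_of:
  "inputs_arrow (op_of J P s) A B f = idn (P s) \<otimes>\<^sub>1 fprod_arrow (arity_sorts J) A B f"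
  by (simp add: inputs_arrow_def op_of_def)

lemma ff_inputs_apply: "s \<in> elts \<S> \<Longrightarrow> ff_inputs J P A s = pow_vhom J A \<otimes> P s"
  by (simp add: ff_inputs_def)

text \<open>The symmetry is there because sorted operations take the parameter on the left and
  free-form operations take it on the right.\<close>

definition inputs_iso :: "('u \<Rightarrow> 'o) \<Rightarrow> ('u \<Rightarrow> 'o) \<Rightarrow> 'u \<Rightarrow> ('u \<Rightarrow> 'o) \<Rightarrow> 'm" where
  "inputs_iso J P s A = (arity_iso J A \<otimes>\<^sub>1 idn (P s)) \<cdot> symm (P s) (fprod (arity_sorts J) A)"

definition inputs_iso_inv :: "('u \<Rightarrow> 'o) \<Rightarrow> ('u \<Rightarrow> 'o) \<Rightarrow> 'u \<Rightarrow> ('u \<Rightarrow> 'o) \<Rightarrow> 'm" where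
  "inputs_iso_inv J P s A = symm (fprod (arity_sorts J) A) (P s) \<cdot> (arity_iso_inv J A \<otimes>\<^sub>1 idn (P s))"

context
  fixes J P s A
  assumes JP [simp]: "J \<in> arity_objects" "P \<in> pow_ob" "s \<in> elts \<S>" "A \<in> pow_ob"
begin

lemma inputs_iso [simp]:
  shows "inputs_iso J P s A \<in> Arr V" "Dom V (inputs_iso J P s A) = inputs (op_of J P s) A"
    "Cod V (inputs_iso J P s A) = ff_inputs J P A s"
    "p \<in> el (P s) \<Longrightarrow> x \<in> el (fprod (arity_sorts J) A) \<Longrightarrow>
       inputs_iso J P s A \<star> kpair p x = kpair (arity_iso J A \<star> x) p"
  by (simp_all add: inputs_iso_def inputs_op_of ff_inputs_apply)

lemma inputs_iso_inv [simp]: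
  shows "inputs_iso_inv J P s A \<in> Arr V" "Dom V (inputs_iso_inv J P s A) = ff_inputs J P A s"
    "Cod V (inputs_iso_inv J P s A) = inputs (op_of J P s) A"
    "p \<in> el (P s) \<Longrightarrow> j \<in> el (pow_vhom J A) \<Longrightarrow>
       inputs_iso_inv J P s A \<star> kpair j p = kpair p (arity_iso_inv J A \<star> j)"
  by (simp_all add: inputs_iso_inv_def inputs_op_of ff_inputs_apply)

lemma inputs_ob [simp]: "inputs (op_of J P s) A \<in> Ob V" "ff_inputs J P A s \<in> Ob V"
  by (simp_all add: inputs_op_of ff_inputs_apply)

lemma inputs_iso_inverse:
  "inputs_iso_inv J P s A \<cdot> inputs_iso J P s A = idn (inputs (op_of J P s) A)"
  "inputs_iso J P s A \<cdot> inputs_iso_inv J P s A = idn (ff_inputs J P A s)"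
proof -
  show "inputs_iso_inv J P s A \<cdot> inputs_iso J P s A = idn (inputs (op_of J P s) A)"
  proof (rule arr_eqI)
    fix a assume "a \<in> el (Dom V (inputs_iso_inv J P s A \<cdot> inputs_iso J P s A))"
    then have "a \<in> el (P s \<otimes> fprod (arity_sorts J) A)" by (simp add: inputs_op_of)
    then obtain p x where "a = kpair p x" "p \<in> el (P s)" "x \<in> el (fprod (arity_sorts J) A)"
      by (rule el_tensorE) simp_all
    then show "(inputs_iso_inv J P s A \<cdot> inputs_iso J P s A) \<star> a
        = idn (inputs (op_of J P s) A) \<star> a"
      by (simp add: inputs_op_of)
  qed simp_all
  show "inputs_iso J P s A \<cdot> inputs_iso_inv J P s A = idn (ff_inputs J P A s)"
  proof (rule arr_eqI)
    fix a assume "a \<in> el (Dom V (inputs_iso J P s A \<cdot> inputs_iso_inv J P s A))"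
    then have "a \<in> el (pow_vhom J A \<otimes> P s)" by (simp add: ff_inputs_apply)
    then obtain j p where "a = kpair j p" "j \<in> el (pow_vhom J A)" "p \<in> el (P s)"
      by (rule el_tensorE) simp_all
    then show "(inputs_iso J P s A \<cdot> inputs_iso_inv J P s A) \<star> a
        = idn (ff_inputs J P A s) \<star> a"
      by (simp add: ff_inputs_apply)
  qed simp_all
qed

lemma inputs_iso_cancel:
  assumes "m \<in> hom (ff_inputs J P A s) B"
  shows "m \<cdot> inputs_iso J P s A \<cdot> inputs_iso_inv J P s A = m"
proof -
  have "m \<cdot> inputs_iso J P s A \<cdot> inputs_iso_inv J P s A = m \<cdot> idn (ff_inputs J P A s)"
    unfolding inputs_iso_inverse(2)[symmetric]
    by (rule cmp_assoc[OF _ _ assms]) (simp_all add: in_hom)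
  then show ?thesis using idn_right[OF assms] by simp
qed

lemma inputs_iso_inv_cancel:
  assumes "m \<in> hom (inputs (op_of J P s) A) B"
  shows "m \<cdot> inputs_iso_inv J P s A \<cdot> inputs_iso J P s A = m"
proof -
  have "m \<cdot> inputs_iso_inv J P s A \<cdot> inputs_iso J P s A = m \<cdot> idn (inputs (op_of J P s) A)"
    unfolding inputs_iso_inverse(1)[symmetric]
    by (rule cmp_assoc[OF _ _ assms]) (simp_all add: in_hom)
  then show ?thesis using idn_right[OF assms] by simp
qed

lemma inputs_iso_cancel_iff:
  assumes "m \<in> hom (ff_inputs J P A s) B" "n \<in> hom (ff_inputs J P A s) B"
  shows "m \<cdot> inputs_iso J P s A = n \<cdot> inputs_iso J P s A \<longleftrightarrow> m = n"
  using inputs_iso_cancel[OF assms(1)] inputs_iso_cancel[OF assms(2)] by metis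

end

text \<open>Naturality along ordinary morphisms of the power, inherited from
  \<open>arity_iso_fprod_arrow\<close>. It carries naturality of operations from one kind of algebra
  to the other.\<close>

lemma inputs_iso_natural:
  assumes [simp]: "J \<in> arity_objects" "P \<in> pow_ob" "s \<in> elts \<S>" "A \<in> pow_ob" "B \<in> pow_ob"
    and f [simp]: "f \<in> pow_hom A B"
  shows "inputs_iso J P s B \<cdot> inputs_arrow (op_of J P s) A B f
    = ff_inputs_arrow J P A B f s \<cdot> inputs_iso J P s A"
proof (rule arr_eqI)
  fix a assume "a \<in> el (Dom V (inputs_iso J P s B \<cdot> inputs_arrow (op_of J P s) A B f))"
  then have "a \<in> el (P s \<otimes> fprod (arity_sorts J) A)"
    by (simp add: inputs_op_of inputs_arrow_op_of)
  then obtain p x where "a = kpair p x" "p \<in> el (P s)" "x \<in> el (fprod (arity_sorts J) A)"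
    by (rule el_tensorE) simp_all
  then show "(inputs_iso J P s B \<cdot> inputs_arrow (op_of J P s) A B f) \<star> a
      = (ff_inputs_arrow J P A B f s \<cdot> inputs_iso J P s A) \<star> a"
    by (simp add: inputs_op_of inputs_arrow_op_of ff_inputs_apply ff_inputs_arrow_def
        arity_iso_fprod_arrow)
qed (simp_all add: inputs_op_of inputs_arrow_op_of ff_inputs_apply ff_inputs_arrow_def)

end

section \<open>Algebras as cut-out subcategories of the power\<close>

context sorted_topological
begin

text \<open>F and G are the two morphisms that one symbol contributes to the joint equalizer. Values
  in their common codomain are compared on pairs of j and p: there F composes h with j before
  applying b, and G applies h to the result of a.\<close>

lemma ff_condition:
  assumes ob [simp]: "J \<in> pow_ob" "P \<in> pow_ob" "A \<in> pow_ob" "B \<in> pow_ob"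
    and a: "a \<in> pow_hom (ff_inputs J P A) A" and b: "b \<in> pow_hom (ff_inputs J P B) B"
  defines "F \<equiv> pow_postcomp (ff_inputs J P A) (ff_inputs J P B) B b \<cdot> snd (ff_inputs_vfun J P) A B"
    and "G \<equiv> pow_precomp (ff_inputs J P A) A B a"
  shows "F \<in> Arr V" "Dom V F = pow_vhom A B" "Cod V F = pow_vhom (ff_inputs J P A) B"
    "G \<in> Arr V" "Dom V G = pow_vhom A B" "Cod V G = pow_vhom (ff_inputs J P A) B"
    "h \<in> el (pow_vhom A B) \<Longrightarrow> F \<star> h = G \<star> h \<longleftrightarrow> (\<forall>s\<in>elts \<S>. \<forall>j\<in>el (pow_vhom J A). \<forall>p\<in>el (P s).
       b s \<star> kpair (VCmp pow_vcat J A B \<star> kpair h j) p = act A B s h (a s \<star> kpair j p))"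
proof -
  \<comment> \<open>Opaque names for the two input families; their values at a sort are expanded
    through \<open>Xs\<close>, where elements have to be recognized as pairs.\<close>
  define X where "X = ff_inputs J P A"
  define Y where "Y = ff_inputs J P B"
  have [simp]: "X \<in> pow_ob" "Y \<in> pow_ob" by (simp_all add: X_def Y_def ff_inputs_def)
  have Xs: "X s = pow_vhom J A \<otimes> P s" "Y s = pow_vhom J B \<otimes> P s" if "s \<in> elts \<S>" for s
    using that by (simp_all add: X_def Y_def ff_inputs_apply)
  have fv [simp]: "snd (ff_inputs_vfun J P) A B \<in> Arr V"
    "Dom V (snd (ff_inputs_vfun J P) A B) = pow_vhom A B"
    "Cod V (snd (ff_inputs_vfun J P) A B) = pow_vhom X Y"
    by (simp_all add: X_def Y_def ff_inputs_def)
  have F: "F = pow_postcomp X Y B b \<cdot> snd (ff_inputs_vfun J P) A B" and G: "G = pow_precomp X A B a"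
    by (simp_all add: F_def G_def X_def Y_def)
  have a' [simp]: "a \<in> pow_hom X A" and b' [simp]: "b \<in> pow_hom Y B"
    using a b by (simp_all add: X_def Y_def)
  show *: "F \<in> Arr V" "Dom V F = pow_vhom A B" "Cod V F = pow_vhom (ff_inputs J P A) B"
    "G \<in> Arr V" "Dom V G = pow_vhom A B" "Cod V G = pow_vhom (ff_inputs J P A) B"
    unfolding F G X_def[symmetric] by simp_all
  assume h [simp]: "h \<in> el (pow_vhom A B)"
  have fa: "act X Y s (snd (ff_inputs_vfun J P) A B \<star> h) (kpair j p)
      = kpair (VCmp pow_vcat J A B \<star> kpair h j) p"
    if "s \<in> elts \<S>" "j \<in> el (pow_vhom J A)" "p \<in> el (P s)" for s j p
    using that ff_inputs_vfun(4)[OF ob h] Xs[OF that(1)] by (simp add: X_def Y_def ff_inputs_def)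
  have lhs: "act X B s (F \<star> h) (kpair j p) = b s \<star> kpair (VCmp pow_vcat J A B \<star> kpair h j) p"
    and rhs: "act X B s (G \<star> h) (kpair j p) = act A B s h (a s \<star> kpair j p)"
    if "s \<in> elts \<S>" "j \<in> el (pow_vhom J A)" "p \<in> el (P s)" for s j p
  proof -
    have e: "kpair j p \<in> el (X s)" using that by (simp add: Xs)
    show "act X B s (F \<star> h) (kpair j p) = b s \<star> kpair (VCmp pow_vcat J A B \<star> kpair h j) p"
      using that e fa[OF that] by (simp add: F)
    show "act X B s (G \<star> h) (kpair j p) = act A B s h (a s \<star> kpair j p)"
      using that e by (simp add: G)
  qed
  show "F \<star> h = G \<star> h \<longleftrightarrow> (\<forall>s\<in>elts \<S>. \<forall>j\<in>el (pow_vhom J A). \<forall>p\<in>el (P s).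
       b s \<star> kpair (VCmp pow_vcat J A B \<star> kpair h j) p = act A B s h (a s \<star> kpair j p))"
    (is "_ \<longleftrightarrow> ?R")
  proof
    assume eq: "F \<star> h = G \<star> h"
    show ?R
      by (intro ballI, subst lhs[symmetric], assumption+, subst rhs[symmetric], assumption+)
        (simp only: eq)
  next
    assume R: ?R
    show "F \<star> h = G \<star> h"
    proof (rule pow_vhom_eqI[of _ X B])
      show "F \<star> h \<in> el (pow_vhom X B)" "G \<star> h \<in> el (pow_vhom X B)"
        using * by (simp_all add: X_def)
      fix s e assume s: "s \<in> elts \<S>" and "e \<in> el (X s)"
      then have "e \<in> el (pow_vhom J A \<otimes> P s)" by (simp add: Xs)
      then obtain j p where "e = kpair j p" "j \<in> el (pow_vhom J A)" "p \<in> el (P s)"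
        by (rule el_tensorE) (simp_all add: s)
      then show "act X B s (F \<star> h) e = act X B s (G \<star> h) e"
        using s R lhs rhs by simp
    qed simp_all
  qed
qed

lemma alg_condition:
  assumes [simp]: "set Ss \<subseteq> elts \<S>" "s \<in> elts \<S>" "P \<in> Ob V" "A \<in> pow_ob" "B \<in> pow_ob"
    and a: "a \<in> hom (inputs (Ss, s, P) A) (A s)" and b: "b \<in> hom (inputs (Ss, s, P) B) (B s)"
  defines "F \<equiv> postcomp (inputs (Ss, s, P) A) b \<cdot> snd (inputs_vfun (Ss, s, P)) A B"
    and "G \<equiv> precomp a (B s) \<cdot> component A B s"
  shows "F \<in> Arr V" "Dom V F = pow_vhom A B" "Cod V F = ihom (inputs (Ss, s, P) A) (B s)"
    "G \<in> Arr V" "Dom V G = pow_vhom A B" "Cod V G = ihom (inputs (Ss, s, P) A) (B s)"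
    "h \<in> el (pow_vhom A B) \<Longrightarrow> F \<star> h = G \<star> h \<longleftrightarrow> (\<forall>p\<in>el P. \<forall>x\<in>el (fprod Ss A).
       b \<star> kpair p (fprod_act Ss A B h x) = act A B s h (a \<star> kpair p x))"
proof -
  have [simp]: "a \<in> Arr V" "Dom V a = P \<otimes> fprod Ss A" "Cod V a = A s"
    "b \<in> Arr V" "Dom V b = P \<otimes> fprod Ss B" "Cod V b = B s"
    using a b by (auto simp: in_hom inputs_def)
  have i: "inputs (Ss, s, P) A = P \<otimes> fprod Ss A" by (simp add: inputs_def)
  have F: "F = postcomp (P \<otimes> fprod Ss A) b
      \<cdot> (snd (ltensor_vfun P) (fprod Ss A) (fprod Ss B) \<cdot> snd (fprod_vfun Ss) A B)"
    by (simp add: F_def i inputs_vfun_def vfun_cmp_def)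
  show *: "F \<in> Arr V" "Dom V F = pow_vhom A B" "Cod V F = ihom (inputs (Ss, s, P) A) (B s)"
    "G \<in> Arr V" "Dom V G = pow_vhom A B" "Cod V G = ihom (inputs (Ss, s, P) A) (B s)"
    unfolding F G_def i by simp_all
  assume h [simp]: "h \<in> el (pow_vhom A B)"
  have lhs: "evl (P \<otimes> fprod Ss A) (B s) (F \<star> h) (kpair p x) = b \<star> kpair p (fprod_act Ss A B h x)"
    and rhs: "evl (P \<otimes> fprod Ss A) (B s) (G \<star> h) (kpair p x) = act A B s h (a \<star> kpair p x)"
    if "p \<in> el P" "x \<in> el (fprod Ss A)" for p x
    using that by (simp_all add: F G_def)
  show "F \<star> h = G \<star> h \<longleftrightarrow> (\<forall>p\<in>el P. \<forall>x\<in>el (fprod Ss A).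
       b \<star> kpair p (fprod_act Ss A B h x) = act A B s h (a \<star> kpair p x))" (is "_ \<longleftrightarrow> ?R")
  proof
    assume eq: "F \<star> h = G \<star> h"
    show ?R
      by (intro ballI, subst lhs[symmetric], assumption+, subst rhs[symmetric], assumption+)
        (simp only: eq)
  next
    assume R: ?R
    show "F \<star> h = G \<star> h"
    proof (rule ihom_eqI[of _ "P \<otimes> fprod Ss A" "B s"])
      show "F \<star> h \<in> el (ihom (P \<otimes> fprod Ss A) (B s))" "G \<star> h \<in> el (ihom (P \<otimes> fprod Ss A) (B s))"
        using * by (simp_all add: i)
      fix e assume "e \<in> el (P \<otimes> fprod Ss A)"
      then obtain p x where "e = kpair p x" "p \<in> el P" "x \<in> el (fprod Ss A)"
        by (rule el_tensorE) simp_all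
      then show "evl (P \<otimes> fprod Ss A) (B s) (F \<star> h) e = evl (P \<otimes> fprod Ss A) (B s) (G \<star> h) e"
        using R lhs rhs by simp
    qed simp_all
  qed
qed

text \<open>The homomorphism condition for an element h of V^S(A, B) in place of a family of
  morphisms; the composition \<open>VCmp\<close> with h plays the role of V^S(J, f).\<close>

definition ff_preserves :: "('u, 'o) free_form_signature \<Rightarrow> ('u, 'o, 'm) ff_algebra \<Rightarrow>
    ('u, 'o, 'm) ff_algebra \<Rightarrow> 'u \<Rightarrow> bool" where
  "ff_preserves \<Gamma> A B h \<longleftrightarrow> (\<forall>\<sigma>\<in>elts (symbols \<Gamma>). \<forall>s\<in>elts \<S>.
     \<forall>j\<in>el (pow_vhom (arity \<Gamma> \<sigma>) (fst A)). \<forall>p\<in>el (param \<Gamma> \<sigma> s).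
       snd B \<sigma> s \<star> kpair (VCmp pow_vcat (arity \<Gamma> \<sigma>) (fst A) (fst B) \<star> kpair h j) p
       = act (fst A) (fst B) s h (snd A \<sigma> s \<star> kpair j p))"

definition preserves :: "('u, 'o) signature \<Rightarrow> ('u, 'o, 'm) algebra \<Rightarrow>
    ('u, 'o, 'm) algebra \<Rightarrow> 'u \<Rightarrow> bool" where
  "preserves \<Sigma> A B h \<longleftrightarrow> (\<forall>\<sigma>\<in>elts (ops \<Sigma>). case op_type \<Sigma> \<sigma> of (Ss, s, P) \<Rightarrow>
     \<forall>p\<in>el P. \<forall>x\<in>el (fprod Ss (fst A)).
       snd B \<sigma> \<star> kpair p (fprod_act Ss (fst A) (fst B) h x)
       = act (fst A) (fst B) s h (snd A \<sigma> \<star> kpair p x))"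

lemma ff_signatureD:
  assumes "free_form_signature \<Gamma>" "\<sigma> \<in> elts (symbols \<Gamma>)"
  shows "arity \<Gamma> \<sigma> \<in> arity_objects" "param \<Gamma> \<sigma> \<in> pow_ob"
  using assms unfolding free_form_signature_def by auto

lemma ff_algebrasD:
  assumes "A \<in> ff_algebras \<Gamma>"
  shows "fst A \<in> pow_ob" "snd A \<in> extensional (elts (symbols \<Gamma>))"
    "\<sigma> \<in> elts (symbols \<Gamma>) \<Longrightarrow>
      snd A \<sigma> \<in> pow_hom (ff_inputs (arity \<Gamma> \<sigma>) (param \<Gamma> \<sigma>) (fst A)) (fst A)"
  using assms unfolding ff_algebras_def by (auto simp: PiE_def)

lemma algebrasD:
  assumes "A \<in> algebras \<Sigma>"
  shows "fst A \<in> pow_ob" "snd A \<in> extensional (elts (ops \<Sigma>))"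
    "\<sigma> \<in> elts (ops \<Sigma>) \<Longrightarrow>
      snd A \<sigma> \<in> hom (inputs (op_type \<Sigma> \<sigma>) (fst A)) (fst A (result (op_type \<Sigma> \<sigma>)))"
  using assms unfolding algebras_def by (auto simp: PiE_def)

text \<open>The joint equalizer is cut out by equality of its two morphisms at each symbol, and
  \<open>ff_condition\<close> rewrites that equality as the homomorphism condition.\<close>

lemma ff_algebra_homs_cut_out:
  assumes \<Gamma>: "free_form_signature \<Gamma>" and A: "A \<in> ff_algebras \<Gamma>" and B: "B \<in> ff_algebras \<Gamma>"
  shows "cuts_out (ff_preserves \<Gamma> A B) (pow_vhom (fst A) (fst B))
    (fst (ff_algebra_homs \<Gamma> A B)) (snd (ff_algebra_homs \<Gamma> A B))"
proof -
  let ?X = "pow_vhom (fst A) (fst B)"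
    and ?F = "\<lambda>\<sigma>. pow_postcomp (ff_inputs (arity \<Gamma> \<sigma>) (param \<Gamma> \<sigma>) (fst A))
             (ff_inputs (arity \<Gamma> \<sigma>) (param \<Gamma> \<sigma>) (fst B)) (fst B) (snd B \<sigma>)
           \<cdot> snd (ff_inputs_vfun (arity \<Gamma> \<sigma>) (param \<Gamma> \<sigma>)) (fst A) (fst B)"
    and ?G = "\<lambda>\<sigma>. pow_precomp (ff_inputs (arity \<Gamma> \<sigma>) (param \<Gamma> \<sigma>) (fst A)) (fst A) (fst B) (snd A \<sigma>)"
  have ob: "fst A \<in> pow_ob" "fst B \<in> pow_ob" using A B by (simp_all add: ff_algebrasD)
  have cond: "?F \<sigma> \<in> Arr V \<and> Dom V (?F \<sigma>) = ?X"
      "?G \<sigma> \<in> Arr V \<and> Dom V (?G \<sigma>) = ?X \<and> Cod V (?G \<sigma>) = Cod V (?F \<sigma>)"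
      "x \<in> el ?X \<Longrightarrow> ?F \<sigma> \<star> x = ?G \<sigma> \<star> x \<longleftrightarrow> (\<forall>s\<in>elts \<S>.
        \<forall>j\<in>el (pow_vhom (arity \<Gamma> \<sigma>) (fst A)). \<forall>p\<in>el (param \<Gamma> \<sigma> s).
          snd B \<sigma> s \<star> kpair (VCmp pow_vcat (arity \<Gamma> \<sigma>) (fst A) (fst B) \<star> kpair x j) p
          = act (fst A) (fst B) s x (snd A \<sigma> s \<star> kpair j p))"
    if "\<sigma> \<in> elts (symbols \<Gamma>)" for \<sigma> x
  proof -
    note c = ff_condition[OF arity_simps(2)[OF ff_signatureD(1)[OF \<Gamma> that]]
        ff_signatureD(2)[OF \<Gamma> that] ob ff_algebrasD(3)[OF A that] ff_algebrasD(3)[OF B that]]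
    show "?F \<sigma> \<in> Arr V \<and> Dom V (?F \<sigma>) = ?X"
      "?G \<sigma> \<in> Arr V \<and> Dom V (?G \<sigma>) = ?X \<and> Cod V (?G \<sigma>) = Cod V (?F \<sigma>)"
      using c(1-6) by (simp_all only:)
    show "x \<in> el ?X \<Longrightarrow> ?F \<sigma> \<star> x = ?G \<sigma> \<star> x \<longleftrightarrow> (\<forall>s\<in>elts \<S>.
        \<forall>j\<in>el (pow_vhom (arity \<Gamma> \<sigma>) (fst A)). \<forall>p\<in>el (param \<Gamma> \<sigma> s).
          snd B \<sigma> s \<star> kpair (VCmp pow_vcat (arity \<Gamma> \<sigma>) (fst A) (fst B) \<star> kpair x j) p
          = act (fst A) (fst B) s x (snd A \<sigma> s \<star> kpair j p))"
      by (rule c(7))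
  qed
  have X: "?X \<in> Ob V" using ob by simp
  show ?thesis
    unfolding ff_algebra_homs_def
  proof (rule cuts_out_cong[OF joint_equalizer_cuts_out[OF X cond(1,2)]])
    fix x assume "x \<in> el ?X"
    then show "(\<forall>\<sigma>\<in>elts (symbols \<Gamma>). ?F \<sigma> \<star> x = ?G \<sigma> \<star> x) \<longleftrightarrow> ff_preserves \<Gamma> A B x"
      unfolding ff_preserves_def using cond(3) by (intro ball_cong refl)
  qed assumption+
qed

lemma signatureD:
  assumes "signature \<Sigma>" "\<sigma> \<in> elts (ops \<Sigma>)" "op_type \<Sigma> \<sigma> = (Ss, s, P)"
  shows "set Ss \<subseteq> elts \<S>" "s \<in> elts \<S>" "P \<in> Ob V"
  using assms unfolding signature_def by force+

lemma algebra_homs_cut_out: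
  assumes \<Sigma>: "signature \<Sigma>" and A: "A \<in> algebras \<Sigma>" and B: "B \<in> algebras \<Sigma>"
  shows "cuts_out (preserves \<Sigma> A B) (pow_vhom (fst A) (fst B))
    (fst (algebra_homs \<Sigma> A B)) (snd (algebra_homs \<Sigma> A B))"
proof -
  let ?X = "pow_vhom (fst A) (fst B)"
    and ?F = "\<lambda>\<sigma>. postcomp (inputs (op_type \<Sigma> \<sigma>) (fst A)) (snd B \<sigma>)
           \<cdot> snd (inputs_vfun (op_type \<Sigma> \<sigma>)) (fst A) (fst B)"
    and ?G = "\<lambda>\<sigma>. precomp (snd A \<sigma>) (fst B (result (op_type \<Sigma> \<sigma>)))
           \<cdot> component (fst A) (fst B) (result (op_type \<Sigma> \<sigma>))"
  have ob: "fst A \<in> pow_ob" "fst B \<in> pow_ob" using A B by (simp_all add: algebrasD)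
  have cond: "?F \<sigma> \<in> Arr V \<and> Dom V (?F \<sigma>) = ?X"
      "?G \<sigma> \<in> Arr V \<and> Dom V (?G \<sigma>) = ?X \<and> Cod V (?G \<sigma>) = Cod V (?F \<sigma>)"
      "x \<in> el ?X \<Longrightarrow> ?F \<sigma> \<star> x = ?G \<sigma> \<star> x \<longleftrightarrow> (case op_type \<Sigma> \<sigma> of (Ss, s, P) \<Rightarrow>
        \<forall>p\<in>el P. \<forall>y\<in>el (fprod Ss (fst A)).
          snd B \<sigma> \<star> kpair p (fprod_act Ss (fst A) (fst B) x y)
          = act (fst A) (fst B) s x (snd A \<sigma> \<star> kpair p y))"
    if \<sigma>: "\<sigma> \<in> elts (ops \<Sigma>)" for \<sigma> x
  proof -
    obtain Ss s P where t: "op_type \<Sigma> \<sigma> = (Ss, s, P)" by (metis prod_cases3)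
    have r: "result (Ss, s, P) = s" by (simp add: result_def)
    note c = alg_condition[OF signatureD[OF \<Sigma> \<sigma> t] ob
      algebrasD(3)[OF A \<sigma>, unfolded t r] algebrasD(3)[OF B \<sigma>, unfolded t r]]
    show "?F \<sigma> \<in> Arr V \<and> Dom V (?F \<sigma>) = ?X"
      "?G \<sigma> \<in> Arr V \<and> Dom V (?G \<sigma>) = ?X \<and> Cod V (?G \<sigma>) = Cod V (?F \<sigma>)"
      using c(1-6) unfolding t r by (simp_all only:)
    show "x \<in> el ?X \<Longrightarrow> ?F \<sigma> \<star> x = ?G \<sigma> \<star> x \<longleftrightarrow> (case op_type \<Sigma> \<sigma> of (Ss, s, P) \<Rightarrow>
        \<forall>p\<in>el P. \<forall>y\<in>el (fprod Ss (fst A)).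
          snd B \<sigma> \<star> kpair p (fprod_act Ss (fst A) (fst B) x y)
          = act (fst A) (fst B) s x (snd A \<sigma> \<star> kpair p y))"
      unfolding t r prod.case by (rule c(7))
  qed
  have X: "?X \<in> Ob V" using ob by simp
  show ?thesis
    unfolding algebra_homs_def
  proof (rule cuts_out_cong[OF joint_equalizer_cuts_out[OF X cond(1,2)]])
    fix x assume "x \<in> el ?X"
    then show "(\<forall>\<sigma>\<in>elts (ops \<Sigma>). ?F \<sigma> \<star> x = ?G \<sigma> \<star> x) \<longleftrightarrow> preserves \<Sigma> A B x"
      unfolding preserves_def using cond(3) by (intro ball_cong refl)
  qed assumption+
qed

lemma ff_structure_in:
  assumes "free_form_signature \<Gamma>" "A \<in> ff_algebras \<Gamma>" "\<sigma> \<in> elts (symbols \<Gamma>)" "s \<in> elts \<S>"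
    "j \<in> el (pow_vhom (arity \<Gamma> \<sigma>) (fst A))" "p \<in> el (param \<Gamma> \<sigma> s)"
  shows "snd A \<sigma> s \<star> kpair j p \<in> el (fst A s)"
  using pow_homD[OF ff_algebrasD(3)[OF assms(2,3)] assms(4)] assms ff_signatureD[OF assms(1,3)]
    ff_algebrasD(1)[OF assms(2)]
  by (intro app_in) (simp_all add: ff_inputs_apply)

lemma structure_in:
  assumes "signature \<Sigma>" "A \<in> algebras \<Sigma>" "\<sigma> \<in> elts (ops \<Sigma>)" "op_type \<Sigma> \<sigma> = (Ss, s, P)"
    "p \<in> el P" "x \<in> el (fprod Ss (fst A))"
  shows "snd A \<sigma> \<star> kpair p x \<in> el (fst A s)"
  using algebrasD(3)[OF assms(2,3)] assms signatureD[OF assms(1,3,4)] algebrasD(1)[OF assms(2)]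
  by (intro app_in) (simp_all add: in_hom inputs_def result_def)

text \<open>Identities and composites are homomorphisms because V^S(J, -) respects them: these are
  the unit and associativity laws of the power, applied to the argument j.\<close>

lemma ff_cut_subcategory:
  assumes \<Gamma>: "free_form_signature \<Gamma>"
  shows "cut_subcategory pow_vcat (ff_algebras \<Gamma>) fst (ff_algebra_homs \<Gamma>) (ff_preserves \<Gamma>)"
  unfolding cut_subcategory_def
proof (intro conjI ballI impI)
  fix A assume A: "A \<in> ff_algebras \<Gamma>"
  note [simp] = ff_algebrasD(1)[OF A] arity_simps(2)[OF ff_signatureD(1)[OF \<Gamma>]]
    vcategory_laws(1)[OF vcategory_pow_vcat] ff_structure_in[OF \<Gamma> A]
  show "ff_preserves \<Gamma> A A (VId pow_vcat (fst A) \<star> pt)"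
    unfolding ff_preserves_def by simp
next
  fix A B D f g assume A: "A \<in> ff_algebras \<Gamma>" and B: "B \<in> ff_algebras \<Gamma>" and D: "D \<in> ff_algebras \<Gamma>"
    and "f \<in> el (VHom pow_vcat (fst A) (fst B))" "g \<in> el (VHom pow_vcat (fst B) (fst D))"
    and p: "ff_preserves \<Gamma> A B f" "ff_preserves \<Gamma> B D g"
  then have [simp]: "f \<in> el (pow_vhom (fst A) (fst B))" "g \<in> el (pow_vhom (fst B) (fst D))" by simp_all
  note [simp] = ff_algebrasD(1)[OF A] ff_algebrasD(1)[OF B] ff_algebrasD(1)[OF D]
    arity_simps(2)[OF ff_signatureD(1)[OF \<Gamma>]]
    vcategory_laws(3)[OF vcategory_pow_vcat] ff_structure_in[OF \<Gamma> A]
  have fp: "snd B \<sigma> s \<star> kpair (VCmp pow_vcat (arity \<Gamma> \<sigma>) (fst A) (fst B) \<star> kpair f j) p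
       = act (fst A) (fst B) s f (snd A \<sigma> s \<star> kpair j p)"
    if "\<sigma> \<in> elts (symbols \<Gamma>)" "s \<in> elts \<S>" "j \<in> el (pow_vhom (arity \<Gamma> \<sigma>) (fst A))"
      "p \<in> el (param \<Gamma> \<sigma> s)" for \<sigma> s j p
    using p(1) that unfolding ff_preserves_def by blast
  have gp: "snd D \<sigma> s \<star> kpair (VCmp pow_vcat (arity \<Gamma> \<sigma>) (fst B) (fst D) \<star> kpair g j) p
       = act (fst B) (fst D) s g (snd B \<sigma> s \<star> kpair j p)"
    if "\<sigma> \<in> elts (symbols \<Gamma>)" "s \<in> elts \<S>" "j \<in> el (pow_vhom (arity \<Gamma> \<sigma>) (fst B))"
      "p \<in> el (param \<Gamma> \<sigma> s)" for \<sigma> s j p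
    using p(2) that unfolding ff_preserves_def by blast
  show "ff_preserves \<Gamma> A D (VCmp pow_vcat (fst A) (fst B) (fst D) \<star> kpair g f)"
    unfolding ff_preserves_def by (simp add: fp gp)
qed (simp_all add: ff_algebra_homs_cut_out[OF \<Gamma>] ff_algebrasD)

text \<open>As for free-form algebras, with functoriality of finite products,
  \<open>fprod_act_id\<close> and \<open>fprod_act_cmp\<close>, in place of the laws of
  composition.\<close>

lemma cut_subcategory_algebras:
  assumes \<Sigma>: "signature \<Sigma>"
  shows "cut_subcategory pow_vcat (algebras \<Sigma>) fst (algebra_homs \<Sigma>) (preserves \<Sigma>)"
  unfolding cut_subcategory_def
proof (intro conjI ballI impI)
  fix A assume A: "A \<in> algebras \<Sigma>"
  note [simp] = algebrasD(1)[OF A] structure_in[OF \<Sigma> A] signatureD[OF \<Sigma>]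
  show "preserves \<Sigma> A A (VId pow_vcat (fst A) \<star> pt)"
    unfolding preserves_def by (auto simp: fprod_act_id)
next
  fix A B D f g assume A: "A \<in> algebras \<Sigma>" and B: "B \<in> algebras \<Sigma>" and D: "D \<in> algebras \<Sigma>"
    and "f \<in> el (VHom pow_vcat (fst A) (fst B))" "g \<in> el (VHom pow_vcat (fst B) (fst D))"
    and p: "preserves \<Sigma> A B f" "preserves \<Sigma> B D g"
  then have [simp]: "f \<in> el (pow_vhom (fst A) (fst B))" "g \<in> el (pow_vhom (fst B) (fst D))" by simp_all
  note [simp] = algebrasD(1)[OF A] algebrasD(1)[OF B] algebrasD(1)[OF D]
  have "snd D \<sigma> \<star> kpair p (fprod_act Ss (fst A) (fst D) (VCmp pow_vcat (fst A) (fst B) (fst D) \<star> kpair g f) x)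
      = act (fst A) (fst D) s (VCmp pow_vcat (fst A) (fst B) (fst D) \<star> kpair g f) (snd A \<sigma> \<star> kpair p x)"
    if \<sigma>: "\<sigma> \<in> elts (ops \<Sigma>)" and t: "op_type \<Sigma> \<sigma> = (Ss, s, P)"
      and px: "p \<in> el P" "x \<in> el (fprod Ss (fst A))" for \<sigma> Ss s P p x
  proof -
    note [simp] = signatureD[OF \<Sigma> \<sigma> t] structure_in[OF \<Sigma> A \<sigma> t px] px
    have "snd B \<sigma> \<star> kpair p (fprod_act Ss (fst A) (fst B) f x) = act (fst A) (fst B) s f (snd A \<sigma> \<star> kpair p x)"
      using bspec[OF p(1)[unfolded preserves_def] \<sigma>] t px by simp
    moreover have "snd D \<sigma> \<star> kpair p (fprod_act Ss (fst B) (fst D) g y) = act (fst B) (fst D) s g (snd B \<sigma> \<star> kpair p y)"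
      if "y \<in> el (fprod Ss (fst B))" for y
      using bspec[OF p(2)[unfolded preserves_def] \<sigma>] t px that by simp
    ultimately show ?thesis by (simp add: fprod_act_cmp)
  qed
  then show "preserves \<Sigma> A D (VCmp pow_vcat (fst A) (fst B) (fst D) \<star> kpair g f)"
    unfolding preserves_def by (auto split: prod.split)
qed (simp_all add: algebra_homs_cut_out[OF \<Sigma>] algebrasD)

end

section \<open>Translating free-form signatures\<close>

context sorted_topological
begin

text \<open>The operation symbols of a signature form a set of the universe, so pairs of a symbol
  and a sort are coded as Kuratowski pairs.\<close>

definition sorted_signature :: "('u, 'o) free_form_signature \<Rightarrow> ('u, 'o) signature" where
  "sorted_signature \<Gamma> = \<lparr> ops = cartesian (symbols \<Gamma>) \<S>,
     op_type = (\<lambda>q. op_of (arity \<Gamma> (kfst q)) (param \<Gamma> (kfst q)) (ksnd q)) \<rparr>"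

definition to_sorted :: "('u, 'o) free_form_signature \<Rightarrow> ('u, 'o, 'm) ff_algebra \<Rightarrow>
    ('u, 'o, 'm) algebra" where
  "to_sorted \<Gamma> A = (fst A, \<lambda>q\<in>elts (cartesian (symbols \<Gamma>) \<S>).
     snd A (kfst q) (ksnd q) \<cdot> inputs_iso (arity \<Gamma> (kfst q)) (param \<Gamma> (kfst q)) (ksnd q) (fst A))"

definition of_sorted :: "('u, 'o) free_form_signature \<Rightarrow> ('u, 'o, 'm) algebra \<Rightarrow>
    ('u, 'o, 'm) ff_algebra" where
  "of_sorted \<Gamma> A = (fst A, \<lambda>\<sigma>\<in>elts (symbols \<Gamma>). \<lambda>s\<in>elts \<S>.
     snd A (kpair \<sigma> s) \<cdot> inputs_iso_inv (arity \<Gamma> \<sigma>) (param \<Gamma> \<sigma>) s (fst A))"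

text \<open>A natural operation is defined on free-form algebras only, hence the detour through
  \<open>of_sorted\<close>. The restriction to algebras makes the family extensional, as algebraic
  operations have to be.\<close>

definition sorted_operation :: "('u, 'o) free_form_signature \<Rightarrow> ('u \<Rightarrow> 'o) \<Rightarrow> ('u \<Rightarrow> 'o) \<Rightarrow> 'u \<Rightarrow>
    (('u, 'o, 'm) ff_algebra \<Rightarrow> 'u \<Rightarrow> 'm) \<Rightarrow> ('u, 'o, 'm) algebra \<Rightarrow> 'm" where
  "sorted_operation \<Gamma> J P s \<omega> = (\<lambda>A\<in>algebras (sorted_signature \<Gamma>).
     \<omega> (of_sorted \<Gamma> A) s \<cdot> inputs_iso J P s (fst A))"

definition sorted_equation :: "('u, 'o) free_form_signature \<Rightarrow> ('u, 'o, 'm) diagrammatic_equation \<Rightarrow>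
    'u \<Rightarrow> ('u, 'o, 'm) algebraic_equation" where
  "sorted_equation \<Gamma> e s = (case e of (J, P, \<omega>, \<nu>) \<Rightarrow>
     (op_of J P s, sorted_operation \<Gamma> J P s \<omega>, sorted_operation \<Gamma> J P s \<nu>))"

definition sorted_comparison :: "('u, 'o) free_form_signature \<Rightarrow>
    (('u, 'o, 'm) ff_algebra, ('u, 'o, 'm) algebra, 'm) vfun" where
  "sorted_comparison \<Gamma>
    = comparison (ff_algebra_homs \<Gamma>) (algebra_homs (sorted_signature \<Gamma>)) (to_sorted \<Gamma>)"

lemma sorted_signature_simps [simp]:
  "ops (sorted_signature \<Gamma>) = cartesian (symbols \<Gamma>) \<S>"
  "op_type (sorted_signature \<Gamma>) (kpair \<sigma> s) = op_of (arity \<Gamma> \<sigma>) (param \<Gamma> \<sigma>) s"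
  by (simp_all add: sorted_signature_def)

lemma fst_to_sorted [simp]: "fst (to_sorted \<Gamma> A) = fst A"
  by (simp add: to_sorted_def)

lemma snd_to_sorted [simp]:
  "\<sigma> \<in> elts (symbols \<Gamma>) \<Longrightarrow> s \<in> elts \<S> \<Longrightarrow> snd (to_sorted \<Gamma> A) (kpair \<sigma> s)
    = snd A \<sigma> s \<cdot> inputs_iso (arity \<Gamma> \<sigma>) (param \<Gamma> \<sigma>) s (fst A)"
  by (simp add: to_sorted_def)

lemma fst_of_sorted [simp]: "fst (of_sorted \<Gamma> A) = fst A"
  by (simp add: of_sorted_def)

lemma snd_of_sorted [simp]:
  "\<sigma> \<in> elts (symbols \<Gamma>) \<Longrightarrow> s \<in> elts \<S> \<Longrightarrow> snd (of_sorted \<Gamma> A) \<sigma> s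
    = snd A (kpair \<sigma> s) \<cdot> inputs_iso_inv (arity \<Gamma> \<sigma>) (param \<Gamma> \<sigma>) s (fst A)"
  by (simp add: of_sorted_def)

context
  fixes \<Gamma> :: "('u, 'o) free_form_signature"
  assumes \<Gamma>: "free_form_signature \<Gamma>"
begin

lemmas symbol_typing [simp] = ff_signatureD[OF \<Gamma>]

lemma ff_structure:
  assumes "A \<in> ff_algebras \<Gamma>" "\<sigma> \<in> elts (symbols \<Gamma>)" "s \<in> elts \<S>"
  shows "snd A \<sigma> s \<in> hom (ff_inputs (arity \<Gamma> \<sigma>) (param \<Gamma> \<sigma>) (fst A) s) (fst A s)"
  using pow_homD[OF ff_algebrasD(3)[OF assms(1,2)] assms(3)] by (simp add: in_hom)

lemma sorted_structure:
  assumes "A \<in> algebras (sorted_signature \<Gamma>)" "\<sigma> \<in> elts (symbols \<Gamma>)" "s \<in> elts \<S>"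
  shows "snd A (kpair \<sigma> s) \<in> hom (inputs (op_of (arity \<Gamma> \<sigma>) (param \<Gamma> \<sigma>) s) (fst A)) (fst A s)"
  using algebrasD(3)[OF assms(1), of "kpair \<sigma> s"] assms(2,3) by simp

lemma signature_sorted: "signature (sorted_signature \<Gamma>)"
  unfolding signature_def by (simp add: ball_cartesian op_of_def)

lemma to_sorted_in:
  assumes A: "A \<in> ff_algebras \<Gamma>" shows "to_sorted \<Gamma> A \<in> algebras (sorted_signature \<Gamma>)"
proof -
  note [simp] = ff_algebrasD(1)[OF A]
  have "snd (to_sorted \<Gamma> A) q \<in> hom (inputs (op_type (sorted_signature \<Gamma>) q) (fst A))
      (fst A (result (op_type (sorted_signature \<Gamma>) q)))"
    if "q \<in> elts (cartesian (symbols \<Gamma>) \<S>)" for q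
    using that
  proof (rule elts_cartesianE)
    fix \<sigma> s assume q: "q = kpair \<sigma> s" and [simp]: "\<sigma> \<in> elts (symbols \<Gamma>)" "s \<in> elts \<S>"
    then show ?thesis using ff_structure[OF A, of \<sigma> s] by (simp add: in_hom)
  qed
  moreover have "snd (to_sorted \<Gamma> A) \<in> extensional (elts (cartesian (symbols \<Gamma>) \<S>))"
    by (simp add: to_sorted_def)
  ultimately show ?thesis
    unfolding algebras_def by (auto simp: PiE_def split_beta)
qed

lemma of_sorted_in:
  assumes A: "A \<in> algebras (sorted_signature \<Gamma>)" shows "of_sorted \<Gamma> A \<in> ff_algebras \<Gamma>"
proof -
  note [simp] = algebrasD(1)[OF A]
  have "snd (of_sorted \<Gamma> A) \<sigma> s \<in> hom (ff_inputs (arity \<Gamma> \<sigma>) (param \<Gamma> \<sigma>) (fst A) s) (fst A s)"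
    if "\<sigma> \<in> elts (symbols \<Gamma>)" "s \<in> elts \<S>" for \<sigma> s
    using sorted_structure[OF A that] that by (simp add: in_hom)
  moreover have "snd (of_sorted \<Gamma> A) \<in> extensional (elts (symbols \<Gamma>))"
    "\<And>\<sigma>. \<sigma> \<in> elts (symbols \<Gamma>) \<Longrightarrow> snd (of_sorted \<Gamma> A) \<sigma> \<in> extensional (elts \<S>)"
    by (simp_all add: of_sorted_def)
  ultimately show ?thesis
    unfolding ff_algebras_def pow_hom_def by (auto simp: PiE_def split_beta)
qed

text \<open>On symbols and sorts \<open>inputs_iso\<close> cancels against its inverse. Elsewhere
  the values agree because both structures are extensional, in the symbol and then in the
  sort.\<close>

lemma of_to_sorted:
  assumes A: "A \<in> ff_algebras \<Gamma>" shows "of_sorted \<Gamma> (to_sorted \<Gamma> A) = A"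
proof (rule prod_eqI)
  note [simp] = ff_algebrasD(1)[OF A]
  show "snd (of_sorted \<Gamma> (to_sorted \<Gamma> A)) = snd A"
  proof (rule extensionalityI[of _ "elts (symbols \<Gamma>)"])
    fix \<sigma> assume \<sigma>: "\<sigma> \<in> elts (symbols \<Gamma>)"
    show "snd (of_sorted \<Gamma> (to_sorted \<Gamma> A)) \<sigma> = snd A \<sigma>"
    proof (rule extensionalityI[of _ "elts \<S>"])
      show "snd (of_sorted \<Gamma> (to_sorted \<Gamma> A)) \<sigma> \<in> extensional (elts \<S>)"
        using \<sigma> by (simp add: of_sorted_def)
      show "snd A \<sigma> \<in> extensional (elts \<S>)"
        using ff_algebrasD(3)[OF A \<sigma>] unfolding pow_hom_def by (simp add: PiE_def)
      fix s assume s: "s \<in> elts \<S>"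
      show "snd (of_sorted \<Gamma> (to_sorted \<Gamma> A)) \<sigma> s = snd A \<sigma> s"
        using \<sigma> s inputs_iso_cancel[OF _ _ _ _ ff_structure[OF A \<sigma> s]] by simp
    qed
  qed (use ff_algebrasD(2)[OF A] in \<open>simp_all add: of_sorted_def\<close>)
qed simp

lemma to_of_sorted:
  assumes A: "A \<in> algebras (sorted_signature \<Gamma>)" shows "to_sorted \<Gamma> (of_sorted \<Gamma> A) = A"
proof (rule prod_eqI)
  note [simp] = algebrasD(1)[OF A]
  show "snd (to_sorted \<Gamma> (of_sorted \<Gamma> A)) = snd A"
  proof (rule extensionalityI[of _ "elts (cartesian (symbols \<Gamma>) \<S>)"])
    fix q assume "q \<in> elts (cartesian (symbols \<Gamma>) \<S>)"
    then show "snd (to_sorted \<Gamma> (of_sorted \<Gamma> A)) q = snd A q"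
    proof (rule elts_cartesianE)
      fix \<sigma> s assume q: "q = kpair \<sigma> s" and \<sigma>: "\<sigma> \<in> elts (symbols \<Gamma>)" and s: "s \<in> elts \<S>"
      show "snd (to_sorted \<Gamma> (of_sorted \<Gamma> A)) q = snd A q"
        using q \<sigma> s inputs_iso_inv_cancel[OF _ _ _ _ sorted_structure[OF A \<sigma> s]] by simp
    qed
  qed (use algebrasD(2)[OF A] in \<open>simp_all add: to_sorted_def\<close>)
qed simp

lemma bij_to_sorted: "bij_betw (to_sorted \<Gamma>) (ff_algebras \<Gamma>) (algebras (sorted_signature \<Gamma>))"
  by (rule bij_betwI[where g = "of_sorted \<Gamma>"])
    (auto simp: to_sorted_in of_sorted_in of_to_sorted to_of_sorted)

text \<open>One condition quantifies over j in V^S(J, A), the other over x in the finite product.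
  \<open>arity_iso\<close> is a bijection between these ranges and is compatible with the action of
  h.\<close>

lemma preserves_to_sorted:
  assumes A: "A \<in> ff_algebras \<Gamma>" and B: "B \<in> ff_algebras \<Gamma>"
    and h [simp]: "h \<in> el (pow_vhom (fst A) (fst B))"
  shows "ff_preserves \<Gamma> A B h \<longleftrightarrow>
    preserves (sorted_signature \<Gamma>) (to_sorted \<Gamma> A) (to_sorted \<Gamma> B) h"
proof -
  note [simp] = ff_algebrasD(1)[OF A] ff_algebrasD(1)[OF B]
  have "(\<forall>j\<in>el (pow_vhom (arity \<Gamma> \<sigma>) (fst A)). \<forall>p\<in>el (param \<Gamma> \<sigma> s).
       snd B \<sigma> s \<star> kpair (VCmp pow_vcat (arity \<Gamma> \<sigma>) (fst A) (fst B) \<star> kpair h j) p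
       = act (fst A) (fst B) s h (snd A \<sigma> s \<star> kpair j p))
     \<longleftrightarrow> (\<forall>p\<in>el (param \<Gamma> \<sigma> s). \<forall>x\<in>el (fprod (arity_sorts (arity \<Gamma> \<sigma>)) (fst A)).
       snd (to_sorted \<Gamma> B) (kpair \<sigma> s)
         \<star> kpair p (fprod_act (arity_sorts (arity \<Gamma> \<sigma>)) (fst A) (fst B) h x)
       = act (fst A) (fst B) s h (snd (to_sorted \<Gamma> A) (kpair \<sigma> s) \<star> kpair p x))"
    (is "?L \<longleftrightarrow> ?R") if \<sigma>: "\<sigma> \<in> elts (symbols \<Gamma>)" and s: "s \<in> elts \<S>" for \<sigma> s
  proof -
    let ?J = "arity \<Gamma> \<sigma>" and ?P = "param \<Gamma> \<sigma>"
    note [simp] = \<sigma> s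
    have [simp]: "snd A \<sigma> s \<in> Arr V" "Dom V (snd A \<sigma> s) = ff_inputs ?J ?P (fst A) s"
      "snd B \<sigma> s \<in> Arr V" "Dom V (snd B \<sigma> s) = ff_inputs ?J ?P (fst B) s"
      using ff_structure[OF A \<sigma> s] ff_structure[OF B \<sigma> s] by (auto simp: in_hom)
    have a: "snd (to_sorted \<Gamma> A) (kpair \<sigma> s) \<star> kpair p x
        = snd A \<sigma> s \<star> kpair (arity_iso ?J (fst A) \<star> x) p"
      if "p \<in> el (?P s)" "x \<in> el (fprod (arity_sorts ?J) (fst A))" for p x
      using that by (simp add: inputs_op_of)
    have b: "snd (to_sorted \<Gamma> B) (kpair \<sigma> s) \<star> kpair p (fprod_act (arity_sorts ?J) (fst A) (fst B) h x)
        = snd B \<sigma> s \<star> kpair (VCmp pow_vcat ?J (fst A) (fst B) \<star> kpair h (arity_iso ?J (fst A) \<star> x)) p"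
      if "p \<in> el (?P s)" "x \<in> el (fprod (arity_sorts ?J) (fst A))" for p x
      using that by (simp add: inputs_op_of arity_iso_fprod_act)
    show ?thesis
    proof
      assume L: ?L
      show ?R
      proof (intro ballI)
        fix p x assume px: "p \<in> el (?P s)" "x \<in> el (fprod (arity_sorts ?J) (fst A))"
        have "arity_iso ?J (fst A) \<star> x \<in> el (pow_vhom ?J (fst A))" using px by simp
        with L px show "snd (to_sorted \<Gamma> B) (kpair \<sigma> s)
            \<star> kpair p (fprod_act (arity_sorts ?J) (fst A) (fst B) h x)
          = act (fst A) (fst B) s h (snd (to_sorted \<Gamma> A) (kpair \<sigma> s) \<star> kpair p x)"
          unfolding a[OF px] b[OF px] by blast
      qed
    next
      assume R: ?R
      show ?L
      proof (intro ballI)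
        fix j p assume jp: "j \<in> el (pow_vhom ?J (fst A))" "p \<in> el (?P s)"
        \<comment> \<open>The argument tuple that corresponds to j; instantiating the sorted
          condition with it returns j itself.\<close>
        let ?x = "arity_iso_inv ?J (fst A) \<star> j"
        have x: "?x \<in> el (fprod (arity_sorts ?J) (fst A))" and j: "arity_iso ?J (fst A) \<star> ?x = j"
          using jp by simp_all
        from bspec[OF bspec[OF R jp(2)] x]
        show "snd B \<sigma> s \<star> kpair (VCmp pow_vcat ?J (fst A) (fst B) \<star> kpair h j) p
            = act (fst A) (fst B) s h (snd A \<sigma> s \<star> kpair j p)"
          unfolding a[OF jp(2) x] b[OF jp(2) x] j .
      qed
    qed
  qed
  then show ?thesis
    unfolding ff_preserves_def preserves_def
    \<comment> \<open>The translated structures stay folded so that the goal matches the equivalence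
      just proved for each symbol and sort.\<close>
    by (simp add: ball_cartesian op_of_def del: snd_to_sorted)
qed

text \<open>Naturality of a natural operation is available along free-form homomorphisms, so a
  sorted homomorphism must be recognized as one. The two squares differ by
  \<open>inputs_iso\<close>, which is natural and can be cancelled on the right.\<close>

lemma algebra_hom_of_sorted:
  assumes A: "A \<in> algebras (sorted_signature \<Gamma>)" and B: "B \<in> algebras (sorted_signature \<Gamma>)"
    and f: "f \<in> algebra_hom (sorted_signature \<Gamma>) A B"
  shows "f \<in> ff_algebra_hom \<Gamma> (of_sorted \<Gamma> A) (of_sorted \<Gamma> B)"
proof -
  note [simp] = algebrasD(1)[OF A] algebrasD(1)[OF B]
  have fp [simp]: "f \<in> pow_hom (fst A) (fst B)" using f unfolding algebra_hom_def by simp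
  note [simp] = pow_homD[OF fp]
  have "f s \<cdot> snd (of_sorted \<Gamma> A) \<sigma> s
      = snd (of_sorted \<Gamma> B) \<sigma> s \<cdot> ff_inputs_arrow (arity \<Gamma> \<sigma>) (param \<Gamma> \<sigma>) (fst A) (fst B) f s"
    if \<sigma>: "\<sigma> \<in> elts (symbols \<Gamma>)" and s: "s \<in> elts \<S>" for \<sigma> s
  proof -
    let ?J = "arity \<Gamma> \<sigma>" and ?P = "param \<Gamma> \<sigma>"
    note [simp] = \<sigma> s
    let ?a = "snd (of_sorted \<Gamma> A) \<sigma> s" and ?b = "snd (of_sorted \<Gamma> B) \<sigma> s"
      and ?F = "ff_inputs_arrow ?J ?P (fst A) (fst B) f s"
    have a: "?a \<in> hom (ff_inputs ?J ?P (fst A) s) (fst A s)"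
      and b: "?b \<in> hom (ff_inputs ?J ?P (fst B) s) (fst B s)"
      using ff_structure[OF of_sorted_in[OF A] \<sigma> s] ff_structure[OF of_sorted_in[OF B] \<sigma> s] by simp_all
    have F: "?F \<in> hom (ff_inputs ?J ?P (fst A) s) (ff_inputs ?J ?P (fst B) s)"
      by (simp add: in_hom ff_inputs_arrow_def ff_inputs_apply)
    have fs: "f s \<in> hom (fst A s) (fst B s)" by (simp add: in_hom)
    have iA: "inputs_iso ?J ?P s (fst A) \<in> hom (inputs (op_of ?J ?P s) (fst A)) (ff_inputs ?J ?P (fst A) s)"
      and iB: "inputs_iso ?J ?P s (fst B) \<in> hom (inputs (op_of ?J ?P s) (fst B)) (ff_inputs ?J ?P (fst B) s)"
      by (simp_all add: in_hom)
    have ia: "inputs_arrow (op_of ?J ?P s) (fst A) (fst B) f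
        \<in> hom (inputs (op_of ?J ?P s) (fst A)) (inputs (op_of ?J ?P s) (fst B))"
      by (simp add: in_hom inputs_op_of inputs_arrow_op_of)
    \<comment> \<open>A sorted algebra is the translation of its own image under
      \<open>of_sorted\<close>, so its structure morphisms factor through
      \<open>inputs_iso\<close>.\<close>
    have sA: "snd A (kpair \<sigma> s) = ?a \<cdot> inputs_iso ?J ?P s (fst A)"
      and sB: "snd B (kpair \<sigma> s) = ?b \<cdot> inputs_iso ?J ?P s (fst B)"
      using snd_to_sorted[of \<sigma> \<Gamma> s "of_sorted \<Gamma> A"] snd_to_sorted[of \<sigma> \<Gamma> s "of_sorted \<Gamma> B"]
      by (simp_all only: to_of_sorted[OF A] to_of_sorted[OF B] fst_of_sorted \<sigma> s)
    have "f s \<cdot> ?a \<cdot> inputs_iso ?J ?P s (fst A) = f s \<cdot> snd A (kpair \<sigma> s)"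
      unfolding sA by (rule cmp_assoc[OF iA a fs])
    also have "\<dots> = snd B (kpair \<sigma> s) \<cdot> inputs_arrow (op_of ?J ?P s) (fst A) (fst B) f"
      using f unfolding algebra_hom_def by (auto dest!: bspec[of _ _ "kpair \<sigma> s"])
    also have "\<dots> = ?b \<cdot> (inputs_iso ?J ?P s (fst B) \<cdot> inputs_arrow (op_of ?J ?P s) (fst A) (fst B) f)"
      unfolding sB by (rule cmp_assoc[OF ia iB b])
    also have "\<dots> = ?b \<cdot> (?F \<cdot> inputs_iso ?J ?P s (fst A))"
      by (simp add: inputs_iso_natural)
    also have "\<dots> = ?b \<cdot> ?F \<cdot> inputs_iso ?J ?P s (fst A)"
      by (rule cmp_assoc[OF iA F b, symmetric])
    finally show ?thesis
      using inputs_iso_cancel_iff[OF _ _ _ _ cmp_hom[OF a fs] cmp_hom[OF F b]] by simp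
  qed
  then show ?thesis
    unfolding ff_algebra_hom_def pow_cmp_def by (auto intro!: restrict_ext)
qed

text \<open>The translated operation pastes two natural squares: that of \<open>inputs_iso\<close>,
  and that of \<omega> at the sort \<open>s\<close>.\<close>

lemma algebraic_sorted_operation:
  assumes \<omega>: "natural_operation \<Gamma> J P \<omega>" and s [simp]: "s \<in> elts \<S>"
  shows "algebraic_operation (sorted_signature \<Gamma>) (op_of J P s) (sorted_operation \<Gamma> J P s \<omega>)"
proof -
  have [simp]: "J \<in> arity_objects" "P \<in> pow_ob" using \<omega> unfolding natural_operation_def by auto
  have \<omega>s: "\<omega> (of_sorted \<Gamma> A) s \<in> hom (ff_inputs J P (fst A) s) (fst A s)"
    if A: "A \<in> algebras (sorted_signature \<Gamma>)" for A
  proof -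
    have "\<omega> (of_sorted \<Gamma> A) \<in> pow_hom (ff_inputs J P (fst A)) (fst A)"
      using \<omega> of_sorted_in[OF A] unfolding natural_operation_def by (auto dest!: PiE_mem)
    from pow_homD[OF this s] show ?thesis by (simp add: in_hom)
  qed
  have natural: "f s \<cdot> (\<omega> (of_sorted \<Gamma> A) s \<cdot> inputs_iso J P s (fst A))
      = \<omega> (of_sorted \<Gamma> B) s \<cdot> inputs_iso J P s (fst B) \<cdot> inputs_arrow (op_of J P s) (fst A) (fst B) f"
    if A: "A \<in> algebras (sorted_signature \<Gamma>)" and B: "B \<in> algebras (sorted_signature \<Gamma>)"
      and f: "f \<in> algebra_hom (sorted_signature \<Gamma>) A B" for A B f
  proof -
    note [simp] = algebrasD(1)[OF A] algebrasD(1)[OF B]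
    have fp [simp]: "f \<in> pow_hom (fst A) (fst B)" using f unfolding algebra_hom_def by simp
    have fs: "f s \<in> hom (fst A s) (fst B s)" using pow_homD[OF fp s] by (simp add: in_hom)
    let ?F = "ff_inputs_arrow J P (fst A) (fst B) f s"
    have F: "?F \<in> hom (ff_inputs J P (fst A) s) (ff_inputs J P (fst B) s)"
      by (simp add: in_hom ff_inputs_arrow_def ff_inputs_apply)
    have iA: "inputs_iso J P s (fst A) \<in> hom (inputs (op_of J P s) (fst A)) (ff_inputs J P (fst A) s)"
      and iB: "inputs_iso J P s (fst B) \<in> hom (inputs (op_of J P s) (fst B)) (ff_inputs J P (fst B) s)"
      by (simp_all add: in_hom)
    have ia: "inputs_arrow (op_of J P s) (fst A) (fst B) f
        \<in> hom (inputs (op_of J P s) (fst A)) (inputs (op_of J P s) (fst B))"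
      by (simp add: in_hom inputs_op_of inputs_arrow_op_of)
    have "pow_cmp f (\<omega> (of_sorted \<Gamma> A))
        = pow_cmp (\<omega> (of_sorted \<Gamma> B)) (ff_inputs_arrow J P (fst A) (fst B) f)"
      using \<omega> of_sorted_in[OF A] of_sorted_in[OF B] algebra_hom_of_sorted[OF A B f]
      unfolding natural_operation_def by simp
    from fun_cong[OF this, of s]
    have nat: "f s \<cdot> \<omega> (of_sorted \<Gamma> A) s = \<omega> (of_sorted \<Gamma> B) s \<cdot> ?F" by (simp add: pow_cmp_def)
    have "f s \<cdot> (\<omega> (of_sorted \<Gamma> A) s \<cdot> inputs_iso J P s (fst A))
        = f s \<cdot> \<omega> (of_sorted \<Gamma> A) s \<cdot> inputs_iso J P s (fst A)"
      by (rule cmp_assoc[OF iA \<omega>s[OF A] fs, symmetric])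
    also have "\<dots> = \<omega> (of_sorted \<Gamma> B) s \<cdot> (?F \<cdot> inputs_iso J P s (fst A))"
      unfolding nat by (rule cmp_assoc[OF iA F \<omega>s[OF B]])
    also have "\<dots> = \<omega> (of_sorted \<Gamma> B) s
        \<cdot> (inputs_iso J P s (fst B) \<cdot> inputs_arrow (op_of J P s) (fst A) (fst B) f)"
      by (simp add: inputs_iso_natural)
    also have "\<dots> = \<omega> (of_sorted \<Gamma> B) s \<cdot> inputs_iso J P s (fst B)
        \<cdot> inputs_arrow (op_of J P s) (fst A) (fst B) f"
      by (rule cmp_assoc[OF ia iB \<omega>s[OF B], symmetric])
    finally show ?thesis .
  qed
  have typed: "\<omega> (of_sorted \<Gamma> A) s \<cdot> inputs_iso J P s (fst A) \<in> hom (inputs (op_of J P s) (fst A)) (fst A s)"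
    if A: "A \<in> algebras (sorted_signature \<Gamma>)" for A
    using \<omega>s[OF A] algebrasD(1)[OF A] by (simp add: in_hom)
  show ?thesis
    unfolding algebraic_operation_def
  proof (intro conjI ballI)
    show "case op_of J P s of (Ss, S, P) \<Rightarrow> set Ss \<subseteq> elts \<S> \<and> S \<in> elts \<S> \<and> P \<in> Ob V"
      by (simp add: op_of_def)
  qed (simp_all add: sorted_operation_def typed natural)
qed

text \<open>At each sort the equation is precomposed with the isomorphism \<open>inputs_iso\<close>,
  which cancels; the components at all sorts together determine the extensional families \<omega> A
  and \<nu> A.\<close>

lemma satisfies_sorted_equation:
  assumes A: "A \<in> ff_algebras \<Gamma>" and e: "diagrammatic_equation \<Gamma> e"
  shows "ff_satisfies A e \<longleftrightarrow> (\<forall>s\<in>elts \<S>. satisfies (to_sorted \<Gamma> A) (sorted_equation \<Gamma> e s))"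
proof -
  obtain J P \<omega> \<nu> where e': "e = (J, P, \<omega>, \<nu>)" by (metis prod_cases4)
  have \<omega>: "natural_operation \<Gamma> J P \<omega>" and \<nu>: "natural_operation \<Gamma> J P \<nu>"
    using e unfolding diagrammatic_equation_def e' by auto
  have [simp]: "J \<in> arity_objects" "P \<in> pow_ob" using \<omega> unfolding natural_operation_def by auto
  note [simp] = ff_algebrasD(1)[OF A]
  have p: "\<omega> A \<in> pow_hom (ff_inputs J P (fst A)) (fst A)" "\<nu> A \<in> pow_hom (ff_inputs J P (fst A)) (fst A)"
    using \<omega> \<nu> A unfolding natural_operation_def by (auto dest!: PiE_mem)
  have "satisfies (to_sorted \<Gamma> A) (sorted_equation \<Gamma> e s) \<longleftrightarrow> \<omega> A s = \<nu> A s"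
    if s [simp]: "s \<in> elts \<S>" for s
  proof -
    have h: "\<omega> A s \<in> hom (ff_inputs J P (fst A) s) (fst A s)" "\<nu> A s \<in> hom (ff_inputs J P (fst A) s) (fst A s)"
      using pow_homD[OF p(1) s] pow_homD[OF p(2) s] by (simp_all add: in_hom)
    have "satisfies (to_sorted \<Gamma> A) (sorted_equation \<Gamma> e s)
        \<longleftrightarrow> \<omega> A s \<cdot> inputs_iso J P s (fst A) = \<nu> A s \<cdot> inputs_iso J P s (fst A)"
      by (simp add: satisfies_def sorted_equation_def e' sorted_operation_def to_sorted_in[OF A]
          of_to_sorted[OF A])
    also have "\<dots> \<longleftrightarrow> \<omega> A s = \<nu> A s" by (rule inputs_iso_cancel_iff[OF _ _ _ _ h]) simp_all
    finally show ?thesis .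
  qed
  moreover have "ff_satisfies A e \<longleftrightarrow> (\<forall>s\<in>elts \<S>. \<omega> A s = \<nu> A s)"
    using p unfolding ff_satisfies_def e' pow_hom_def by (auto intro: PiE_ext)
  ultimately show ?thesis by simp
qed

lemma algebraic_sorted_equation:
  assumes "diagrammatic_equation \<Gamma> e" "s \<in> elts \<S>"
  shows "algebraic_equation (sorted_signature \<Gamma>) (sorted_equation \<Gamma> e s)"
  using assms algebraic_sorted_operation
  by (cases e) (simp add: diagrammatic_equation_def algebraic_equation_def sorted_equation_def)

text \<open>Stated for any set Z of algebras: all algebras give the isomorphism for signatures, the
  models of a set of equations give the one for presentations.\<close>

lemma slice_iso_sorted:
  assumes Z: "Z \<subseteq> ff_algebras \<Gamma>"
  shows "slice_iso pow_vcat (full_sub (ff_Alg \<Gamma>) Z)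
    (full_sub (Alg (sorted_signature \<Gamma>)) (to_sorted \<Gamma> ` Z)) (sorted_comparison \<Gamma>)"
proof -
  have Z': "to_sorted \<Gamma> ` Z \<subseteq> algebras (sorted_signature \<Gamma>)" using Z to_sorted_in by auto
  show ?thesis
    unfolding ff_Alg_def Alg_def full_sub_sub_homs sorted_comparison_def
  proof (rule slice_iso_comparison)
    show "cut_subcategory pow_vcat Z fst (ff_algebra_homs \<Gamma>) (ff_preserves \<Gamma>)"
      by (rule cut_subcategory_subset[OF ff_cut_subcategory[OF \<Gamma>] Z])
    show "cut_subcategory pow_vcat (to_sorted \<Gamma> ` Z) fst (algebra_homs (sorted_signature \<Gamma>))
        (preserves (sorted_signature \<Gamma>))"
      by (rule cut_subcategory_subset[OF cut_subcategory_algebras[OF signature_sorted] Z'])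
    show "bij_betw (to_sorted \<Gamma>) Z (to_sorted \<Gamma> ` Z)"
      using bij_betw_subset[OF bij_to_sorted Z] by simp
    show "fst (to_sorted \<Gamma> A) = fst A" for A by simp
    show "ff_preserves \<Gamma> A B h \<longleftrightarrow> preserves (sorted_signature \<Gamma>) (to_sorted \<Gamma> A) (to_sorted \<Gamma> B) h"
      if "A \<in> Z" "B \<in> Z" "h \<in> el (VHom pow_vcat (fst A) (fst B))" for A B h
      using preserves_to_sorted[OF subsetD[OF Z that(1)] subsetD[OF Z that(2)]] that(3) by simp
  qed
qed

lemma slice_iso_sorted_signature:
  "slice_iso pow_vcat (ff_Alg \<Gamma>) (Alg (sorted_signature \<Gamma>)) (sorted_comparison \<Gamma>)"
proof -
  have "full_sub (ff_Alg \<Gamma>) (ff_algebras \<Gamma>) = ff_Alg \<Gamma>"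
    "full_sub (Alg (sorted_signature \<Gamma>)) (to_sorted \<Gamma> ` ff_algebras \<Gamma>) = Alg (sorted_signature \<Gamma>)"
    by (simp_all add: ff_Alg_def Alg_def full_sub_sub_homs bij_betw_imp_surj_on[OF bij_to_sorted])
  then show ?thesis using slice_iso_sorted[OF subset_refl] by simp
qed

end

definition sorted_theory ::
    "('u, 'o) free_form_signature \<times> ('u, 'o, 'm) diagrammatic_equation set \<Rightarrow>
     ('u, 'o) signature \<times> ('u, 'o, 'm) algebraic_equation set" where
  "sorted_theory T = (sorted_signature (fst T),
     \<Union>e\<in>snd T. sorted_equation (fst T) e ` elts \<S>)"

text \<open>The equations remain a small set, being a union over small sets of equations and
  sorts.\<close>

lemma equational_sorted_theory:
  assumes "diagrammatic_presentation T" shows "equational_theory (sorted_theory T)"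
  using assms signature_sorted algebraic_sorted_equation
  unfolding diagrammatic_presentation_def equational_theory_def sorted_theory_def
  by (auto intro!: small_UN small_image)

text \<open>What remains is that the translation maps the models of the presentation onto those of
  the theory; \<open>of_sorted\<close> supplies the preimages.\<close>

lemma slice_iso_sorted_theory:
  assumes T: "diagrammatic_presentation T"
  shows "slice_iso pow_vcat (presentation_Alg T) (theory_Alg (sorted_theory T))
    (sorted_comparison (fst T))"
proof -
  have \<Gamma>: "free_form_signature (fst T)" using T unfolding diagrammatic_presentation_def by blast
  let ?Z = "{A \<in> ff_algebras (fst T). \<forall>e\<in>snd T. ff_satisfies A e}"
  have sat: "(\<forall>e\<in>snd T. ff_satisfies A e)
      \<longleftrightarrow> (\<forall>d\<in>snd (sorted_theory T). satisfies (to_sorted (fst T) A) d)"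
    if "A \<in> ff_algebras (fst T)" for A
    using T satisfies_sorted_equation[OF \<Gamma> that]
    unfolding diagrammatic_presentation_def sorted_theory_def by auto
  have "to_sorted (fst T) ` ?Z = {B \<in> algebras (sorted_signature (fst T)).
      \<forall>d\<in>snd (sorted_theory T). satisfies B d}"
  proof (intro subset_antisym subsetI)
    fix B assume "B \<in> to_sorted (fst T) ` ?Z"
    then show "B \<in> {B \<in> algebras (sorted_signature (fst T)). \<forall>d\<in>snd (sorted_theory T). satisfies B d}"
      using to_sorted_in[OF \<Gamma>] sat by auto
  next
    fix B assume B: "B \<in> {B \<in> algebras (sorted_signature (fst T)). \<forall>d\<in>snd (sorted_theory T). satisfies B d}"
    then have "of_sorted (fst T) B \<in> ?Z" "B = to_sorted (fst T) (of_sorted (fst T) B)"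
      using of_sorted_in[OF \<Gamma>] to_of_sorted[OF \<Gamma>] sat by auto
    then show "B \<in> to_sorted (fst T) ` ?Z" by blast
  qed
  then show ?thesis
    using slice_iso_sorted[OF \<Gamma>, of ?Z]
    by (simp add: presentation_Alg_def theory_Alg_def sorted_theory_def)
qed

end

theorem proposition6p6:
  fixes V :: "('o, 'm) closed"
    and Uo :: "'o \<Rightarrow> 'u::set_universe" and Ua :: "'m \<Rightarrow> 'u set_arrow"
    and \<S> :: 'u
  assumes "topological V Uo Ua"
    and "symmetric_monoidal_closed V"
    and "strict_symmetric_monoidal V SET Uo Ua"
    and "represented_by V Uo Ua \<I>\<^bsub>V\<^esub>"
  shows "(\<forall>\<Gamma>. sorted_power.free_form_signature V \<S> \<Gamma> \<longrightarrow>
      (\<exists>\<Sigma> \<Phi>. sorted_power.signature V \<S> \<Sigma>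
        \<and> symmetric_monoidal_closed.slice_iso V (sorted_power.pow_vcat V \<S>)
            (sorted_power.ff_Alg V \<S> \<Gamma>) (sorted_power.Alg V \<S> \<Sigma>) \<Phi>
        \<and> (\<forall>e. sorted_power.diagrammatic_equation V \<S> \<Gamma> e \<longrightarrow>
            (\<exists>E. small TYPE('u) E
              \<and> (\<forall>d\<in>E. sorted_power.algebraic_equation V \<S> \<Sigma> d)
              \<and> (\<forall>A\<in>sorted_power.ff_algebras V \<S> \<Gamma>.
                   sorted_power.ff_satisfies A e
                   \<longleftrightarrow> (\<forall>d\<in>E. sorted_power.satisfies (fst \<Phi> A) d))))))
    \<and> (\<forall>T. sorted_power.diagrammatic_presentation V \<S> T \<longrightarrow>
      (\<exists>T'. sorted_power.equational_theory V \<S> T'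
        \<and> (\<exists>\<Phi>. symmetric_monoidal_closed.slice_iso V (sorted_power.pow_vcat V \<S>)
            (sorted_power.presentation_Alg V \<S> T) (sorted_power.theory_Alg V \<S> T') \<Phi>)))"
proof -
  interpret symmetric_monoidal_closed V by (rule assms(2))
  interpret sorted_topological V Uo Ua \<S> by unfold_locales (rule assms)+
  show ?thesis
  proof (intro conjI allI impI)
    fix \<Gamma> assume \<Gamma>: "free_form_signature \<Gamma>"
    have "\<exists>E. small TYPE('u) E \<and> (\<forall>d\<in>E. algebraic_equation (sorted_signature \<Gamma>) d)
        \<and> (\<forall>A\<in>ff_algebras \<Gamma>. ff_satisfies A e
             \<longleftrightarrow> (\<forall>d\<in>E. satisfies (fst (sorted_comparison \<Gamma>) A) d))"
      if e: "diagrammatic_equation \<Gamma> e" for e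
      using algebraic_sorted_equation[OF \<Gamma> e] satisfies_sorted_equation[OF \<Gamma> _ e]
      \<comment> \<open>One algebraic equation for each sort. \<Phi> is fixed before e, so the same
        isomorphism serves every equation; its object part is \<open>to_sorted\<close>.\<close>
      by (intro exI[of _ "sorted_equation \<Gamma> e ` elts \<S>"])
        (simp add: small_image sorted_comparison_def)
    then show "\<exists>\<Sigma> \<Phi>. signature \<Sigma> \<and> slice_iso pow_vcat (ff_Alg \<Gamma>) (Alg \<Sigma>) \<Phi>
        \<and> (\<forall>e. diagrammatic_equation \<Gamma> e \<longrightarrow>
            (\<exists>E. small TYPE('u) E \<and> (\<forall>d\<in>E. algebraic_equation \<Sigma> d)
              \<and> (\<forall>A\<in>ff_algebras \<Gamma>. ff_satisfies A e \<longleftrightarrow> (\<forall>d\<in>E. satisfies (fst \<Phi> A) d))))"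
      using signature_sorted[OF \<Gamma>] slice_iso_sorted_signature[OF \<Gamma>] by blast
  next
    fix T assume T: "diagrammatic_presentation T"
    show "\<exists>T'. equational_theory T' \<and> (\<exists>\<Phi>. slice_iso pow_vcat (presentation_Alg T) (theory_Alg T') \<Phi>)"
      using equational_sorted_theory[OF T] slice_iso_sorted_theory[OF T] by blast
  qed
qed

end
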